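(* Let $(R,\mathfrak{m})$ be a Noetherian local ring. If $\mathfrak{m}$ has finite projective dimension as an $R$-module, then $\mathfrak{m}$ is generated by an $R$-regular sequence.
   Context: Rings are commutative. A sequence $x_1,\dots,x_n$ ($n\ge0$) in $R$ is $R$-regular if each $x_j$ is a non-zero-divisor on $R/(x_1,\dots,x_{j-1})$ and $(x_1,\dots,x_n)\neq R$; the empty sequence generates the zero ideal. The zero module is regarded as having finite projective dimension. *)

theory Defs
  imports "HOL-Algebra.Algebra"
begin

definition local_ring :: "('a, 'r) ring_scheme \<Rightarrow> 'a set \<Rightarrow> bool" where
  "local_ring R \<mm> \<longleftrightarrow>
     cring R \<and> maximalideal \<mm> R \<and> (\<forall>J. maximalideal J R \<longrightarrow> J = \<mm>)"

text \<open>The record type of modules extends that of rings; its fields \<open>mult\<close> and \<open>one\<close> play no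
  role for a module and are filled in arbitrarily below.\<close>

definition ideal_module :: "('a, 'r) ring_scheme \<Rightarrow> 'a set \<Rightarrow> ('a, 'a) module" where
  "ideal_module R I =
     \<lparr>carrier = I, monoid.mult = (\<otimes>\<^bsub>R\<^esub>), one = \<one>\<^bsub>R\<^esub>, ring.zero = \<zero>\<^bsub>R\<^esub>,
      ring.add = (\<oplus>\<^bsub>R\<^esub>), smult = (\<otimes>\<^bsub>R\<^esub>)\<rparr>"

definition mod_hom ::
  "('a, 'r) ring_scheme \<Rightarrow> ('a, 'b, 'c) module_scheme \<Rightarrow> ('a, 'd, 'e) module_scheme
     \<Rightarrow> ('b \<Rightarrow> 'd) set" where
  "mod_hom R M N =
     {f \<in> carrier M \<rightarrow> carrier N.
        (\<forall>x\<in>carrier M. \<forall>y\<in>carrier M. f (x \<oplus>\<^bsub>M\<^esub> y) = f x \<oplus>\<^bsub>N\<^esub> f y) \<and>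
        (\<forall>a\<in>carrier R. \<forall>x\<in>carrier M. f (a \<odot>\<^bsub>M\<^esub> x) = a \<odot>\<^bsub>N\<^esub> f x)}"

text \<open>Projectivity is the lifting property against surjections. A formula of HOL cannot quantify
  over the carrier types of the test modules, so two types are fixed which are large enough: they
  admit the surjection from the free module on the carrier of \<open>P\<close> onto \<open>P\<close>. The lemma
  \<open>projective_module_lift\<close> below recovers the lifting property for test modules over
  arbitrary types.\<close>

definition projective_module :: "('a, 'r) ring_scheme \<Rightarrow> ('a, 'p) module \<Rightarrow> bool" where
  "projective_module R P \<longleftrightarrow>
     module R P \<and>
     (\<forall>(N :: ('a, 'p \<Rightarrow> 'a) module) (M :: ('a, 'p) module) g f.
        module R N \<longrightarrow> module R M \<longrightarrow>
        g \<in> mod_hom R N M \<longrightarrow> g ` carrier N = carrier M \<longrightarrow> f \<in> mod_hom R P M \<longrightarrow>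
        (\<exists>h\<in>mod_hom R P N. \<forall>x\<in>carrier P. g (h x) = f x))"

text \<open>An exact sequence \<open>0 \<rightarrow> P n \<rightarrow> \<dots> \<rightarrow> P 1 \<rightarrow> P 0 \<rightarrow> M \<rightarrow> 0\<close> with projective \<open>P i\<close>, continued by
  zero modules beyond \<open>n\<close>; \<open>d i\<close> goes from \<open>P (i + 1)\<close> to \<open>P i\<close> and \<open>e\<close> is the augmentation.\<close>

definition projective_resolution ::
  "('a, 'r) ring_scheme \<Rightarrow> ('a, 'm) module \<Rightarrow> nat \<Rightarrow>
     (nat \<Rightarrow> ('a, 'p) module) \<Rightarrow> (nat \<Rightarrow> 'p \<Rightarrow> 'p) \<Rightarrow> ('p \<Rightarrow> 'm) \<Rightarrow> bool" where
  "projective_resolution R M n P d e \<longleftrightarrow>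
     (\<forall>i. projective_module R (P i)) \<and>
     (\<forall>i>n. carrier (P i) = {\<zero>\<^bsub>P i\<^esub>}) \<and>
     e \<in> mod_hom R (P 0) M \<and>
     (\<forall>i. d i \<in> mod_hom R (P (Suc i)) (P i)) \<and>
     e ` carrier (P 0) = carrier M \<and>
     d 0 ` carrier (P (Suc 0)) = {x \<in> carrier (P 0). e x = \<zero>\<^bsub>M\<^esub>} \<and>
     (\<forall>i. d (Suc i) ` carrier (P (Suc (Suc i)))
            = {x \<in> carrier (P (Suc i)). d i x = \<zero>\<^bsub>P i\<^esub>})"

text \<open>The modules of the resolution live in the type \<open>'p\<close>. Having finite projective dimension means
  that this holds for some \<open>'p\<close>; a theorem which assumes it for a type variable \<open>'p\<close> therefore
  covers every finite projective resolution. (The members of a finite resolution can always be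
  moved into one common type, for instance the sum of their carrier types.)\<close>

definition finite_projective_dimension ::
  "'p itself \<Rightarrow> ('a, 'r) ring_scheme \<Rightarrow> ('a, 'm) module \<Rightarrow> bool" where
  "finite_projective_dimension (_ :: 'p itself) R M \<longleftrightarrow>
     module R M \<and>
     (\<exists>n (P :: nat \<Rightarrow> ('a, 'p) module) d e. projective_resolution R M n P d e)"

text \<open>\<open>xs ! j\<close> has to be a non-zero-divisor modulo the ideal generated by its predecessors
  \<open>take j xs\<close>.\<close>

definition regular_sequence :: "('a, 'r) ring_scheme \<Rightarrow> 'a list \<Rightarrow> bool" where
  "regular_sequence R xs \<longleftrightarrow>
     set xs \<subseteq> carrier R \<and>
     (\<forall>j<length xs. let Q = R Quot (Idl\<^bsub>R\<^esub> (set (take j xs))) in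
        \<forall>a\<in>carrier Q.
          (Idl\<^bsub>R\<^esub> (set (take j xs)) +>\<^bsub>R\<^esub> (xs ! j)) \<otimes>\<^bsub>Q\<^esub> a = \<zero>\<^bsub>Q\<^esub> \<longrightarrow> a = \<zero>\<^bsub>Q\<^esub>) \<and>
     Idl\<^bsub>R\<^esub> (set xs) \<noteq> carrier R"


subsection \<open>Adequacy of the definitions\<close>

lemma ideal_module_is_module:
  fixes R (structure)
  assumes "cring R" "ideal I R"
  shows "module R (ideal_module R I)"
proof -
  interpret cring R by fact
  interpret ideal I R by fact
  have "abelian_group (ideal_module R I)"
  proof (rule abelian_groupI)
    fix x assume "x \<in> carrier (ideal_module R I)"
    then have x: "x \<in> I" "x \<in> carrier R" using a_Hcarr by (auto simp: ideal_module_def)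
    then have "\<ominus> x \<in> I" "\<ominus> x \<oplus> x = \<zero>" by (auto simp: l_neg)
    then show "\<exists>y\<in>carrier (ideal_module R I).
                 y \<oplus>\<^bsub>ideal_module R I\<^esub> x = \<zero>\<^bsub>ideal_module R I\<^esub>"
      by (auto simp: ideal_module_def)
  qed (auto simp: ideal_module_def add.m_ac a_Hcarr)
  then show ?thesis
    by (intro moduleI)
      (auto simp: ideal_module_def a_Hcarr l_distr r_distr m_assoc I_l_closed is_cring)
qed

definition free_mod :: "('a, 'r) ring_scheme \<Rightarrow> 'p set \<Rightarrow> ('a, 'p \<Rightarrow> 'a) module" where
  "free_mod R B =
     \<lparr>carrier = {\<phi>. (\<forall>x. \<phi> x \<in> carrier R) \<and> {x. \<phi> x \<noteq> \<zero>\<^bsub>R\<^esub>} \<subseteq> B \<and> finite {x. \<phi> x \<noteq> \<zero>\<^bsub>R\<^esub>}},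
      monoid.mult = (\<lambda>\<phi> \<psi>. \<phi>), one = (\<lambda>_. \<zero>\<^bsub>R\<^esub>), ring.zero = (\<lambda>_. \<zero>\<^bsub>R\<^esub>),
      ring.add = (\<lambda>\<phi> \<psi> x. \<phi> x \<oplus>\<^bsub>R\<^esub> \<psi> x), smult = (\<lambda>a \<phi> x. a \<otimes>\<^bsub>R\<^esub> \<phi> x)\<rparr>"

definition free_ext ::
  "('a, 'r) ring_scheme \<Rightarrow> ('a, 'n, 'e) module_scheme \<Rightarrow> ('p \<Rightarrow> 'n) \<Rightarrow> ('p \<Rightarrow> 'a) \<Rightarrow> 'n" where
  "free_ext R N s \<phi> = (\<Oplus>\<^bsub>N\<^esub>x\<in>{x. \<phi> x \<noteq> \<zero>\<^bsub>R\<^esub>}. \<phi> x \<odot>\<^bsub>N\<^esub> s x)"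

lemma free_mod_module:
  fixes R (structure) and B :: "'p set"
  assumes "cring R"
  shows "module R (free_mod R B)"
proof -
  interpret cring R by fact
  have fin: "finite {x. \<phi> x \<oplus> \<psi> x \<noteq> \<zero>}"
    if "finite {x. \<phi> x \<noteq> \<zero>}" "finite {x. \<psi> x \<noteq> \<zero>}" for \<phi> \<psi> :: "'p \<Rightarrow> 'a"
    by (rule finite_subset[OF _ finite_UnI[OF that]]) auto
  have fin': "finite {x. a \<otimes> \<phi> x \<noteq> \<zero>}"
    if "finite {x. \<phi> x \<noteq> \<zero>}" "a \<in> carrier R" for a and \<phi> :: "'p \<Rightarrow> 'a"
    by (rule finite_subset[OF _ that(1)]) (use that(2) in auto)
  have "abelian_group (free_mod R B)"
  proof (rule abelian_groupI)
    fix \<phi> assume "\<phi> \<in> carrier (free_mod R B)"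
    then have p: "\<And>x. \<phi> x \<in> carrier R" "{x. \<phi> x \<noteq> \<zero>} \<subseteq> B" "finite {x. \<phi> x \<noteq> \<zero>}"
      by (auto simp: free_mod_def)
    have "{x. \<ominus> \<phi> x \<noteq> \<zero>} \<subseteq> {x. \<phi> x \<noteq> \<zero>}" by auto
    with p have "(\<lambda>x. \<ominus> \<phi> x) \<in> carrier (free_mod R B)"
      by (auto simp: free_mod_def intro: finite_subset)
    moreover have "(\<lambda>x. \<ominus> \<phi> x) \<oplus>\<^bsub>free_mod R B\<^esub> \<phi> = \<zero>\<^bsub>free_mod R B\<^esub>"
      using p by (auto simp: free_mod_def l_neg)
    ultimately show "\<exists>\<psi>\<in>carrier (free_mod R B). \<psi> \<oplus>\<^bsub>free_mod R B\<^esub> \<phi> = \<zero>\<^bsub>free_mod R B\<^esub>"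
      by blast
  next
    fix \<phi> \<psi> assume "\<phi> \<in> carrier (free_mod R B)" "\<psi> \<in> carrier (free_mod R B)"
    moreover have "{x. \<phi> x \<oplus> \<psi> x \<noteq> \<zero>} \<subseteq> {x. \<phi> x \<noteq> \<zero>} \<union> {x. \<psi> x \<noteq> \<zero>}"
      by auto
    ultimately show "\<phi> \<oplus>\<^bsub>free_mod R B\<^esub> \<psi> \<in> carrier (free_mod R B)"
      using fin[of \<phi> \<psi>] by (simp add: free_mod_def) blast
  qed (auto simp: free_mod_def add.m_ac fun_eq_iff)
  then show ?thesis
  proof (intro moduleI)
    fix a \<phi> assume "a \<in> carrier R" "\<phi> \<in> carrier (free_mod R B)"
    moreover from this have "{x. a \<otimes> \<phi> x \<noteq> \<zero>} \<subseteq> {x. \<phi> x \<noteq> \<zero>}"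
      by auto
    ultimately show "a \<odot>\<^bsub>free_mod R B\<^esub> \<phi> \<in> carrier (free_mod R B)"
      using fin'[of \<phi> a] by (simp add: free_mod_def) blast
  qed (auto simp: free_mod_def l_distr r_distr m_assoc is_cring)
qed

lemma mod_hom_zero:
  assumes "module R M" "module R N" "g \<in> mod_hom R M N"
  shows "g \<zero>\<^bsub>M\<^esub> = \<zero>\<^bsub>N\<^esub>"
proof -
  interpret M: module R M by fact
  interpret N: module R N by fact
  have "g (\<zero>\<^bsub>R\<^esub> \<odot>\<^bsub>M\<^esub> \<zero>\<^bsub>M\<^esub>) = \<zero>\<^bsub>R\<^esub> \<odot>\<^bsub>N\<^esub> g \<zero>\<^bsub>M\<^esub>" "g \<zero>\<^bsub>M\<^esub> \<in> carrier N"
    using assms(3) M.R.zero_closed M.M.zero_closed unfolding mod_hom_def by blast+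
  then show ?thesis by simp
qed

lemma mod_hom_finsum:
  assumes "module R M" "module R N" "g \<in> mod_hom R M N"
    and "finite A" "u \<in> A \<rightarrow> carrier M"
  shows "g (\<Oplus>\<^bsub>M\<^esub>x\<in>A. u x) = (\<Oplus>\<^bsub>N\<^esub>x\<in>A. g (u x))"
proof -
  interpret M: module R M by fact
  interpret N: module R N by fact
  have gc: "g x \<in> carrier N" if "x \<in> carrier M" for x
    using that assms(3) by (auto simp: mod_hom_def)
  have ga: "g (x \<oplus>\<^bsub>M\<^esub> y) = g x \<oplus>\<^bsub>N\<^esub> g y" if "x \<in> carrier M" "y \<in> carrier M" for x y
    using that assms(3) by (auto simp: mod_hom_def)
  show ?thesis using assms(4,5)
  proof (induction A rule: finite_induct)
    case empty
    then show ?case by (simp add: mod_hom_zero[OF assms(1-3)])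
  next
    case (insert a A)
    then have "u a \<in> carrier M" "u \<in> A \<rightarrow> carrier M" by auto
    moreover from this have "(\<lambda>x. g (u x)) \<in> A \<rightarrow> carrier N" using gc by auto
    ultimately show ?case using insert by (simp add: ga gc)
  qed
qed

lemma free_ext_superset:
  assumes "module R N" "finite A" "{x. \<phi> x \<noteq> \<zero>\<^bsub>R\<^esub>} \<subseteq> A"
    and "\<And>x. \<phi> x \<in> carrier R" "s \<in> A \<rightarrow> carrier N"
  shows "free_ext R N s \<phi> = (\<Oplus>\<^bsub>N\<^esub>x\<in>A. \<phi> x \<odot>\<^bsub>N\<^esub> s x)"
proof -
  interpret N: module R N by fact
  show ?thesis unfolding free_ext_def
    by (rule N.add.finprod_mono_neutral_cong_left) (use assms in \<open>auto simp: Pi_iff\<close>)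
qed

lemma free_ext_hom:
  assumes "module R N" and s: "s \<in> B \<rightarrow> carrier N"
  shows "free_ext R N s \<in> mod_hom R (free_mod R B) N"
proof -
  interpret N: module R N by fact
  let ?F = "free_mod R B"
  interpret F: module R ?F by (rule free_mod_module[OF N.R.is_cring])
  have c: "\<phi> x \<in> carrier R" "{x. \<phi> x \<noteq> \<zero>\<^bsub>R\<^esub>} \<subseteq> B" "finite {x. \<phi> x \<noteq> \<zero>\<^bsub>R\<^esub>}"
    if "\<phi> \<in> carrier ?F" for \<phi> x
    using that by (auto simp: free_mod_def)
  have "free_ext R N s \<phi> \<in> carrier N" if "\<phi> \<in> carrier ?F" for \<phi>
    unfolding free_ext_def by (rule N.M.finsum_closed) (use c[OF that] s in auto)
  moreover have "free_ext R N s (\<phi> \<oplus>\<^bsub>?F\<^esub> \<psi>) = free_ext R N s \<phi> \<oplus>\<^bsub>N\<^esub> free_ext R N s \<psi>"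
    if p: "\<phi> \<in> carrier ?F" "\<psi> \<in> carrier ?F" for \<phi> \<psi>
  proof -
    define A where "A = {x. \<phi> x \<noteq> \<zero>\<^bsub>R\<^esub>} \<union> {x. \<psi> x \<noteq> \<zero>\<^bsub>R\<^esub>}"
    have A: "finite A" "A \<subseteq> B" using c[OF p(1)] c[OF p(2)] by (auto simp: A_def)
    have sA: "s \<in> A \<rightarrow> carrier N" using A s by auto
    have e: "(\<phi> \<oplus>\<^bsub>?F\<^esub> \<psi>) x = \<phi> x \<oplus>\<^bsub>R\<^esub> \<psi> x" for x by (simp add: free_mod_def)
    have sub: "{x. (\<phi> \<oplus>\<^bsub>?F\<^esub> \<psi>) x \<noteq> \<zero>\<^bsub>R\<^esub>} \<subseteq> A" by (auto simp: e A_def)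
    have "free_ext R N s (\<phi> \<oplus>\<^bsub>?F\<^esub> \<psi>) = (\<Oplus>\<^bsub>N\<^esub>x\<in>A. (\<phi> x \<oplus>\<^bsub>R\<^esub> \<psi> x) \<odot>\<^bsub>N\<^esub> s x)"
      using free_ext_superset[OF assms(1) A(1) sub _ sA] c(1)[OF F.M.a_closed[OF p]]
      unfolding e by blast
    also have "\<dots> = (\<Oplus>\<^bsub>N\<^esub>x\<in>A. \<phi> x \<odot>\<^bsub>N\<^esub> s x \<oplus>\<^bsub>N\<^esub> \<psi> x \<odot>\<^bsub>N\<^esub> s x)"
      by (rule N.M.finsum_cong')
        (use c(1)[OF p(1)] c(1)[OF p(2)] sA in \<open>auto simp: N.smult_l_distr Pi_iff\<close>)
    also have "\<dots> = (\<Oplus>\<^bsub>N\<^esub>x\<in>A. \<phi> x \<odot>\<^bsub>N\<^esub> s x) \<oplus>\<^bsub>N\<^esub> (\<Oplus>\<^bsub>N\<^esub>x\<in>A. \<psi> x \<odot>\<^bsub>N\<^esub> s x)"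
      by (rule N.M.finsum_addf) (use c(1)[OF p(1)] c(1)[OF p(2)] sA in auto)
    also have "\<dots> = free_ext R N s \<phi> \<oplus>\<^bsub>N\<^esub> free_ext R N s \<psi>"
      using free_ext_superset[OF assms(1) A(1) _ _ sA, of \<phi>]
        free_ext_superset[OF assms(1) A(1) _ _ sA, of \<psi>] c[OF p(1)] c[OF p(2)]
      by (simp add: A_def)
    finally show ?thesis .
  qed
  moreover have "free_ext R N s (a \<odot>\<^bsub>?F\<^esub> \<phi>) = a \<odot>\<^bsub>N\<^esub> free_ext R N s \<phi>"
    if a: "a \<in> carrier R" and p: "\<phi> \<in> carrier ?F" for a \<phi>
  proof -
    define A where "A = {x. \<phi> x \<noteq> \<zero>\<^bsub>R\<^esub>}"
    have A: "finite A" "A \<subseteq> B" using c[OF p] by (auto simp: A_def)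
    have sA: "s \<in> A \<rightarrow> carrier N" using A s by auto
    have e: "(a \<odot>\<^bsub>?F\<^esub> \<phi>) x = a \<otimes>\<^bsub>R\<^esub> \<phi> x" for x by (simp add: free_mod_def)
    have sub: "{x. (a \<odot>\<^bsub>?F\<^esub> \<phi>) x \<noteq> \<zero>\<^bsub>R\<^esub>} \<subseteq> A" using a by (auto simp: e A_def)
    have "free_ext R N s (a \<odot>\<^bsub>?F\<^esub> \<phi>) = (\<Oplus>\<^bsub>N\<^esub>x\<in>A. (a \<otimes>\<^bsub>R\<^esub> \<phi> x) \<odot>\<^bsub>N\<^esub> s x)"
      using free_ext_superset[OF assms(1) A(1) sub _ sA] c(1)[OF F.smult_closed[OF a p]]
      unfolding e by blast
    also have "\<dots> = (\<Oplus>\<^bsub>N\<^esub>x\<in>A. a \<odot>\<^bsub>N\<^esub> (\<phi> x \<odot>\<^bsub>N\<^esub> s x))"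
      by (rule N.M.finsum_cong') (use a c(1)[OF p] sA in \<open>auto simp: N.smult_assoc1 Pi_iff\<close>)
    also have "\<dots> = a \<odot>\<^bsub>N\<^esub> (\<Oplus>\<^bsub>N\<^esub>x\<in>A. \<phi> x \<odot>\<^bsub>N\<^esub> s x)"
      by (rule N.finsum_smult_ldistr[symmetric]) (use A a c(1)[OF p] sA in auto)
    finally show ?thesis by (simp add: free_ext_def A_def)
  qed
  ultimately show ?thesis by (auto simp: mod_hom_def)
qed

lemma projective_module_lift:
  fixes P :: "('a, 'p) module"
    and N :: "('a, 'n, 'e) module_scheme" and M :: "('a, 'm, 'f) module_scheme"
  assumes P: "projective_module R P" and N: "module R N" and M: "module R M"
    and g: "g \<in> mod_hom R N M" "g ` carrier N = carrier M" and f: "f \<in> mod_hom R P M"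
  shows "\<exists>h\<in>mod_hom R P N. \<forall>x\<in>carrier P. g (h x) = f x"
proof -
  have mP: "module R P" using P by (simp add: projective_module_def)
  interpret P: module R P by fact
  interpret N: module R N by fact
  interpret M: module R M by fact
  define F where "F = free_mod R (carrier P)"
  have mF: "module R F" unfolding F_def by (rule free_mod_module[OF P.R.is_cring])
  define eps where "eps = free_ext R P (\<lambda>x. x)"
  have eps: "eps \<in> mod_hom R F P"
    unfolding eps_def F_def by (rule free_ext_hom[OF mP]) auto
  have surj: "eps ` carrier F = carrier P"
  proof
    show "eps ` carrier F \<subseteq> carrier P" using eps by (auto simp: mod_hom_def)
    show "carrier P \<subseteq> eps ` carrier F"
    proof
      fix x assume x: "x \<in> carrier P"
      define \<phi> where "\<phi> = (\<lambda>y. if y = x then \<one>\<^bsub>R\<^esub> else \<zero>\<^bsub>R\<^esub>)"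
      have sub: "{y. \<phi> y \<noteq> \<zero>\<^bsub>R\<^esub>} \<subseteq> {x}" by (auto simp: \<phi>_def)
      have "\<phi> \<in> carrier F"
        using x sub finite_subset[OF sub] by (auto simp: F_def free_mod_def \<phi>_def)
      moreover have "eps \<phi> = (\<Oplus>\<^bsub>P\<^esub>y\<in>{x}. \<phi> y \<odot>\<^bsub>P\<^esub> y)"
        unfolding eps_def by (rule free_ext_superset[OF mP _ sub]) (use x in \<open>auto simp: \<phi>_def\<close>)
      moreover have "(\<Oplus>\<^bsub>P\<^esub>y\<in>{x}. \<phi> y \<odot>\<^bsub>P\<^esub> y) = x"
        using x by (simp add: \<phi>_def)
      ultimately show "x \<in> eps ` carrier F" by (metis image_eqI)
    qed
  qed
  have "(\<lambda>x. x) \<in> mod_hom R P P" by (auto simp: mod_hom_def)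
  then obtain h where h: "h \<in> mod_hom R P F" "\<And>x. x \<in> carrier P \<Longrightarrow> eps (h x) = x"
    using P mF mP eps surj unfolding projective_module_def by blast
  have "\<forall>x\<in>carrier P. \<exists>y\<in>carrier N. g y = f x"
  proof
    fix x assume "x \<in> carrier P"
    then have "f x \<in> g ` carrier N" using f g(2) by (auto simp: mod_hom_def)
    then show "\<exists>y\<in>carrier N. g y = f x" by (metis imageE)
  qed
  then obtain s where s: "\<And>x. x \<in> carrier P \<Longrightarrow> s x \<in> carrier N \<and> g (s x) = f x" by metis
  define k where "k = free_ext R N s"
  have k: "k \<in> mod_hom R F N"
    unfolding k_def F_def by (rule free_ext_hom[OF N]) (use s in auto)
  have gk: "g (k \<phi>) = f (eps \<phi>)" if p: "\<phi> \<in> carrier F" for \<phi>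
  proof -
    let ?A = "{x. \<phi> x \<noteq> \<zero>\<^bsub>R\<^esub>}"
    have c: "\<And>x. \<phi> x \<in> carrier R" "?A \<subseteq> carrier P" "finite ?A"
      using p by (auto simp: F_def free_mod_def)
    have "g (k \<phi>) = (\<Oplus>\<^bsub>M\<^esub>x\<in>?A. g (\<phi> x \<odot>\<^bsub>N\<^esub> s x))"
      unfolding k_def free_ext_def
      by (rule mod_hom_finsum[OF N M g(1) c(3)]) (use c s in auto)
    also have "\<dots> = (\<Oplus>\<^bsub>M\<^esub>x\<in>?A. f (\<phi> x \<odot>\<^bsub>P\<^esub> x))"
    proof (rule M.M.finsum_cong')
      fix x assume "x \<in> ?A"
      then have x: "x \<in> carrier P" using c by auto
      show "g (\<phi> x \<odot>\<^bsub>N\<^esub> s x) = f (\<phi> x \<odot>\<^bsub>P\<^esub> x)"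
        using f g(1) c(1) s[OF x] x by (simp add: mod_hom_def)
    qed (use f c in \<open>auto simp: mod_hom_def Pi_iff subset_iff\<close>)
    also have "\<dots> = f (eps \<phi>)"
      unfolding eps_def free_ext_def
      by (rule mod_hom_finsum[OF mP M f c(3), symmetric]) (use c in auto)
    finally show ?thesis .
  qed
  have hF: "h x \<in> carrier F" if "x \<in> carrier P" for x
    using h(1) that by (auto simp: mod_hom_def)
  have "(\<lambda>x. k (h x)) \<in> mod_hom R P N"
    using h(1) k by (auto simp: mod_hom_def Pi_iff)
  moreover have "\<forall>x\<in>carrier P. g (k (h x)) = f x"
    using gk hF h(2) by auto
  ultimately show ?thesis by (intro bexI[where x = "\<lambda>x. k (h x)"])
qed

end

theory Submission
  imports Defs
begin

text \<open>Let \<open>\<mm> \<noteq> 0\<close>. A minimal finite free resolution of \<open>\<mm>\<close> shows that no \<open>a \<noteq> 0\<close> is killed by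
  \<open>\<mm>\<close>: such an \<open>a\<close> would kill the last free module of the resolution. Hence \<open>\<mm>\<close> is not contained in
  any maximal annihilator, and prime avoidance yields a minimal generating system
  \<open>z, g\<^sub>1, \<dots>, g\<^sub>c\<close> of \<open>\<mm>\<close> in which \<open>z\<close> is a non-zero-divisor. Let \<open>K\<close> be its module of relations. Tensoring
  the resolution of \<open>K\<close> with \<open>S = R/(z)\<close> keeps it exact and minimal, so the image of \<open>K\<close> in the
  free \<open>S\<close>-module has a finite resolution. By minimality the \<open>z\<close>-coordinate of every relation lies
  in \<open>\<mm>\<close>, and \<open>(s, 0, \<dots>, 0)\<close> lifts to a relation for all \<open>s \<in> \<mm>\<close>; thus the maximal ideal of \<open>S\<close> is a
  retract of this image and has itself a finite resolution. It needs one generator less, and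
  induction applies.

  That finite projective resolutions pass to retracts and yield finite minimal free ones is seen
  without Schanuel's lemma: if the identity of \<open>A\<close> factors through \<open>B\<close> up to a map that factors
  through a finite free module, the same holds for their syzygies. When the syzygy of \<open>B\<close>
  vanishes, the kernel of the next minimal cover \<open>F\<close> of \<open>A\<close> is the image of an idempotent of \<open>F\<close>
  and lies in \<open>\<mm>F\<close>, so it is zero.\<close>

section \<open>Homomorphisms of modules and free modules\<close>

lemma mod_homI:
  assumes "\<And>x. x \<in> carrier M \<Longrightarrow> f x \<in> carrier N"
    and "\<And>x y. x \<in> carrier M \<Longrightarrow> y \<in> carrier M \<Longrightarrow> f (x \<oplus>\<^bsub>M\<^esub> y) = f x \<oplus>\<^bsub>N\<^esub> f y"
    and "\<And>a x. a \<in> carrier R \<Longrightarrow> x \<in> carrier M \<Longrightarrow> f (a \<odot>\<^bsub>M\<^esub> x) = a \<odot>\<^bsub>N\<^esub> f x"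
  shows "f \<in> mod_hom R M N"
  using assms by (auto simp: mod_hom_def)

lemma mod_homD:
  assumes "f \<in> mod_hom R M N"
  shows "x \<in> carrier M \<Longrightarrow> f x \<in> carrier N"
    and "x \<in> carrier M \<Longrightarrow> y \<in> carrier M \<Longrightarrow> f (x \<oplus>\<^bsub>M\<^esub> y) = f x \<oplus>\<^bsub>N\<^esub> f y"
    and "a \<in> carrier R \<Longrightarrow> x \<in> carrier M \<Longrightarrow> f (a \<odot>\<^bsub>M\<^esub> x) = a \<odot>\<^bsub>N\<^esub> f x"
  using assms by (auto simp: mod_hom_def)

lemma mod_hom_comp:
  "f \<in> mod_hom R M N \<Longrightarrow> g \<in> mod_hom R N L \<Longrightarrow> (\<lambda>x. g (f x)) \<in> mod_hom R M L"
  by (rule mod_homI) (auto simp: mod_homD)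

lemma (in module) neg_eq_smult: "x \<in> carrier M \<Longrightarrow> \<ominus>\<^bsub>M\<^esub> x = (\<ominus>\<^bsub>R\<^esub> \<one>\<^bsub>R\<^esub>) \<odot>\<^bsub>M\<^esub> x"
  by (simp add: smult_l_minus)

lemma (in module) submoduleI':
  assumes "H \<subseteq> carrier M" "\<zero>\<^bsub>M\<^esub> \<in> H" "\<And>a b. \<lbrakk>a \<in> H; b \<in> H\<rbrakk> \<Longrightarrow> a \<oplus>\<^bsub>M\<^esub> b \<in> H"
    and "\<And>a x. \<lbrakk>a \<in> carrier R; x \<in> H\<rbrakk> \<Longrightarrow> a \<odot>\<^bsub>M\<^esub> x \<in> H"
  shows "submodule H R M"
  by (rule submoduleI) (use assms neg_eq_smult in auto)

lemma submoduleD: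
  assumes "module R M" "submodule H R M"
  shows "H \<subseteq> carrier M" "\<zero>\<^bsub>M\<^esub> \<in> H" "\<And>a b. \<lbrakk>a \<in> H; b \<in> H\<rbrakk> \<Longrightarrow> a \<oplus>\<^bsub>M\<^esub> b \<in> H"
    and "\<And>a x. \<lbrakk>a \<in> carrier R; x \<in> H\<rbrakk> \<Longrightarrow> a \<odot>\<^bsub>M\<^esub> x \<in> H"
proof -
  interpret module R M by fact
  interpret submodule H R M by fact
  show "H \<subseteq> carrier M" "\<And>a b. \<lbrakk>a \<in> H; b \<in> H\<rbrakk> \<Longrightarrow> a \<oplus>\<^bsub>M\<^esub> b \<in> H"
    "\<And>a x. \<lbrakk>a \<in> carrier R; x \<in> H\<rbrakk> \<Longrightarrow> a \<odot>\<^bsub>M\<^esub> x \<in> H"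
    using submoduleE[OF assms(2)] by auto
  show "\<zero>\<^bsub>M\<^esub> \<in> H" using subgroup.one_closed[OF subgroup_axioms] by simp
qed

lemma submodule_module:
  "module R M \<Longrightarrow> submodule H R M \<Longrightarrow> module R (M\<lparr>carrier := H\<rparr>)"
  by (rule submodule.submodule_is_module)

definition ker where "ker M N f = {x \<in> carrier M. f x = \<zero>\<^bsub>N\<^esub>}"

lemma ker_submodule:
  assumes M: "module R M" and N: "module R N" and f: "f \<in> mod_hom R M N"
  shows "submodule (ker M N f) R M"
proof -
  interpret M: module R M by fact
  interpret N: module R N by fact
  show ?thesis
    by (rule M.submoduleI') (auto simp: ker_def mod_homD[OF f] mod_hom_zero[OF M N f])
qed

lemma image_submodule:
  assumes M: "module R M" and N: "module R N" and f: "f \<in> mod_hom R M N"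
  shows "submodule (f ` carrier M) R N"
proof -
  interpret M: module R M by fact
  interpret N: module R N by fact
  show ?thesis
  proof (rule N.submoduleI')
    show "\<zero>\<^bsub>N\<^esub> \<in> f ` carrier M"
      using mod_hom_zero[OF M N f] by (metis M.M.zero_closed image_eqI)
  next
    fix a b assume "a \<in> f ` carrier M" "b \<in> f ` carrier M"
    then obtain x y where "x \<in> carrier M" "y \<in> carrier M" "a = f x" "b = f y" by blast
    then show "a \<oplus>\<^bsub>N\<^esub> b \<in> f ` carrier M"
      by (intro image_eqI[of _ _ "x \<oplus>\<^bsub>M\<^esub> y"]) (auto simp: mod_homD[OF f])
  next
    fix a b assume a: "a \<in> carrier R" "b \<in> f ` carrier M"
    then obtain x where "x \<in> carrier M" "b = f x" by blast
    with a show "a \<odot>\<^bsub>N\<^esub> b \<in> f ` carrier M"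
      by (intro image_eqI[of _ _ "a \<odot>\<^bsub>M\<^esub> x"]) (auto simp: mod_homD[OF f])
  qed (use mod_homD[OF f] in auto)
qed

section \<open>Finite free modules: bases, linear maps out of them, lifting\<close>

definition unit_vec :: "('a, 'r) ring_scheme \<Rightarrow> 'p \<Rightarrow> 'p \<Rightarrow> 'a" where
  "unit_vec R i = (\<lambda>k. if k = i then \<one>\<^bsub>R\<^esub> else \<zero>\<^bsub>R\<^esub>)"

lemma free_mod_sel:
  "v \<oplus>\<^bsub>free_mod R I\<^esub> w = (\<lambda>k. v k \<oplus>\<^bsub>R\<^esub> w k)"
  "a \<odot>\<^bsub>free_mod R I\<^esub> v = (\<lambda>k. a \<otimes>\<^bsub>R\<^esub> v k)"
  "\<zero>\<^bsub>free_mod R I\<^esub> = (\<lambda>k. \<zero>\<^bsub>R\<^esub>)"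
  by (auto simp: free_mod_def)

lemma free_mod_carrier:
  assumes "finite I"
  shows "v \<in> carrier (free_mod R I) \<longleftrightarrow> (\<forall>k. v k \<in> carrier R) \<and> (\<forall>k. k \<notin> I \<longrightarrow> v k = \<zero>\<^bsub>R\<^esub>)"
proof -
  have "finite {k. v k \<noteq> \<zero>\<^bsub>R\<^esub>}" if "{k. v k \<noteq> \<zero>\<^bsub>R\<^esub>} \<subseteq> I"
    by (rule finite_subset[OF that assms])
  then show ?thesis by (auto simp: free_mod_def)
qed

context cring
begin

lemma unit_vec_closed: "i \<in> I \<Longrightarrow> unit_vec R i \<in> carrier (free_mod R I)"
  by (auto simp: free_mod_def unit_vec_def)

text \<open>Builds \<open>v\<close> up coordinate by coordinate, through its truncations to subsets
  of \<open>I\<close>. The vector \<open>v\<close> stays fixed and only its own entries occur as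
  scalars, so facts such as \<open>v i \<in> \<mm>\<close> are available in the induction
  step.\<close>

lemma free_mod_induct:
  fixes I :: "'p set"
  assumes I: "finite I" and v: "v \<in> carrier (free_mod R I)"
    and z: "P (\<lambda>k. \<zero>)"
    and s: "\<And>i w. i \<in> I \<Longrightarrow> w \<in> carrier (free_mod R I) \<Longrightarrow> P w \<Longrightarrow>
      P (w \<oplus>\<^bsub>free_mod R I\<^esub> v i \<odot>\<^bsub>free_mod R I\<^esub> unit_vec R i)"
  shows "P v"
proof -
  have vc: "\<And>k. v k \<in> carrier R" "\<And>k. k \<notin> I \<Longrightarrow> v k = \<zero>"
    using v by (auto simp: free_mod_carrier[OF I])
  have "P (\<lambda>k. if k \<in> J then v k else \<zero>)" if "J \<subseteq> I" "finite J" for J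
    using that(2,1)
  proof (induction J rule: finite_induct)
    case empty
    then show ?case using z by simp
  next
    case (insert j J)
    let ?w = "\<lambda>k. if k \<in> J then v k else \<zero>"
    have w: "?w \<in> carrier (free_mod R I)" using insert vc by (auto simp: free_mod_carrier[OF I])
    have "?w \<oplus>\<^bsub>free_mod R I\<^esub> v j \<odot>\<^bsub>free_mod R I\<^esub> unit_vec R j = (\<lambda>k. if k \<in> insert j J then v k else \<zero>)"
      using insert vc by (auto simp: free_mod_sel unit_vec_def fun_eq_iff)
    then show ?case using s[of j ?w] w insert by auto
  qed
  from this[OF subset_refl I] have "P (\<lambda>k. if k \<in> I then v k else \<zero>)" .
  moreover have "(\<lambda>k. if k \<in> I then v k else \<zero>) = v" using vc by auto
  ultimately show ?thesis by simp
qed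

lemma free_mod_hom_exists:
  fixes I :: "'p set" and N :: "('a, 'n, 'e) module_scheme"
  assumes N: "module R N" and I: "finite I" and s: "\<And>i. i \<in> I \<Longrightarrow> s i \<in> carrier N"
  shows "\<exists>h\<in>mod_hom R (free_mod R I) N. \<forall>i\<in>I. h (unit_vec R i) = s i"
proof (intro bexI ballI)
  interpret N: module R N by fact
  show "free_ext R N s \<in> mod_hom R (free_mod R I) N"
    by (rule free_ext_hom[OF N]) (use s in auto)
  fix i assume i: "i \<in> I"
  have "free_ext R N s (unit_vec R i) = (\<Oplus>\<^bsub>N\<^esub>x\<in>{i}. unit_vec R i x \<odot>\<^bsub>N\<^esub> s x)"
    by (rule free_ext_superset[OF N]) (use i s in \<open>auto simp: unit_vec_def\<close>)
  then show "free_ext R N s (unit_vec R i) = s i"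
    using s[OF i] by (simp add: unit_vec_def)
qed

lemma free_mod_hom_eq:
  fixes I :: "'p set"
  assumes N: "module R N" and I: "finite I"
    and f: "f \<in> mod_hom R (free_mod R I) N" and g: "g \<in> mod_hom R (free_mod R I) N"
    and eq: "\<And>i. i \<in> I \<Longrightarrow> f (unit_vec R i) = g (unit_vec R i)"
    and v: "v \<in> carrier (free_mod R I)"
  shows "f v = g v"
proof (rule free_mod_induct[OF I v, where P = "\<lambda>v. f v = g v"])
  have F: "module R (free_mod R I)" by (rule free_mod_module[OF is_cring])
  interpret F: module R "free_mod R I" by fact
  show "f (\<lambda>k. \<zero>) = g (\<lambda>k. \<zero>)"
    using mod_hom_zero[OF F N f] mod_hom_zero[OF F N g] by (simp add: free_mod_sel)
  fix i w assume i: "i \<in> I" "w \<in> carrier (free_mod R I)" "f w = g w"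
  have "v i \<in> carrier R" using v by (simp add: free_mod_carrier[OF I])
  then show "f (w \<oplus>\<^bsub>free_mod R I\<^esub> v i \<odot>\<^bsub>free_mod R I\<^esub> unit_vec R i)
    = g (w \<oplus>\<^bsub>free_mod R I\<^esub> v i \<odot>\<^bsub>free_mod R I\<^esub> unit_vec R i)"
    using i unit_vec_closed[OF i(1)] eq by (simp add: mod_homD[OF f] mod_homD[OF g])
qed

text \<open>Preimages are chosen for the unit vectors and extended linearly. The types of
  \<open>N\<close> and \<open>M\<close> are arbitrary, so this gives
  \<open>free_mod_projective\<close> and also serves directly for lifting along covers.\<close>

lemma free_mod_lift:
  fixes I :: "'p set" and N :: "('a, 'n, 'e) module_scheme" and M :: "('a, 'm, 'f) module_scheme"
  assumes I: "finite I" and N: "module R N" and M: "module R M"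
    and g: "g \<in> mod_hom R N M" "g ` carrier N = carrier M" and f: "f \<in> mod_hom R (free_mod R I) M"
  shows "\<exists>h\<in>mod_hom R (free_mod R I) N. \<forall>x\<in>carrier (free_mod R I). g (h x) = f x"
proof -
  have "\<forall>i\<in>I. \<exists>y\<in>carrier N. g y = f (unit_vec R i)"
    using mod_homD(1)[OF f unit_vec_closed] g(2) by (metis imageE)
  then obtain s where s: "\<And>i. i \<in> I \<Longrightarrow> s i \<in> carrier N \<and> g (s i) = f (unit_vec R i)" by metis
  then obtain h where h: "h \<in> mod_hom R (free_mod R I) N" "\<And>i. i \<in> I \<Longrightarrow> h (unit_vec R i) = s i"
    using free_mod_hom_exists[OF N I, of s] by auto
  have "g (h x) = f x" if "x \<in> carrier (free_mod R I)" for x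
    by (rule free_mod_hom_eq[OF M I mod_hom_comp[OF h(1) g(1)] f _ that]) (use h s in auto)
  with h(1) show ?thesis by blast
qed

lemma free_mod_projective:
  assumes "finite I"
  shows "projective_module R (free_mod R I)"
  unfolding projective_module_def
  by (intro conjI allI impI free_mod_module[OF is_cring] free_mod_lift[OF assms])

end

section \<open>Submodules of free modules over Noetherian rings, stable retracts\<close>

lemma (in cring) idealI':
  assumes "J \<subseteq> carrier R" "\<zero> \<in> J" "\<And>a b. a \<in> J \<Longrightarrow> b \<in> J \<Longrightarrow> a \<oplus> b \<in> J"
    and m: "\<And>a x. x \<in> carrier R \<Longrightarrow> a \<in> J \<Longrightarrow> x \<otimes> a \<in> J"
  shows "ideal J R"
proof (rule idealI[OF ring_axioms])
  show "subgroup J (add_monoid R)"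
  proof
    fix x assume "x \<in> J"
    then have "(\<ominus> \<one>) \<otimes> x \<in> J" "x \<in> carrier R" using m assms(1) by auto
    then show "inv\<^bsub>add_monoid R\<^esub> x \<in> J" by (simp add: l_minus flip: a_inv_def)
  qed (use assms in auto)
  fix a x assume "a \<in> J" "x \<in> carrier R"
  then show "x \<otimes> a \<in> J" "a \<otimes> x \<in> J" using m[of x a] assms(1) m_comm[of a x] by auto
qed

text \<open>A ring record is not a module record over itself, so linearity of \<open>f\<close> into
  \<open>R\<close> is spelled out instead of using \<open>mod_hom\<close>. The lemma is applied to
  coordinate functions.\<close>

lemma submodule_image_ideal:
  assumes M: "module R M" and K: "submodule K R M"
    and f: "\<And>x. x \<in> carrier M \<Longrightarrow> f x \<in> carrier R"
      "\<And>x y. x \<in> carrier M \<Longrightarrow> y \<in> carrier M \<Longrightarrow> f (x \<oplus>\<^bsub>M\<^esub> y) = f x \<oplus>\<^bsub>R\<^esub> f y"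
      "\<And>a x. a \<in> carrier R \<Longrightarrow> x \<in> carrier M \<Longrightarrow> f (a \<odot>\<^bsub>M\<^esub> x) = a \<otimes>\<^bsub>R\<^esub> f x"
  shows "ideal (f ` K) R"
proof -
  interpret M: module R M by fact
  note k = submoduleD[OF M K]
  show ?thesis
  proof (rule M.R.idealI')
    have "f \<zero>\<^bsub>M\<^esub> = \<zero>\<^bsub>R\<^esub>"
      using f(1)[of "\<zero>\<^bsub>M\<^esub>"] f(3)[of "\<zero>\<^bsub>R\<^esub>" "\<zero>\<^bsub>M\<^esub>"] by simp
    then show "\<zero>\<^bsub>R\<^esub> \<in> f ` K" using k(2) by (metis image_eqI)
  next
    fix a b assume "a \<in> f ` K" "b \<in> f ` K"
    then obtain x y where x: "x \<in> K" "y \<in> K" "a = f x" "b = f y" by blast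
    moreover have "a \<oplus>\<^bsub>R\<^esub> b = f (x \<oplus>\<^bsub>M\<^esub> y)" using x f(2)[OF subsetD[OF k(1)] subsetD[OF k(1)]] by simp
    ultimately show "a \<oplus>\<^bsub>R\<^esub> b \<in> f ` K" using k(3) by blast
  next
    fix a r assume r: "r \<in> carrier R" "a \<in> f ` K"
    then obtain x where x: "x \<in> K" "a = f x" by blast
    moreover have "r \<otimes>\<^bsub>R\<^esub> a = f (r \<odot>\<^bsub>M\<^esub> x)" using x f(3)[OF r(1) subsetD[OF k(1)]] by simp
    ultimately show "r \<otimes>\<^bsub>R\<^esub> a \<in> f ` K" using k(4) r by blast
  qed (use k f in auto)
qed

lemma submodule_Int:
  assumes M: "module R M" and "submodule K R M" "submodule L R M"
  shows "submodule (K \<inter> L) R M"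
proof -
  interpret M: module R M by fact
  show ?thesis
    by (rule M.submoduleI') (use submoduleD[OF M assms(2)] submoduleD[OF M assms(3)] in auto)
qed

text \<open>Induction on the rank. The vectors of \<open>K\<close> with vanishing coordinate
  \<open>n\<close> are handled by the induction hypothesis; the \<open>n\<close>-th coordinates of
  \<open>K\<close> form a finitely generated ideal, whose generators are lifted to \<open>K\<close>.
  Generation is expressed through the submodules that contain \<open>S\<close>, which avoids
  spans.\<close>

lemma free_mod_submodule_fg:
  fixes I :: "'p set"
  assumes R: "cring R" "noetherian_ring R" and I: "finite I" and K: "submodule K R (free_mod R I)"
  shows "\<exists>S. finite S \<and> S \<subseteq> K \<and> (\<forall>L. submodule L R (free_mod R I) \<longrightarrow> S \<subseteq> L \<longrightarrow> K \<subseteq> L)"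
  using I K
proof (induction I arbitrary: K rule: finite_induct)
  case empty
  interpret cring R by fact
  have F: "module R (free_mod R {})" by (rule free_mod_module[OF R(1)])
  have "K \<subseteq> {\<lambda>k. \<zero>\<^bsub>R\<^esub>}"
    using submoduleD(1)[OF F empty] by (fastforce simp: free_mod_carrier fun_eq_iff)
  then have "K \<subseteq> L" if "submodule L R (free_mod R {})" for L
    using submoduleD(2)[OF F that] by (auto simp: free_mod_sel)
  then show ?case by (intro exI[of _ "{}"]) auto
next
  case (insert n I)
  interpret cring R by fact
  interpret N: noetherian_ring R by fact
  let ?F = "free_mod R (insert n I)" and ?G = "free_mod R I"
  have F: "module R ?F" and G: "module R ?G" by (rule free_mod_module[OF R(1)])+
  interpret F: module R ?F by fact
  interpret G: module R ?G by fact
  note k = submoduleD[OF F insert.prems]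
  have fI: "finite (insert n I)" using insert by simp
  have mem: "v \<in> carrier ?G \<longleftrightarrow> v \<in> carrier ?F \<and> v n = \<zero>\<^bsub>R\<^esub>" for v
    using insert.hyps by (auto simp: free_mod_carrier)
  have restr: "submodule (L \<inter> carrier ?G) R ?G" if L: "submodule L R ?F" for L
  proof (rule G.submoduleI')
    show "\<zero>\<^bsub>?G\<^esub> \<in> L \<inter> carrier ?G"
      using submoduleD(2)[OF F L] G.M.zero_closed by (simp add: free_mod_sel)
    fix a b assume "a \<in> L \<inter> carrier ?G" "b \<in> L \<inter> carrier ?G"
    then show "a \<oplus>\<^bsub>?G\<^esub> b \<in> L \<inter> carrier ?G"
      using submoduleD(3)[OF F L, of a b] G.M.a_closed[of a b] by (simp add: free_mod_sel)
  next
    fix a b assume "a \<in> carrier R" "b \<in> L \<inter> carrier ?G"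
    then show "a \<odot>\<^bsub>?G\<^esub> b \<in> L \<inter> carrier ?G"
      using submoduleD(4)[OF F L, of a b] G.smult_closed[of a b] by (simp add: free_mod_sel)
  qed auto
  obtain S0 where S0: "finite S0" "S0 \<subseteq> K \<inter> carrier ?G"
    "\<And>L. submodule L R ?G \<Longrightarrow> S0 \<subseteq> L \<Longrightarrow> K \<inter> carrier ?G \<subseteq> L"
    using insert.IH[OF restr[OF insert.prems]] by blast
  have id: "ideal ((\<lambda>v. v n) ` L) R" if "submodule L R ?F" for L
    by (rule submodule_image_ideal[OF F that]) (auto simp: free_mod_carrier[OF fI] free_mod_sel)
  obtain T where T: "T \<subseteq> carrier R" "finite T" "(\<lambda>v. v n) ` K = Idl\<^bsub>R\<^esub> T"
    using N.finetely_gen[OF id[OF insert.prems]] by blast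
  have TK: "T \<subseteq> (\<lambda>v. v n) ` K" using genideal_self[OF T(1)] T(3) by simp
  then have "\<forall>t\<in>T. \<exists>v\<in>K. v n = t" by blast
  then obtain r where r: "\<And>t. t \<in> T \<Longrightarrow> r t \<in> K \<and> r t n = t" by metis
  have "K \<subseteq> L" if L: "submodule L R ?F" and S: "S0 \<union> r ` T \<subseteq> L" for L
  proof
    fix v assume v: "v \<in> K"
    have K0: "K \<inter> carrier ?G \<subseteq> L"
      using S0(3)[OF restr[OF L]] S0(2) S by auto
    \<comment> \<open>Working in \<open>L \<inter> K\<close> rather than in \<open>L\<close> yields
      \<open>w\<close> in \<open>K\<close> as well, so that the difference of \<open>v\<close> and
      \<open>w\<close> is in \<open>K\<close> and falls under the induction hypothesis.\<close>
    have "T \<subseteq> (\<lambda>v. v n) ` (L \<inter> K)"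
    proof
      fix t assume t: "t \<in> T"
      then have "r t \<in> L \<inter> K" using S r by auto
      then show "t \<in> (\<lambda>v. v n) ` (L \<inter> K)" using r[OF t] by (metis image_eqI)
    qed
    then have "Idl\<^bsub>R\<^esub> T \<subseteq> (\<lambda>v. v n) ` (L \<inter> K)"
      by (rule genideal_minimal[OF id[OF submodule_Int[OF F L insert.prems]]])
    then have "v n \<in> (\<lambda>v. v n) ` (L \<inter> K)" using v T(3) by auto
    then obtain w where w: "w \<in> L" "w \<in> K" "w n = v n" by auto
    have c: "v \<in> carrier ?F" "w \<in> carrier ?F" using v w k(1) by auto
    then have cc: "v j \<in> carrier R" "w j \<in> carrier R" for j by (auto simp: free_mod_carrier[OF fI])
    define d where "d = v \<oplus>\<^bsub>?F\<^esub> (\<ominus>\<^bsub>R\<^esub> \<one>\<^bsub>R\<^esub>) \<odot>\<^bsub>?F\<^esub> w"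
    have dK: "d \<in> K" unfolding d_def using v w k by auto
    have "d n = \<zero>\<^bsub>R\<^esub>" using w cc by (simp add: d_def free_mod_sel l_minus r_neg)
    then have "d \<in> K \<inter> carrier ?G" using dK k(1) mem by auto
    then have "d \<in> L" using K0 by auto
    moreover have "v = d \<oplus>\<^bsub>?F\<^esub> w"
      using cc by (simp add: d_def free_mod_sel l_minus a_assoc l_neg)
    ultimately show "v \<in> L" using submoduleD(3)[OF F L] w by simp
  qed
  then show ?case
    using S0(1,2) T(2) r by (intro exI[of _ "S0 \<union> r ` T"]) auto
qed

text \<open>The index set consists of natural numbers whatever the type of \<open>M\<close>, so that
  the syzygies of such covers have elements of type \<open>nat \<Rightarrow> 'a\<close>.\<close>

lemma fg_imp_surjection:
  assumes M: "module R M" and S: "finite S" "S \<subseteq> carrier M"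
    and gen: "\<And>L. submodule L R M \<Longrightarrow> S \<subseteq> L \<Longrightarrow> carrier M \<subseteq> L"
  shows "\<exists>(I :: nat set) \<alpha>. finite I \<and> \<alpha> \<in> mod_hom R (free_mod R I) M
    \<and> \<alpha> ` carrier (free_mod R I) = carrier M"
proof -
  interpret M: module R M by fact
  obtain e :: "nat \<Rightarrow> _" where e: "bij_betw e {0..<card S} S"
    using ex_bij_betw_nat_finite[OF S(1)] by blast
  let ?I = "{0..<card S}"
  have "e i \<in> carrier M" if "i \<in> ?I" for i using e S that by (auto simp: bij_betw_def)
  from M.free_mod_hom_exists[where s = e and I = ?I, OF M finite_atLeastLessThan this]
  obtain h where h: "h \<in> mod_hom R (free_mod R ?I) M" "\<And>i. i \<in> ?I \<Longrightarrow> h (unit_vec R i) = e i"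
    by blast
  have F: "module R (free_mod R ?I)" by (rule free_mod_module[OF M.R.is_cring])
  have "S \<subseteq> h ` carrier (free_mod R ?I)"
  proof
    fix s assume "s \<in> S"
    then obtain i where i: "i \<in> ?I" "s = e i" using e by (metis bij_betw_def imageE)
    then have "s = h (unit_vec R i)" using h(2) by simp
    then show "s \<in> h ` carrier (free_mod R ?I)" using M.unit_vec_closed[OF i(1)] by blast
  qed
  then have "carrier M \<subseteq> h ` carrier (free_mod R ?I)"
    by (rule gen[OF image_submodule[OF F M h(1)]])
  then have "h ` carrier (free_mod R ?I) = carrier M" using mod_homD(1)[OF h(1)] by auto
  then show ?thesis using h(1) by blast
qed

text \<open>\<open>A\<close> is a retract of \<open>B\<close> once maps that factor through finite
  free modules are set to zero. This relation, unlike that of being a retract, passes to the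
  syzygies of independently chosen covers.\<close>

definition stable_retract ::
  "('a, 'r) ring_scheme \<Rightarrow> ('a, 'q) module \<Rightarrow> ('a, 'p) module \<Rightarrow> bool" where
  "stable_retract R A B \<longleftrightarrow> (\<exists>(J :: nat set) i p s t. finite J \<and>
     i \<in> mod_hom R A B \<and> p \<in> mod_hom R B A \<and>
     s \<in> mod_hom R A (free_mod R J) \<and> t \<in> mod_hom R (free_mod R J) A \<and>
     (\<forall>x\<in>carrier A. x = p (i x) \<oplus>\<^bsub>A\<^esub> t (s x)))"

abbreviation ker_mod where "ker_mod M N f \<equiv> M\<lparr>carrier := ker M N f\<rparr>"

text \<open>The maps \<open>i\<close>, \<open>p\<close>, \<open>t\<close> lift to \<open>i'\<close>,
  \<open>p'\<close>, \<open>t'\<close> between the covers. With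
  \<open>w = p' i' + t' s \<alpha>\<close> one has \<open>\<alpha> w = \<alpha>\<close>, so
  \<open>u = 1 - w\<close> takes values in the kernel of \<open>\<alpha>\<close>; on that kernel the
  summand through \<open>s\<close> vanishes and the identity is \<open>p' i' + u\<close>. Since
  \<open>u\<close> is defined on the whole free module, its restriction to the kernel factors
  through a finite free module.\<close>

lemma stable_retract_ker:
  fixes I :: "nat set"
  assumes A: "module R A" and B: "module R B" and ret: "stable_retract R A B"
    and I: "finite I" and \<alpha>: "\<alpha> \<in> mod_hom R (free_mod R I) A" "\<alpha> ` carrier (free_mod R I) = carrier A"
    and P: "projective_module R P" and \<beta>: "\<beta> \<in> mod_hom R P B" "\<beta> ` carrier P = carrier B"
  shows "\<exists>i p u. i \<in> mod_hom R (ker_mod (free_mod R I) A \<alpha>) (ker_mod P B \<beta>) \<and>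
      p \<in> mod_hom R (ker_mod P B \<beta>) (ker_mod (free_mod R I) A \<alpha>) \<and>
      u \<in> mod_hom R (free_mod R I) (ker_mod (free_mod R I) A \<alpha>) \<and>
      (\<forall>x\<in>ker (free_mod R I) A \<alpha>. x = p (i x) \<oplus>\<^bsub>free_mod R I\<^esub> u x)"
proof -
  interpret A: module R A by fact
  interpret B: module R B by fact
  let ?F = "free_mod R I"
  have F: "module R ?F" by (rule free_mod_module[OF A.R.is_cring])
  interpret F: module R ?F by fact
  have PM: "module R P" using P by (simp add: projective_module_def)
  interpret P: module R P by fact
  obtain J :: "nat set" and i p s t where J: "finite J" and i: "i \<in> mod_hom R A B"
    and p: "p \<in> mod_hom R B A" and s: "s \<in> mod_hom R A (free_mod R J)"
    and t: "t \<in> mod_hom R (free_mod R J) A"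
    and eq: "\<And>x. x \<in> carrier A \<Longrightarrow> x = p (i x) \<oplus>\<^bsub>A\<^esub> t (s x)"
    using ret unfolding stable_retract_def by blast
  obtain i' where i': "i' \<in> mod_hom R ?F P" "\<And>x. x \<in> carrier ?F \<Longrightarrow> \<beta> (i' x) = i (\<alpha> x)"
    using A.free_mod_lift[OF I PM B \<beta> mod_hom_comp[OF \<alpha>(1) i]] by blast
  obtain p' where p': "p' \<in> mod_hom R P ?F" "\<And>x. x \<in> carrier P \<Longrightarrow> \<alpha> (p' x) = p (\<beta> x)"
    using projective_module_lift[OF P F A \<alpha> mod_hom_comp[OF \<beta>(1) p]] by blast
  obtain t' where t': "t' \<in> mod_hom R (free_mod R J) ?F"
    "\<And>x. x \<in> carrier (free_mod R J) \<Longrightarrow> \<alpha> (t' x) = t x"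
    using A.free_mod_lift[OF J F A \<alpha> t] by blast
  define w where "w x = p' (i' x) \<oplus>\<^bsub>?F\<^esub> t' (s (\<alpha> x))" for x
  note cl = mod_homD(1)[OF \<alpha>(1)] mod_homD(1)[OF s] mod_homD(1)[OF t'(1)] mod_homD(1)[OF p'(1)]
    mod_homD(1)[OF i'(1)] mod_homD(1)[OF i] mod_homD(1)[OF p] mod_homD(1)[OF t] mod_homD(1)[OF \<beta>(1)]
  have wc: "w x \<in> carrier ?F" if "x \<in> carrier ?F" for x
    using that cl by (simp add: w_def)
  have w: "w \<in> mod_hom R ?F ?F"
  proof (rule mod_homI)
    fix x y assume "x \<in> carrier ?F" "y \<in> carrier ?F"
    then show "w (x \<oplus>\<^bsub>?F\<^esub> y) = w x \<oplus>\<^bsub>?F\<^esub> w y"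
      by (simp add: w_def mod_homD(2)[OF \<alpha>(1)] mod_homD(2)[OF s] mod_homD(2)[OF t'(1)]
          mod_homD(2)[OF p'(1)] mod_homD(2)[OF i'(1)] cl F.M.add.m_ac)
  next
    fix a x assume "a \<in> carrier R" "x \<in> carrier ?F"
    then show "w (a \<odot>\<^bsub>?F\<^esub> x) = a \<odot>\<^bsub>?F\<^esub> w x"
      by (simp add: w_def mod_homD(3)[OF \<alpha>(1)] mod_homD(3)[OF s] mod_homD(3)[OF t'(1)]
          mod_homD(3)[OF p'(1)] mod_homD(3)[OF i'(1)] cl F.smult_r_distr)
  qed (rule wc)
  have \<alpha>w: "\<alpha> (w x) = \<alpha> x" if "x \<in> carrier ?F" for x
  proof -
    have "\<alpha> (w x) = p (i (\<alpha> x)) \<oplus>\<^bsub>A\<^esub> t (s (\<alpha> x))"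
      using that cl by (simp add: w_def mod_homD(2)[OF \<alpha>(1)] p' i' t')
    then show ?thesis using eq[of "\<alpha> x"] that cl by simp
  qed
  define u where "u x = x \<oplus>\<^bsub>?F\<^esub> (\<ominus>\<^bsub>R\<^esub> \<one>\<^bsub>R\<^esub>) \<odot>\<^bsub>?F\<^esub> w x" for x
  have m1: "\<ominus>\<^bsub>R\<^esub> \<one>\<^bsub>R\<^esub> \<in> carrier R" by simp
  have u: "u \<in> mod_hom R ?F (ker_mod ?F A \<alpha>)"
  proof (rule mod_homI)
    fix x assume x: "x \<in> carrier ?F"
    have "\<alpha> (u x) = \<alpha> x \<oplus>\<^bsub>A\<^esub> (\<ominus>\<^bsub>R\<^esub> \<one>\<^bsub>R\<^esub>) \<odot>\<^bsub>A\<^esub> \<alpha> x"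
      using x wc[OF x] m1 by (simp add: u_def mod_homD(2,3)[OF \<alpha>(1)] \<alpha>w)
    also have "\<dots> = \<zero>\<^bsub>A\<^esub>" using cl(1)[OF x] by (simp add: A.M.r_neg flip: A.neg_eq_smult)
    finally show "u x \<in> carrier (ker_mod ?F A \<alpha>)" using x wc[OF x] by (simp add: ker_def u_def)
  next
    fix x y assume "x \<in> carrier ?F" "y \<in> carrier ?F"
    then show "u (x \<oplus>\<^bsub>?F\<^esub> y) = u x \<oplus>\<^bsub>ker_mod ?F A \<alpha>\<^esub> u y"
      using wc by (simp add: u_def mod_homD(2)[OF w] F.smult_r_distr F.M.add.m_ac)
  next
    fix a x assume "a \<in> carrier R" "x \<in> carrier ?F"
    then show "u (a \<odot>\<^bsub>?F\<^esub> x) = a \<odot>\<^bsub>ker_mod ?F A \<alpha>\<^esub> u x"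
      using wc by (simp add: u_def mod_homD(3)[OF w] F.smult_r_distr A.R.m_comm flip: F.smult_assoc1)
  qed
  have z: "s \<zero>\<^bsub>A\<^esub> = \<zero>\<^bsub>free_mod R J\<^esub>" "t' \<zero>\<^bsub>free_mod R J\<^esub> = \<zero>\<^bsub>?F\<^esub>"
    "i \<zero>\<^bsub>A\<^esub> = \<zero>\<^bsub>B\<^esub>" "p \<zero>\<^bsub>B\<^esub> = \<zero>\<^bsub>A\<^esub>"
    using mod_hom_zero[OF A _ s] mod_hom_zero[OF _ F t'(1)] free_mod_module[OF A.R.is_cring]
      mod_hom_zero[OF A B i] mod_hom_zero[OF B A p] by auto
  have dec: "x = p' (i' x) \<oplus>\<^bsub>?F\<^esub> u x" if x: "x \<in> ker ?F A \<alpha>" for x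
  proof -
    have xc: "x \<in> carrier ?F" "\<alpha> x = \<zero>\<^bsub>A\<^esub>" using x by (auto simp: ker_def)
    have wx: "w x = p' (i' x)" using xc cl by (simp add: w_def z)
    show ?thesis unfolding u_def wx using xc cl
      by (simp add: F.M.add.m_lcomm F.M.r_neg flip: F.neg_eq_smult)
  qed
  have i'': "i' \<in> mod_hom R (ker_mod ?F A \<alpha>) (ker_mod P B \<beta>)"
    by (rule mod_homI) (use cl i'(2) z in \<open>auto simp: ker_def mod_homD[OF i'(1)]\<close>)
  have p'': "p' \<in> mod_hom R (ker_mod P B \<beta>) (ker_mod ?F A \<alpha>)"
    by (rule mod_homI) (use cl p'(2) z in \<open>auto simp: ker_def mod_homD[OF p'(1)]\<close>)
  show ?thesis using i'' p'' u dec by blast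
qed

section \<open>Minimal covers over local rings\<close>

definition is_cover where
  "is_cover R I \<alpha> A \<longleftrightarrow> finite I \<and> \<alpha> \<in> mod_hom R (free_mod R I) A \<and>
     \<alpha> ` carrier (free_mod R I) = carrier A"

text \<open>The kernel lies in \<open>\<mm>F\<close>: over a local ring, no relation between the
  generators has a unit as coefficient.\<close>

definition min_cover where
  "min_cover R \<mm> I \<alpha> A \<longleftrightarrow> is_cover R I \<alpha> A \<and> (\<forall>v\<in>ker (free_mod R I) A \<alpha>. \<forall>k. v k \<in> \<mm>)"

text \<open>Finite minimal free resolutions, recorded through their syzygies: after \<open>j\<close>
  minimal covers the remaining kernel is zero. The recursion stays in one type because covers are
  indexed by sets of naturals, so each kernel again lives in
  \<open>nat \<Rightarrow> 'a\<close>.\<close>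

primrec min_res :: "('a, 'r) ring_scheme \<Rightarrow> 'a set \<Rightarrow> nat \<Rightarrow> ('a, nat \<Rightarrow> 'a) module \<Rightarrow> bool" where
  "min_res R \<mm> 0 N \<longleftrightarrow> carrier N = {\<zero>\<^bsub>N\<^esub>}"
| "min_res R \<mm> (Suc j) N \<longleftrightarrow>
     (\<exists>I \<alpha>. min_cover R \<mm> I \<alpha> N \<and> min_res R \<mm> j (ker_mod (free_mod R I) N \<alpha>))"

primrec proj_res :: "('a, 'r) ring_scheme \<Rightarrow> nat \<Rightarrow> ('a, 'p) module \<Rightarrow> bool" where
  "proj_res R 0 N \<longleftrightarrow> carrier N = {\<zero>\<^bsub>N\<^esub>}"
| "proj_res R (Suc j) N \<longleftrightarrow>
     (\<exists>P \<beta>. projective_module R P \<and> \<beta> \<in> mod_hom R P N \<and> \<beta> ` carrier P = carrier N \<and>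
        proj_res R j (ker_mod P N \<beta>))"

lemma (in cring) min_res_imp_proj_res: "min_res R \<mm> j N \<Longrightarrow> proj_res R j N"
proof (induction j arbitrary: N)
  case (Suc j)
  then obtain I \<alpha> where "min_cover R \<mm> I \<alpha> N" "min_res R \<mm> j (ker_mod (free_mod R I) N \<alpha>)" by auto
  then show ?case
    using Suc.IH free_mod_projective by (auto simp: min_cover_def is_cover_def)
qed simp

lemma is_coverD:
  assumes "is_cover R I \<alpha> A"
  shows "finite I" "\<alpha> \<in> mod_hom R (free_mod R I) A" "\<alpha> ` carrier (free_mod R I) = carrier A"
  using assms by (auto simp: is_cover_def)

text \<open>Lets a zero module be covered by itself, inside its own type, where a resolution that
  has already ended must be continued by one more step.\<close>

lemma zero_module_projective:
  fixes N :: "('a, 'p) module"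
  assumes M: "module R N" and z: "carrier N = {\<zero>\<^bsub>N\<^esub>}"
  shows "projective_module R N"
  unfolding projective_module_def
proof (intro conjI allI impI M)
  fix L :: "('a, 'p \<Rightarrow> 'a) module" and K :: "('a, 'p) module" and g f
  assume L: "module R L" and K: "module R K" and g: "g \<in> mod_hom R L K" and f: "f \<in> mod_hom R N K"
  interpret L: module R L by fact
  have "(\<lambda>_. \<zero>\<^bsub>L\<^esub>) \<in> mod_hom R N L" by (rule mod_homI) auto
  moreover have "g \<zero>\<^bsub>L\<^esub> = f \<zero>\<^bsub>N\<^esub>"
    using mod_hom_zero[OF L K g] mod_hom_zero[OF M K f] by simp
  ultimately show "\<exists>h\<in>mod_hom R N L. \<forall>x\<in>carrier N. g (h x) = f x" using z by auto
qed

text \<open>The operations of \<open>free_mod R I\<close> do not depend on \<open>I\<close>, so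
  dropping generators keeps the function itself and only shrinks its domain.\<close>

lemma mod_hom_free_mod_mono:
  assumes f: "f \<in> mod_hom R (free_mod R I) A" and J: "J \<subseteq> I"
  shows "f \<in> mod_hom R (free_mod R J) A"
proof -
  have "carrier (free_mod R J) \<subseteq> carrier (free_mod R I)" using J by (auto simp: free_mod_def)
  moreover have "(\<oplus>\<^bsub>free_mod R J\<^esub>) = (\<oplus>\<^bsub>free_mod R I\<^esub>)" "(\<odot>\<^bsub>free_mod R J\<^esub>) = (\<odot>\<^bsub>free_mod R I\<^esub>)"
    by (simp_all add: free_mod_def)
  ultimately show ?thesis using f by (auto simp: mod_hom_def subset_iff)
qed

text \<open>Locality in a form that passes easily to quotients: elements outside
  \<open>\<mm>\<close> are units. \<open>local_ring_imp_noeth_local\<close> derives it from the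
  uniqueness of the maximal ideal.\<close>

locale noeth_local = R?: cring R + R?: noetherian_ring R for R (structure) +
  fixes \<mm>
  assumes ideal_max: "ideal \<mm> R" and proper_max: "\<mm> \<noteq> carrier R"
    and units: "a \<in> carrier R \<Longrightarrow> a \<notin> \<mm> \<Longrightarrow> a \<in> Units R"
begin

lemma one_notin_max: "\<one> \<notin> \<mm>"
  using ideal.one_imp_carrier[OF ideal_max] proper_max by blast

lemma max_simps:
  "a \<in> \<mm> \<Longrightarrow> a \<in> carrier R" "\<zero> \<in> \<mm>" "a \<in> \<mm> \<Longrightarrow> b \<in> \<mm> \<Longrightarrow> a \<oplus> b \<in> \<mm>"
  "a \<in> \<mm> \<Longrightarrow> b \<in> carrier R \<Longrightarrow> a \<otimes> b \<in> \<mm>" "a \<in> \<mm> \<Longrightarrow> b \<in> carrier R \<Longrightarrow> b \<otimes> a \<in> \<mm>"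
proof -
  interpret ideal \<mm> R by (rule ideal_max)
  show "a \<in> \<mm> \<Longrightarrow> a \<in> carrier R" "\<zero> \<in> \<mm>" "a \<in> \<mm> \<Longrightarrow> b \<in> \<mm> \<Longrightarrow> a \<oplus> b \<in> \<mm>"
    "a \<in> \<mm> \<Longrightarrow> b \<in> carrier R \<Longrightarrow> a \<otimes> b \<in> \<mm>" "a \<in> \<mm> \<Longrightarrow> b \<in> carrier R \<Longrightarrow> b \<otimes> a \<in> \<mm>"
    using I_l_closed I_r_closed Icarr additive_subgroup.zero_closed[OF is_additive_subgroup]
    by auto
qed

lemma free_mod_module': "module R (free_mod R I)"
  by (rule free_mod_module[OF is_cring])

text \<open>The vector \<open>f v\<close> is the sum of the \<open>f (unit_vec R i)\<close> with
  coefficients \<open>v i\<close>, which lie in \<open>\<mm>\<close>.\<close>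

lemma free_mod_hom_max:
  fixes I :: "'p set" and L :: "'q set"
  assumes I: "finite I" and L: "finite L" and f: "f \<in> mod_hom R (free_mod R I) (free_mod R L)"
    and v: "v \<in> carrier (free_mod R I)" "\<And>k. v k \<in> \<mm>"
  shows "f v k \<in> \<mm>"
proof -
  interpret F: module R "free_mod R I" by (rule free_mod_module')
  have "\<forall>k. f v k \<in> \<mm>"
  proof (rule free_mod_induct[OF I v(1), where P = "\<lambda>v. \<forall>k. f v k \<in> \<mm>"])
    show "\<forall>k. f (\<lambda>k. \<zero>) k \<in> \<mm>"
      using mod_hom_zero[OF free_mod_module' free_mod_module' f] max_simps(2) by (simp add: free_mod_sel)
    fix i w assume i: "i \<in> I" "w \<in> carrier (free_mod R I)" "\<forall>k. f w k \<in> \<mm>"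
    have c: "v i \<in> carrier R" "unit_vec R i \<in> carrier (free_mod R I)"
      using max_simps(1) v(2) unit_vec_closed[OF i(1)] by auto
    have "f (unit_vec R i) k \<in> carrier R" for k
      using mod_homD(1)[OF f c(2)] by (simp add: free_mod_carrier[OF L])
    then show "\<forall>k. f (w \<oplus>\<^bsub>free_mod R I\<^esub> v i \<odot>\<^bsub>free_mod R I\<^esub> unit_vec R i) k \<in> \<mm>"
      using i c v(2) F.smult_closed[OF c]
      by (auto simp: mod_homD[OF f] free_mod_sel(1,2)[of _ L] max_simps)
  qed
  then show ?thesis by simp
qed

text \<open>The coordinate \<open>v k\<close> is a unit, so the relation \<open>v\<close> expresses
  the generator with index \<open>k\<close> through the others.\<close>

lemma cover_reduce:
  assumes A: "module R A" and c: "is_cover R I \<alpha> A"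
    and v: "v \<in> ker (free_mod R I) A \<alpha>" "v k \<notin> \<mm>"
  shows "k \<in> I" "is_cover R (I - {k}) \<alpha> A"
proof -
  note c' = is_coverD[OF c]
  let ?F = "free_mod R I"
  interpret A: module R A by fact
  interpret F: module R ?F by (rule free_mod_module')
  have vF: "v \<in> carrier ?F" "\<alpha> v = \<zero>\<^bsub>A\<^esub>" using v by (auto simp: ker_def)
  then have vc: "v j \<in> carrier R" "j \<notin> I \<Longrightarrow> v j = \<zero>" for j by (auto simp: free_mod_carrier[OF c'(1)])
  then show "k \<in> I" using v(2) max_simps(2) by metis
  have u: "v k \<in> Units R" using units vc v by auto
  have sub: "carrier (free_mod R (I - {k})) \<subseteq> carrier ?F"
    using c'(1) by (auto simp: free_mod_carrier)
  have "carrier A \<subseteq> \<alpha> ` carrier (free_mod R (I - {k}))"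
  proof
    fix y assume "y \<in> carrier A"
    then obtain w where w: "w \<in> carrier ?F" "\<alpha> w = y" using c'(3) by (metis imageE)
    then have wc: "w j \<in> carrier R" "j \<notin> I \<Longrightarrow> w j = \<zero>" for j by (auto simp: free_mod_carrier[OF c'(1)])
    \<comment> \<open>Chosen so that coordinate \<open>k\<close> of \<open>w + r v\<close> vanishes;
      as \<open>v\<close> is a relation, the image under \<open>\<alpha>\<close> does not
      change.\<close>
    define r where "r = \<ominus> (w k \<otimes> inv (v k))"
    have r: "r \<in> carrier R" "r \<otimes> v k = \<ominus> w k"
      using u wc vc by (auto simp: r_def m_assoc l_minus)
    define w' where "w' = w \<oplus>\<^bsub>?F\<^esub> r \<odot>\<^bsub>?F\<^esub> v"
    have "\<alpha> w' = y"
      using w vF r by (simp add: w'_def mod_homD[OF c'(2)] mod_homD(1)[OF c'(2) w(1), unfolded w(2)])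
    moreover have "w' \<in> carrier (free_mod R (I - {k}))"
      using c'(1) wc vc r by (auto simp: free_mod_carrier w'_def free_mod_sel r_neg)
    ultimately show "y \<in> \<alpha> ` carrier (free_mod R (I - {k}))" by blast
  qed
  moreover have "\<alpha> \<in> mod_hom R (free_mod R (I - {k})) A"
    by (rule mod_hom_free_mod_mono[OF c'(2)]) auto
  ultimately show "is_cover R (I - {k}) \<alpha> A"
    using c'(1) sub mod_homD(1)[OF c'(2)] by (auto simp: is_cover_def)
qed

text \<open>A relation with a coefficient outside \<open>\<mm>\<close> would let
  \<open>cover_reduce\<close> drop a generator.\<close>

lemma min_cover_if_min_card:
  assumes A: "module R A" and c: "is_cover R I \<alpha> A"
    and min: "\<And>J. is_cover R J \<alpha> A \<Longrightarrow> card I \<le> card J"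
  shows "min_cover R \<mm> I \<alpha> A"
  unfolding min_cover_def
proof (intro conjI ballI allI c)
  fix v k assume v: "v \<in> ker (free_mod R I) A \<alpha>"
  show "v k \<in> \<mm>"
  proof (rule ccontr)
    assume "v k \<notin> \<mm>"
    from cover_reduce[OF A c v this] min[of "I - {k}"] have "k \<in> I" "card I \<le> card (I - {k})" by blast+
    then show False using is_coverD(1)[OF c] by (metis card_Diff1_less not_le)
  qed
qed

lemma min_cover_exists:
  assumes A: "module R A" and c: "is_cover R I \<alpha> A"
  shows "\<exists>I. min_cover R \<mm> I \<alpha> A"
proof -
  obtain J where "is_cover R J \<alpha> A" "\<And>K. is_cover R K \<alpha> A \<Longrightarrow> card J \<le> card K"
    using ex_has_least_nat[of "\<lambda>J. is_cover R J \<alpha> A" I card] c by blast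
  then show ?thesis using min_cover_if_min_card[OF A] by blast
qed

text \<open>Here the Noetherian hypothesis provides the next step of a resolution: a syzygy has
  finitely many generators, and a smallest index set gives a minimal cover.\<close>

lemma submodule_min_cover_exists:
  fixes I :: "'p set"
  assumes I: "finite I" and K: "submodule K R (free_mod R I)"
  shows "\<exists>(L :: nat set) \<gamma>. min_cover R \<mm> L \<gamma> ((free_mod R I)\<lparr>carrier := K\<rparr>)"
proof -
  let ?F = "free_mod R I" let ?K = "?F\<lparr>carrier := K\<rparr>"
  have F: "module R ?F" by (rule free_mod_module')
  have KM: "module R ?K" by (rule submodule_module[OF F K])
  interpret KM: module R ?K by fact
  interpret F: module R ?F by fact
  obtain S where S: "finite S" "S \<subseteq> K" "\<And>L. submodule L R ?F \<Longrightarrow> S \<subseteq> L \<Longrightarrow> K \<subseteq> L"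
    using free_mod_submodule_fg[OF is_cring noetherian_ring_axioms I K] by blast
  have sub: "submodule L R ?F" if "submodule L R ?K" for L
    by (rule F.submoduleI') (use submoduleD[OF KM that] submoduleD(1)[OF F K] in auto)
  obtain L :: "nat set" and \<gamma> where "is_cover R L \<gamma> ?K"
    using fg_imp_surjection[OF KM S(1)] S sub unfolding is_cover_def by auto
  then show ?thesis using min_cover_exists[OF KM] by blast
qed

text \<open>A minimal cover \<open>L\<close> of the kernel is mapped into itself by a lift of \<open>u\<close>, which differs from the
  identity by elements of \<open>\<mm>L\<close> and has values in \<open>\<mm>L\<close>; hence \<open>L = \<mm>L\<close>.\<close>

lemma min_cover_retract_kernel:
  fixes I :: "'p set"
  assumes A: "module R A" and c: "min_cover R \<mm> I \<alpha> A"
    and u: "u \<in> mod_hom R (free_mod R I) (ker_mod (free_mod R I) A \<alpha>)"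
    and idem: "\<And>x. x \<in> ker (free_mod R I) A \<alpha> \<Longrightarrow> u x = x"
  shows "ker (free_mod R I) A \<alpha> = {\<zero>\<^bsub>free_mod R I\<^esub>}"
proof -
  let ?F = "free_mod R I" let ?K = "ker ?F A \<alpha>" let ?KM = "ker_mod ?F A \<alpha>"
  have cov: "is_cover R I \<alpha> A" and min: "\<And>v k. v \<in> ?K \<Longrightarrow> v k \<in> \<mm>"
    using c by (auto simp: min_cover_def)
  note c' = is_coverD[OF cov]
  have F: "module R ?F" by (rule free_mod_module')
  have K: "submodule ?K R ?F" by (rule ker_submodule[OF F A c'(2)])
  have KM: "module R ?KM" by (rule submodule_module[OF F K])
  interpret KM: module R ?KM by fact
  interpret F: module R ?F by fact
  obtain L :: "nat set" and \<gamma> where L: "min_cover R \<mm> L \<gamma> ?KM"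
    using submodule_min_cover_exists[OF c'(1) K] by blast
  then have Lc: "is_cover R L \<gamma> ?KM" by (simp add: min_cover_def)
  note L' = is_coverD[OF Lc]
  let ?G = "free_mod R L"
  have G: "module R ?G" by (rule free_mod_module')
  interpret G: module R ?G by fact
  obtain u' where u': "u' \<in> mod_hom R ?F ?G" "\<And>x. x \<in> carrier ?F \<Longrightarrow> \<gamma> (u' x) = u x"
    using free_mod_lift[OF c'(1) G KM L'(2,3) u] by blast
  have small: "w k \<in> \<mm>" if w: "w \<in> carrier ?G" for w k
  proof -
    have gK: "\<gamma> w \<in> ?K" using mod_homD(1)[OF L'(2) w] by simp
    then have gF: "\<gamma> w \<in> carrier ?F" using submoduleD(1)[OF F K] by blast
    then have uc: "u' (\<gamma> w) \<in> carrier ?G" by (rule mod_homD(1)[OF u'(1)])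
    define d where "d = w \<oplus>\<^bsub>?G\<^esub> (\<ominus> \<one>) \<odot>\<^bsub>?G\<^esub> u' (\<gamma> w)"
    have dc: "d \<in> carrier ?G" using w uc by (simp add: d_def)
    have m1: "\<ominus> \<one> \<in> carrier R" by simp
    have "\<gamma> d = \<gamma> w \<oplus>\<^bsub>?F\<^esub> (\<ominus> \<one>) \<odot>\<^bsub>?F\<^esub> \<gamma> w"
      using mod_homD(2)[OF L'(2) w G.smult_closed[OF m1 uc]] mod_homD(3)[OF L'(2) m1 uc]
      by (simp add: d_def u'(2)[OF gF] idem[OF gK])
    also have "\<dots> = \<zero>\<^bsub>?F\<^esub>" using gF by (simp add: F.M.r_neg flip: F.neg_eq_smult)
    finally have "d \<in> ker ?G ?KM \<gamma>" using dc by (simp add: ker_def)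
    then have "d k \<in> \<mm>" using L by (simp add: min_cover_def)
    moreover have "u' (\<gamma> w) k \<in> \<mm>"
      by (rule free_mod_hom_max[OF c'(1) L'(1) u'(1) gF min[OF gK]])
    moreover have "w = d \<oplus>\<^bsub>?G\<^esub> u' (\<gamma> w)"
      using w uc by (simp add: d_def G.M.a_assoc G.M.l_neg flip: G.neg_eq_smult)
    then have "w k = d k \<oplus> u' (\<gamma> w) k" by (simp add: free_mod_sel fun_eq_iff)
    ultimately show ?thesis using max_simps by simp
  qed
  \<comment> \<open>The entry \<open>1\<close> of a unit vector is not in \<open>\<mm>\<close>, so
    there can be no generators.\<close>
  have "L = {}"
  proof (rule ccontr)
    assume "L \<noteq> {}"
    then obtain l where "l \<in> L" by blast
    from small[OF unit_vec_closed[OF this], of l] one_notin_max show False by (simp add: unit_vec_def)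
  qed
  then have "carrier ?G = {\<zero>\<^bsub>?G\<^esub>}" by (auto simp: free_mod_carrier free_mod_sel fun_eq_iff)
  then have "carrier ?KM = {\<gamma> \<zero>\<^bsub>?G\<^esub>}" using L'(3) by (metis image_empty image_insert)
  then show ?thesis using mod_hom_zero[OF G KM L'(2)] by simp
qed

text \<open>\<open>stable_retract_ker\<close> supplies the correction term \<open>u\<close>; it
  factors through the inclusion of the kernel into the finite free module of the cover.\<close>

lemma stable_retract_syzygy:
  fixes I :: "nat set"
  assumes A: "module R A" and B: "module R B" and ret: "stable_retract R A B"
    and c: "is_cover R I \<alpha> A"
    and P: "projective_module R P" and \<beta>: "\<beta> \<in> mod_hom R P B" "\<beta> ` carrier P = carrier B"
  shows "stable_retract R (ker_mod (free_mod R I) A \<alpha>) (ker_mod P B \<beta>)"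
proof -
  note c' = is_coverD[OF c]
  let ?F = "free_mod R I" let ?K = "ker_mod ?F A \<alpha>"
  obtain i p u where "i \<in> mod_hom R ?K (ker_mod P B \<beta>)" "p \<in> mod_hom R (ker_mod P B \<beta>) ?K"
    "u \<in> mod_hom R ?F ?K" "\<forall>x\<in>ker ?F A \<alpha>. x = p (i x) \<oplus>\<^bsub>?F\<^esub> u x"
    using stable_retract_ker[OF A B ret c' P \<beta>] by blast
  moreover have "(\<lambda>x. x) \<in> mod_hom R ?K ?F" by (auto simp: mod_hom_def ker_def)
  ultimately show ?thesis
    unfolding stable_retract_def using c'(1)
    by (intro exI[of _ I] exI[of _ i] exI[of _ p] exI[of _ "\<lambda>x. x"] exI[of _ u]) auto
qed

text \<open>The projective resolution of \<open>N\<close> is followed while minimal covers are taken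
  of the stable retract; the syzygies stay stable retracts. Once the module on the right is zero,
  the one on the left has still to be covered once, whence \<open>Suc j\<close>: the kernel of that
  cover is fixed by \<open>u\<close>, and \<open>min_cover_retract_kernel\<close> makes it
  zero.\<close>

lemma min_res_if_stable_retract:
  fixes I :: "nat set" and N :: "('a, 'p) module"
  assumes "finite I" "submodule K R (free_mod R I)"
    and "module R N" "stable_retract R ((free_mod R I)\<lparr>carrier := K\<rparr>) N" "proj_res R j N"
  shows "min_res R \<mm> (Suc j) ((free_mod R I)\<lparr>carrier := K\<rparr>)"
  using assms
proof (induction j arbitrary: I K N)
  case 0
  let ?A = "(free_mod R I)\<lparr>carrier := K\<rparr>"
  have A: "module R ?A" by (rule submodule_module[OF free_mod_module' 0(2)])
  obtain L :: "nat set" and \<gamma> where L: "min_cover R \<mm> L \<gamma> ?A" using submodule_min_cover_exists[OF 0(1,2)] by blast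
  let ?F = "free_mod R L" let ?K = "ker_mod ?F ?A \<gamma>"
  interpret F: module R ?F by (rule free_mod_module')
  have Lc: "is_cover R L \<gamma> ?A" using L by (simp add: min_cover_def)
  note L' = is_coverD[OF Lc]
  have z: "carrier N = {\<zero>\<^bsub>N\<^esub>}" using 0 by simp
  \<comment> \<open>The zero module \<open>N\<close> is covered by itself through the identity, as
    \<open>stable_retract_ker\<close> asks for a projective module over \<open>N\<close>.\<close>
  have id: "(\<lambda>x. x) \<in> mod_hom R N N" "(\<lambda>x. x) ` carrier N = carrier N" by (auto simp: mod_hom_def)
  have K: "submodule (ker ?F ?A \<gamma>) R ?F" by (rule ker_submodule[OF free_mod_module' A L'(2)])
  have KM: "module R ?K" by (rule submodule_module[OF free_mod_module' K])
  have NM: "module R (ker_mod N N (\<lambda>x. x))"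
    by (rule submodule_module[OF 0(3) ker_submodule[OF 0(3) 0(3) id(1)]])
  obtain i p u where i: "i \<in> mod_hom R ?K (ker_mod N N (\<lambda>x. x))"
    and p: "p \<in> mod_hom R (ker_mod N N (\<lambda>x. x)) ?K"
    and u: "u \<in> mod_hom R ?F ?K" and eq: "\<And>x. x \<in> ker ?F ?A \<gamma> \<Longrightarrow> x = p (i x) \<oplus>\<^bsub>?F\<^esub> u x"
    using stable_retract_ker[OF A 0(3,4) L' zero_module_projective[OF 0(3) z] id] by blast
  have "u x = x" if x: "x \<in> ker ?F ?A \<gamma>" for x
  proof -
    have "i x = \<zero>\<^bsub>N\<^esub>" using mod_homD(1)[OF i] x z by (auto simp: ker_def)
    then have "p (i x) = \<zero>\<^bsub>?F\<^esub>" using mod_hom_zero[OF NM KM p] by simp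
    moreover have "u x \<in> carrier ?F" using mod_homD(1)[OF u] x by (auto simp: ker_def)
    ultimately show ?thesis using eq[OF x] by simp
  qed
  then have "ker ?F ?A \<gamma> = {\<zero>\<^bsub>?F\<^esub>}" by (rule min_cover_retract_kernel[OF A L u])
  then show ?case using L by auto
next
  case (Suc j)
  let ?A = "(free_mod R I)\<lparr>carrier := K\<rparr>"
  have A: "module R ?A" by (rule submodule_module[OF free_mod_module' Suc.prems(2)])
  obtain L :: "nat set" and \<gamma> where L: "min_cover R \<mm> L \<gamma> ?A" using submodule_min_cover_exists[OF Suc.prems(1,2)] by blast
  let ?F = "free_mod R L"
  have Lc: "is_cover R L \<gamma> ?A" using L by (simp add: min_cover_def)
  note L' = is_coverD[OF Lc]
  obtain P :: "('a, 'p) module" and \<beta> where P: "projective_module R P" and b: "\<beta> \<in> mod_hom R P N" "\<beta> ` carrier P = carrier N"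
    and res: "proj_res R j (ker_mod P N \<beta>)"
    using Suc.prems(5) by auto
  have PM: "module R P" using P by (simp add: projective_module_def)
  have "module R (ker_mod P N \<beta>)"
    by (rule submodule_module[OF PM ker_submodule[OF PM Suc.prems(3) b(1)]])
  from Suc.IH[OF L'(1) ker_submodule[OF free_mod_module' A L'(2)] this
      stable_retract_syzygy[OF A Suc.prems(3,4) Lc P b] res]
  show ?case using L by (subst min_res.simps(2)) blast
qed

end

section \<open>Non-zero-divisors and the socle\<close>

text \<open>Zorn's lemma, where the union of a chain is a member of the chain by the Noetherian
  property.\<close>

lemma (in noetherian_ring) ideal_family_has_maximal:
  assumes "J \<in> \<F>" "\<And>J. J \<in> \<F> \<Longrightarrow> ideal J R"
  obtains M where "M \<in> \<F>" "\<And>J. J \<in> \<F> \<Longrightarrow> M \<subseteq> J \<Longrightarrow> J = M"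
proof -
  have "\<exists>M\<in>\<F>. \<forall>J\<in>\<F>. M \<subseteq> J \<longrightarrow> J = M"
  proof (rule subset_Zorn_nonempty)
    show "\<F> \<noteq> {}" using assms(1) by blast
    fix C assume C: "C \<noteq> {}" "subset.chain \<F> C"
    then have "subset.chain {J. ideal J R} C"
      using assms(2) by (auto simp: subset_chain_def)
    then have "\<Union>C \<in> C" using ideal_chain_is_trivial C(1) by blast
    then show "\<Union>C \<in> \<F>" using C(2) by (auto simp: subset_chain_def)
  qed
  then show ?thesis using that by blast
qed

text \<open>A maximal ideal among the \<open>Idl T\<close> with finite
  \<open>T \<subseteq> Y\<close> absorbs every further element of \<open>Y\<close>. The generators
  are taken from \<open>Y\<close> itself, as \<open>finite_max_ann\<close> requires.\<close>

lemma (in noetherian_ring) finite_subset_generates: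
  assumes "Y \<subseteq> carrier R"
  shows "\<exists>T\<subseteq>Y. finite T \<and> Y \<subseteq> Idl T"
proof -
  define \<F> where "\<F> = {Idl T |T. T \<subseteq> Y \<and> finite T}"
  have F: "Idl T \<in> \<F>" if "T \<subseteq> Y" "finite T" for T using that unfolding \<F>_def by blast
  have "ideal J R" if "J \<in> \<F>" for J
    using that assms genideal_ideal unfolding \<F>_def by blast
  then obtain M where M: "M \<in> \<F>" and M': "\<And>J. J \<in> \<F> \<Longrightarrow> M \<subseteq> J \<Longrightarrow> J = M"
    using ideal_family_has_maximal[OF F[of "{}"]] by blast
  obtain T where T: "T \<subseteq> Y" "finite T" and MT: "M = Idl T" using M unfolding \<F>_def by blast
  have max: "Idl S = Idl T" if "S \<subseteq> Y" "finite S" "Idl T \<subseteq> Idl S" for S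
  proof -
    show ?thesis using M'[OF F] that MT by simp
  qed
  have "x \<in> Idl T" if x: "x \<in> Y" for x
  proof -
    have c: "insert x T \<subseteq> carrier R" using x T assms by auto
    have "Idl (insert x T) = Idl T"
      by (rule max) (use x T subset_Idl_subset[OF c, of T] in auto)
    then show ?thesis using genideal_self[OF c] by auto
  qed
  with T show ?thesis by blast
qed

text \<open>A product of elements of the ideals \<open>Q\<close>, each outside \<open>P\<close>, is
  in every \<open>Q\<close>, and it is outside \<open>P\<close> by primality.\<close>

lemma (in cring) primeideal_avoid_Inter:
  assumes P: "primeideal P R" and fin: "finite \<Q>"
    and Q: "\<And>Q. Q \<in> \<Q> \<Longrightarrow> ideal Q R \<and> \<not> Q \<subseteq> P"
  shows "\<exists>r\<in>carrier R. r \<notin> P \<and> (\<forall>Q\<in>\<Q>. r \<in> Q)"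
  using fin Q
proof (induction \<Q> rule: finite_induct)
  case empty
  have "\<one> \<notin> P"
    using ideal.one_imp_carrier[OF primeideal.axioms(1)[OF P]] primeideal.I_notcarr[OF P] by auto
  then show ?case by blast
next
  case (insert Q \<Q>)
  then obtain r where r: "r \<in> carrier R" "r \<notin> P" "\<forall>Q\<in>\<Q>. r \<in> Q" by auto
  obtain q where q: "q \<in> Q" "q \<notin> P" using insert.prems by blast
  have qc: "q \<in> carrier R" using q(1) insert.prems ideal.Icarr by (metis insertI1)
  have "q \<otimes> r \<notin> P" using primeideal.I_prime[OF P qc r(1)] q r by blast
  moreover have "q \<otimes> r \<in> Q" using ideal.I_r_closed q(1) r(1) insert.prems by (metis insertI1)
  moreover have "q \<otimes> r \<in> Q'" if "Q' \<in> \<Q>" for Q'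
    using ideal.I_l_closed that r(3) qc insert.prems by (metis insertI2)
  ultimately show ?case using qc r(1) by blast
qed

lemma ideal_add_cancel:
  assumes "ideal P R" "b \<in> P" "a \<in> carrier R" "a \<oplus>\<^bsub>R\<^esub> b \<in> P"
  shows "a \<in> P"
proof -
  interpret ideal P R by fact
  have "(a \<oplus>\<^bsub>R\<^esub> b) \<oplus>\<^bsub>R\<^esub> \<ominus>\<^bsub>R\<^esub> b \<in> P" using assms by simp
  moreover have "(a \<oplus>\<^bsub>R\<^esub> b) \<oplus>\<^bsub>R\<^esub> \<ominus>\<^bsub>R\<^esub> b = a" using assms a_Hcarr by (simp add: a_assoc r_neg)
  ultimately show ?thesis by simp
qed

text \<open>Prime avoidance for the coset of \<open>h\<close> modulo \<open>J\<close>. If the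
  \<open>j\<close> found for the earlier primes puts \<open>h + j\<close> into the new prime
  \<open>P\<close>, an element \<open>r\<close> of \<open>J\<close> and of all earlier primes, but
  not of \<open>P\<close>, is added; it repairs \<open>P\<close> and disturbs none of the others.
  Such an \<open>r\<close> exists because neither \<open>J\<close> nor an earlier prime is contained
  in \<open>P\<close>.\<close>

lemma (in cring) primeideal_coset_avoidance:
  assumes fin: "finite \<P>" and prime: "\<And>P. P \<in> \<P> \<Longrightarrow> primeideal P R"
    and inc: "\<And>P Q. P \<in> \<P> \<Longrightarrow> Q \<in> \<P> \<Longrightarrow> P \<subseteq> Q \<Longrightarrow> P = Q"
    and J: "ideal J R" and h: "h \<in> carrier R"
    and notin: "\<And>P. P \<in> \<P> \<Longrightarrow> h \<in> P \<Longrightarrow> \<not> J \<subseteq> P"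
  shows "\<exists>j\<in>J. \<forall>P\<in>\<P>. h \<oplus> j \<notin> P"
  using fin prime inc notin
proof (induction \<P> rule: finite_induct)
  case empty
  then show ?case using additive_subgroup.zero_closed[OF ideal.axioms(1)[OF J]] by auto
next
  case (insert P \<P>)
  have "\<exists>j\<in>J. \<forall>P\<in>\<P>. h \<oplus> j \<notin> P"
  proof (rule insert.IH)
    show "primeideal Q R" if "Q \<in> \<P>" for Q using that by (intro insert.prems(1)) simp
    show "Q = Q'" if "Q \<in> \<P>" "Q' \<in> \<P>" "Q \<subseteq> Q'" for Q Q'
      using that by (intro insert.prems(2)) simp_all
    show "\<not> J \<subseteq> Q" if "Q \<in> \<P>" "h \<in> Q" for Q using that by (intro insert.prems(3)) simp_all
  qed
  then obtain j where j: "j \<in> J" "\<forall>P\<in>\<P>. h \<oplus> j \<notin> P" by blast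
  have jc: "j \<in> carrier R" using ideal.Icarr[OF J j(1)] .
  have P: "primeideal P R" by (rule insert.prems(1)) simp
  have idl: "ideal Q R" if "Q \<in> insert P \<P>" for Q using insert.prems(1)[OF that] primeideal.axioms(1) by blast
  show ?case
  proof (cases "h \<oplus> j \<in> P")
    case True
    have "\<not> J \<subseteq> P"
      using insert.prems(3)[of P] ideal_add_cancel[OF idl[of P] _ h True] j(1) by blast
    moreover have "\<not> Q \<subseteq> P" if "Q \<in> \<P>" for Q
      using insert.prems(2)[of Q P] that insert.hyps(2) by blast
    ultimately have "\<exists>r\<in>carrier R. r \<notin> P \<and> (\<forall>Q\<in>insert J \<P>. r \<in> Q)"
      using primeideal_avoid_Inter[OF P, of "insert J \<P>"] insert.hyps(1) idl J by blast
    then obtain r where r: "r \<in> carrier R" "r \<notin> P" "r \<in> J" "\<And>Q. Q \<in> \<P> \<Longrightarrow> r \<in> Q" by blast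
    have eq: "h \<oplus> (j \<oplus> r) = (h \<oplus> j) \<oplus> r" "h \<oplus> (j \<oplus> r) = r \<oplus> (h \<oplus> j)"
      using h jc r(1) by (auto simp: a_ac)
    have "h \<oplus> (j \<oplus> r) \<notin> P"
      using ideal_add_cancel[OF idl[of P] True r(1)] r(2) by (auto simp: eq(2))
    moreover have "h \<oplus> (j \<oplus> r) \<notin> Q" if "Q \<in> \<P>" for Q
      using ideal_add_cancel[OF idl[of Q] r(4)[OF that], of "h \<oplus> j"] j(2) that h jc by (auto simp: eq(1))
    moreover have "j \<oplus> r \<in> J" using J j(1) r(3) by (simp add: additive_subgroup.a_closed ideal.axioms(1))
    ultimately show ?thesis by blast
  qed (use j in blast)
qed

section \<open>Maximal annihilators and non-zero-divisors\<close>

definition ann where "ann R a = {r \<in> carrier R. r \<otimes>\<^bsub>R\<^esub> a = \<zero>\<^bsub>R\<^esub>}"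

text \<open>Over a Noetherian ring these are the maximal associated primes, and their union is the
  set of zero divisors.\<close>

definition max_ann where
  "max_ann R = {P. (\<exists>a\<in>carrier R - {\<zero>\<^bsub>R\<^esub>}. P = ann R a) \<and>
     (\<forall>b\<in>carrier R - {\<zero>\<^bsub>R\<^esub>}. P \<subseteq> ann R b \<longrightarrow> ann R b = P)}"

lemma (in cring) ann_ideal: "a \<in> carrier R \<Longrightarrow> ideal (ann R a) R"
  by (rule idealI') (auto simp: ann_def l_distr m_assoc)

text \<open>If \<open>r s\<close> kills \<open>a\<close> and \<open>s\<close> does not, then the
  annihilator of \<open>s a\<close> contains \<open>P\<close>, hence equals it, and it contains
  \<open>r\<close>.\<close>

lemma (in cring) max_ann_prime:
  assumes "P \<in> max_ann R"
  shows "primeideal P R"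
proof -
  obtain a where a: "a \<in> carrier R" "a \<noteq> \<zero>" "P = ann R a"
    and max: "\<And>b. b \<in> carrier R \<Longrightarrow> b \<noteq> \<zero> \<Longrightarrow> P \<subseteq> ann R b \<Longrightarrow> ann R b = P"
    using assms by (auto simp: max_ann_def)
  show ?thesis
  proof (rule primeidealI)
    show "ideal P R" using ann_ideal a by simp
    have "\<one> \<notin> P" using a by (auto simp: ann_def)
    then show "carrier R \<noteq> P" by auto
    fix r s assume rs: "r \<in> carrier R" "s \<in> carrier R" "r \<otimes> s \<in> P"
    show "r \<in> P \<or> s \<in> P"
    proof (rule ccontr)
      assume n: "\<not> (r \<in> P \<or> s \<in> P)"
      then have sa: "s \<otimes> a \<noteq> \<zero>" using rs a by (auto simp: ann_def)
      have "x \<otimes> (s \<otimes> a) = s \<otimes> (x \<otimes> a)" if "x \<in> carrier R" for x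
        using that rs(2) a(1) by (rule m_lcomm)
      then have "P \<subseteq> ann R (s \<otimes> a)" using a rs by (auto simp: ann_def)
      then have "ann R (s \<otimes> a) = P" using max sa rs a by auto
      moreover have "r \<in> ann R (s \<otimes> a)" using rs a by (auto simp: ann_def m_assoc)
      ultimately show False using n by simp
    qed
  qed (rule is_cring)
qed

text \<open>Each member is the annihilator of some \<open>x P\<close>, and finitely many
  \<open>x Q\<close> generate the ideal of all of them. A further \<open>P\<close> contains none of
  these \<open>Q\<close> by maximality, so some \<open>r\<close> outside \<open>P\<close> is in all
  of them; it kills every \<open>x Q\<close> and hence \<open>x P\<close>, a contradiction.\<close>

lemma (in noeth_local) finite_max_ann: "finite (max_ann R)"
proof -
  have "\<forall>P\<in>max_ann R. \<exists>a\<in>carrier R. P = ann R a" by (auto simp: max_ann_def)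
  then obtain x where x: "\<And>P. P \<in> max_ann R \<Longrightarrow> x P \<in> carrier R \<and> P = ann R (x P)" by metis
  obtain T where T: "T \<subseteq> x ` max_ann R" "finite T" "x ` max_ann R \<subseteq> Idl T"
    using finite_subset_generates[of "x ` max_ann R"] x by blast
  obtain \<Q> where Q: "\<Q> \<subseteq> max_ann R" "finite \<Q>" "T = x ` \<Q>"
    using T(1,2) finite_subset_image by metis
  have "max_ann R \<subseteq> \<Q>"
  proof (rule ccontr)
    assume "\<not> max_ann R \<subseteq> \<Q>"
    then obtain P where P: "P \<in> max_ann R" "P \<notin> \<Q>" by blast
    have "ideal Q R \<and> \<not> Q \<subseteq> P" if q: "Q \<in> \<Q>" for Q
    proof -
      have "Q \<in> max_ann R" using q Q by blast
      then have "Q = P" if "Q \<subseteq> P" using P(1) that by (auto simp: max_ann_def)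
      then show ?thesis using P(2) q max_ann_prime[OF \<open>Q \<in> max_ann R\<close>] primeideal.axioms(1) by blast
    qed
    then obtain r where r: "r \<in> carrier R" "r \<notin> P" "\<And>Q. Q \<in> \<Q> \<Longrightarrow> r \<in> Q"
      using primeideal_avoid_Inter[OF max_ann_prime[OF P(1)] Q(2)] by blast
    have "T \<subseteq> ann R r"
    proof
      fix t assume "t \<in> T"
      then obtain Q where q: "Q \<in> \<Q>" "t = x Q" using Q(3) by blast
      then have "r \<in> ann R t" "t \<in> carrier R" using r(3) x Q(1) by auto
      then show "t \<in> ann R r" by (auto simp: ann_def m_comm)
    qed
    then have "Idl T \<subseteq> ann R r" by (rule genideal_minimal[OF ann_ideal[OF r(1)]])
    then have "x P \<in> ann R r" using T(3) P(1) by auto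
    then have "r \<in> ann R (x P)" using r(1) by (auto simp: ann_def m_comm)
    then show False using r(2) x[OF P(1)] by simp
  qed
  then show ?thesis using Q(2) finite_subset by blast
qed

definition nonzerodivisor where
  "nonzerodivisor R z \<longleftrightarrow> z \<in> carrier R \<and> (\<forall>b\<in>carrier R. z \<otimes>\<^bsub>R\<^esub> b = \<zero>\<^bsub>R\<^esub> \<longrightarrow> b = \<zero>\<^bsub>R\<^esub>)"

text \<open>By \<open>soc\<close> no maximal annihilator contains \<open>\<mm>\<close>, so by
  \<open>gen\<close> none contains both \<open>h\<close> and \<open>J\<close>, and coset avoidance
  applies. The coset matters: later \<open>J\<close> is generated by the remaining generators, and
  \<open>h + j\<close> can replace \<open>h\<close> among them.\<close>

lemma (in noeth_local) nonzerodivisor_coset: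
  assumes J: "ideal J R" and h: "h \<in> carrier R"
    and gen: "\<And>P. ideal P R \<Longrightarrow> h \<in> P \<Longrightarrow> J \<subseteq> P \<Longrightarrow> \<mm> \<subseteq> P"
    and soc: "\<And>a. a \<in> carrier R \<Longrightarrow> (\<And>r. r \<in> \<mm> \<Longrightarrow> r \<otimes> a = \<zero>) \<Longrightarrow> a = \<zero>"
  shows "\<exists>j\<in>J. nonzerodivisor R (h \<oplus> j)"
proof -
  have idl: "ideal P R" if "P \<in> max_ann R" for P
    using max_ann_prime[OF that] primeideal.axioms(1) by blast
  have "\<not> \<mm> \<subseteq> P" if "P \<in> max_ann R" for P
    using that soc by (auto simp: max_ann_def ann_def)
  then have "\<exists>j\<in>J. \<forall>P\<in>max_ann R. h \<oplus> j \<notin> P"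
    using gen idl
    by (intro primeideal_coset_avoidance finite_max_ann max_ann_prime J h) (auto simp: max_ann_def)
  then obtain j where j: "j \<in> J" "\<And>P. P \<in> max_ann R \<Longrightarrow> h \<oplus> j \<notin> P" by blast
  have jc: "j \<in> carrier R" using ideal.Icarr[OF J j(1)] .
  have "b = \<zero>" if b: "b \<in> carrier R" "(h \<oplus> j) \<otimes> b = \<zero>" for b
  proof (rule ccontr)
    assume nz: "b \<noteq> \<zero>"
    \<comment> \<open>The annihilators above that of \<open>b\<close>; a maximal one belongs to
      \<open>max_ann R\<close> and contains the zero divisor \<open>h + j\<close>.\<close>
    define \<F> where "\<F> = {ann R a |a. a \<in> carrier R - {\<zero>} \<and> ann R b \<subseteq> ann R a}"
    have F: "ann R a \<in> \<F>" if "a \<in> carrier R - {\<zero>}" "ann R b \<subseteq> ann R a" for a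
      using that unfolding \<F>_def by blast
    have "ideal K R" if "K \<in> \<F>" for K using that ann_ideal unfolding \<F>_def by blast
    then obtain M where M: "M \<in> \<F>" and M': "\<And>K. K \<in> \<F> \<Longrightarrow> M \<subseteq> K \<Longrightarrow> K = M"
      using ideal_family_has_maximal[OF F[of b]] b nz by blast
    obtain a where a: "a \<in> carrier R - {\<zero>}" "M = ann R a" and bM: "ann R b \<subseteq> M"
      using M unfolding \<F>_def by blast
    have "ann R c = M" if c: "c \<in> carrier R - {\<zero>}" "M \<subseteq> ann R c" for c
      by (rule M'[OF F[OF c(1)] c(2)]) (use bM c(2) in simp)
    then have "M \<in> max_ann R" unfolding max_ann_def using a by blast
    moreover have "h \<oplus> j \<in> M" using bM b h jc by (auto simp: ann_def)
    ultimately show False using j(2) by blast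
  qed
  then show ?thesis using j(1) h jc by (auto simp: nonzerodivisor_def)
qed

section \<open>The socle and finite minimal resolutions\<close>

context noeth_local
begin

text \<open>The cover is injective, so \<open>N\<close> is free. For an index \<open>i\<close> the
  vector \<open>unit_vec R i\<close> times \<open>a\<close> would be a relation, which forces
  \<open>a\<close> to be zero; so there is no index.\<close>

lemma socle_kills_free_cover:
  assumes N: "module R N" and c: "is_cover R I \<alpha> N" and k: "ker (free_mod R I) N \<alpha> = {\<zero>\<^bsub>free_mod R I\<^esub>}"
    and a: "a \<in> carrier R" "a \<noteq> \<zero>" "\<And>x. x \<in> carrier N \<Longrightarrow> a \<odot>\<^bsub>N\<^esub> x = \<zero>\<^bsub>N\<^esub>"
  shows "carrier N = {\<zero>\<^bsub>N\<^esub>}"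
proof -
  let ?F = "free_mod R I"
  interpret F: module R ?F by (rule free_mod_module')
  note c' = is_coverD[OF c]
  have "I = {}"
  proof (rule ccontr)
    assume "I \<noteq> {}"
    then obtain i where i: "i \<in> I" by blast
    have e: "unit_vec R i \<in> carrier ?F" by (rule unit_vec_closed[OF i])
    have "a \<odot>\<^bsub>?F\<^esub> unit_vec R i \<in> ker ?F N \<alpha>"
      using a e mod_homD(1)[OF c'(2) e] by (simp add: ker_def mod_homD(3)[OF c'(2)])
    then have "a \<odot>\<^bsub>?F\<^esub> unit_vec R i = \<zero>\<^bsub>?F\<^esub>" using k by simp
    then have "a \<otimes> unit_vec R i i = \<zero>" by (simp add: free_mod_sel fun_eq_iff)
    then show False using a by (simp add: unit_vec_def)
  qed
  then have "carrier ?F = {\<zero>\<^bsub>?F\<^esub>}" by (auto simp: free_mod_carrier free_mod_sel fun_eq_iff)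
  then have "carrier N = {\<alpha> \<zero>\<^bsub>?F\<^esub>}" using c'(3) by (metis image_empty image_insert)
  then show ?thesis using mod_hom_zero[OF free_mod_module' N c'(2)] by simp
qed

text \<open>By minimality the kernel of each cover has entries in \<open>\<mm>\<close>, so
  \<open>a\<close> kills the kernel, which is zero by induction. Then the cover is injective and
  \<open>socle_kills_free_cover\<close> applies.\<close>

lemma socle_kills_min_res:
  assumes "module R N" "min_res R \<mm> j N"
    and "\<And>x. x \<in> carrier N \<Longrightarrow> a \<odot>\<^bsub>N\<^esub> x = \<zero>\<^bsub>N\<^esub>"
    and a: "a \<in> carrier R" "a \<noteq> \<zero>" "\<And>r. r \<in> \<mm> \<Longrightarrow> a \<otimes> r = \<zero>"
  shows "carrier N = {\<zero>\<^bsub>N\<^esub>}"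
  using assms(1-3)
proof (induction j arbitrary: N)
  case (Suc j)
  obtain I \<alpha> where c: "min_cover R \<mm> I \<alpha> N" and r: "min_res R \<mm> j (ker_mod (free_mod R I) N \<alpha>)"
    using Suc.prems by auto
  let ?F = "free_mod R I"
  have cc: "is_cover R I \<alpha> N" using c by (simp add: min_cover_def)
  note c' = is_coverD[OF cc]
  have K: "module R (ker_mod ?F N \<alpha>)"
    by (rule submodule_module[OF free_mod_module' ker_submodule[OF free_mod_module' Suc.prems(1) c'(2)]])
  have "carrier (ker_mod ?F N \<alpha>) = {\<zero>\<^bsub>ker_mod ?F N \<alpha>\<^esub>}"
    by (rule Suc.IH[OF K r]) (use c a(3) in \<open>auto simp: free_mod_sel min_cover_def\<close>)
  then show ?case using socle_kills_free_cover[OF Suc.prems(1) cc _ a(1,2) Suc.prems(3)] by simp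
qed simp

end

section \<open>Reduction modulo a non-zero-divisor\<close>

text \<open>Beforehand \<open>S\<close> is a bare record; each ring law is checked on
  representatives, where it follows from the law in \<open>R\<close>.\<close>

lemma (in cring) cring_surjective_image:
  fixes S (structure)
  assumes surj: "\<pi> ` carrier R = carrier S"
    and mult: "\<And>a b. a \<in> carrier R \<Longrightarrow> b \<in> carrier R \<Longrightarrow> \<pi> (a \<otimes>\<^bsub>R\<^esub> b) = \<pi> a \<otimes>\<^bsub>S\<^esub> \<pi> b"
    and add: "\<And>a b. a \<in> carrier R \<Longrightarrow> b \<in> carrier R \<Longrightarrow> \<pi> (a \<oplus>\<^bsub>R\<^esub> b) = \<pi> a \<oplus>\<^bsub>S\<^esub> \<pi> b"
    and one: "\<pi> \<one>\<^bsub>R\<^esub> = \<one>\<^bsub>S\<^esub>" and zero: "\<pi> \<zero>\<^bsub>R\<^esub> = \<zero>\<^bsub>S\<^esub>"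
  shows "cring S"
proof -
  have c: "\<pi> a \<in> carrier S" if "a \<in> carrier R" for a using surj that by blast
  have P: "\<forall>s\<in>carrier S. Q s" if "\<And>a. a \<in> carrier R \<Longrightarrow> Q (\<pi> a)" for Q
    unfolding surj[symmetric] using that by simp
  note reps = mult[symmetric] add[symmetric] one[symmetric] zero[symmetric]
  have "\<forall>x\<in>carrier S. \<forall>y\<in>carrier S. x \<oplus>\<^bsub>S\<^esub> y \<in> carrier S \<and> x \<otimes>\<^bsub>S\<^esub> y \<in> carrier S"
    by (intro P) (auto simp: reps c)
  moreover have "\<forall>x\<in>carrier S. \<forall>y\<in>carrier S. x \<oplus>\<^bsub>S\<^esub> y = y \<oplus>\<^bsub>S\<^esub> x \<and> x \<otimes>\<^bsub>S\<^esub> y = y \<otimes>\<^bsub>S\<^esub> x"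
    by (intro P) (simp add: reps a_comm m_comm)
  moreover have "\<forall>x\<in>carrier S. \<forall>y\<in>carrier S. \<forall>z\<in>carrier S.
      (x \<oplus>\<^bsub>S\<^esub> y) \<oplus>\<^bsub>S\<^esub> z = x \<oplus>\<^bsub>S\<^esub> (y \<oplus>\<^bsub>S\<^esub> z) \<and> (x \<otimes>\<^bsub>S\<^esub> y) \<otimes>\<^bsub>S\<^esub> z = x \<otimes>\<^bsub>S\<^esub> (y \<otimes>\<^bsub>S\<^esub> z) \<and>
      (x \<oplus>\<^bsub>S\<^esub> y) \<otimes>\<^bsub>S\<^esub> z = x \<otimes>\<^bsub>S\<^esub> z \<oplus>\<^bsub>S\<^esub> y \<otimes>\<^bsub>S\<^esub> z"
    by (intro P) (simp add: reps a_assoc m_assoc l_distr)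
  moreover have "\<forall>x\<in>carrier S. \<zero>\<^bsub>S\<^esub> \<oplus>\<^bsub>S\<^esub> x = x \<and> \<one>\<^bsub>S\<^esub> \<otimes>\<^bsub>S\<^esub> x = x"
    by (intro P) (simp add: reps)
  moreover have "\<forall>x\<in>carrier S. \<exists>y\<in>carrier S. y \<oplus>\<^bsub>S\<^esub> x = \<zero>\<^bsub>S\<^esub>"
  proof (rule P)
    fix a assume a: "a \<in> carrier R"
    then have "\<pi> (\<ominus>\<^bsub>R\<^esub> a) \<oplus>\<^bsub>S\<^esub> \<pi> a = \<zero>\<^bsub>S\<^esub>" by (simp add: reps l_neg)
    then show "\<exists>y\<in>carrier S. y \<oplus>\<^bsub>S\<^esub> \<pi> a = \<zero>\<^bsub>S\<^esub>" using c a by blast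
  qed
  moreover have "\<one>\<^bsub>S\<^esub> \<in> carrier S" "\<zero>\<^bsub>S\<^esub> \<in> carrier S" using c one zero by (metis one_closed, metis zero_closed)
  ultimately show ?thesis
    by (intro cringI abelian_groupI comm_monoidI) auto
qed

text \<open>The induction over quotient rings has to stay within one type of rings, so \<open>R/I\<close> is
  realised on a set of representatives of the cosets.\<close>

lemma (in cring) quotient_ring_same_type:
  assumes I: "ideal I R"
  shows "\<exists>(S :: ('a, 'b) ring_scheme) \<pi>. cring S \<and> \<pi> \<in> ring_hom R S \<and> \<pi> ` carrier R = carrier S \<and>
    (\<forall>a\<in>carrier R. \<pi> a = \<zero>\<^bsub>S\<^esub> \<longleftrightarrow> a \<in> I)"
proof -
  interpret I: ideal I R by fact
  \<comment> \<open>A chosen element of the coset of \<open>a\<close>. It depends on the coset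
    alone, so \<open>\<pi> a = \<pi> b\<close> means equality of cosets.\<close>
  define \<pi> where "\<pi> a = (SOME b. b \<in> carrier R \<and> I +> b = I +> a)" for a
  have p: "\<pi> a \<in> carrier R" "I +> \<pi> a = I +> a" if "a \<in> carrier R" for a
    using someI[of "\<lambda>b. b \<in> carrier R \<and> I +> b = I +> a" a] that by (auto simp: \<pi>_def)
  have eq: "\<pi> a = \<pi> b" if "I +> a = I +> b" for a b using that by (simp add: \<pi>_def)
  have inj: "\<pi> a = \<pi> b \<longleftrightarrow> I +> a = I +> b" if "a \<in> carrier R" "b \<in> carrier R" for a b
    using eq p(2) that by metis
  \<comment> \<open>The operations are those of \<open>R\<close> followed by \<open>\<pi>\<close>.
    Updating the record \<open>R\<close> keeps its type, including any further fields.\<close>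
  define S where "S = R\<lparr>carrier := \<pi> ` carrier R, monoid.mult := \<lambda>a b. \<pi> (a \<otimes> b), one := \<pi> \<one>,
    ring.zero := \<pi> \<zero>, ring.add := \<lambda>a b. \<pi> (a \<oplus> b)\<rparr>"
  have mult: "\<pi> (a \<otimes> b) = \<pi> a \<otimes>\<^bsub>S\<^esub> \<pi> b" if "a \<in> carrier R" "b \<in> carrier R" for a b
  proof -
    have "I +> (a \<otimes> b) = I +> (\<pi> a \<otimes> \<pi> b)"
      using I.rcoset_mult_add[OF that] I.rcoset_mult_add[OF p(1) p(1), OF that] p(2) that by simp
    from eq[OF this] show ?thesis by (simp add: S_def)
  qed
  have add: "\<pi> (a \<oplus> b) = \<pi> a \<oplus>\<^bsub>S\<^esub> \<pi> b" if "a \<in> carrier R" "b \<in> carrier R" for a b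
  proof -
    have "I +> (a \<oplus> b) = I +> (\<pi> a \<oplus> \<pi> b)"
      using I.a_rcos_sum[OF that] I.a_rcos_sum[OF p(1) p(1), OF that] p(2) that by simp
    from eq[OF this] show ?thesis by (simp add: S_def)
  qed
  have S: "cring S"
    by (rule cring_surjective_image[of \<pi>]) (auto simp: mult add, auto simp: S_def)
  have "\<pi> \<in> ring_hom R S" by (rule ring_hom_memI) (auto simp: mult add, auto simp: S_def)
  moreover have "\<pi> a = \<zero>\<^bsub>S\<^esub> \<longleftrightarrow> a \<in> I" if a: "a \<in> carrier R" for a
  proof -
    have "\<pi> a = \<zero>\<^bsub>S\<^esub> \<longleftrightarrow> I +> a = I +> \<zero>" using inj[OF a zero_closed] by (simp add: S_def)
    also have "I +> \<zero> = I" by (rule a_rcos_zero[OF I]) simp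
    also have "I +> a = I \<longleftrightarrow> a \<in> I" using I.rcos_const_imp_mem[OF a] a_rcos_zero[OF I] by blast
    finally show ?thesis .
  qed
  moreover have "\<pi> ` carrier R = carrier S" by (simp add: S_def)
  ultimately show ?thesis using S by blast
qed

text \<open>\<open>S\<close> stands for \<open>R/(z)\<close>, given only through a surjection with
  kernel \<open>zR\<close>. Both rings share one type, as the induction over quotients
  demands.\<close>

locale regular_quotient = R?: noeth_local R \<mm> + S: cring S
  for R :: "('a, 'r) ring_scheme" (structure) and \<mm> and S :: "('a, 'r) ring_scheme" +
  fixes \<pi> :: "'a \<Rightarrow> 'a" and z :: 'a
  assumes hom: "\<pi> \<in> ring_hom R S" and surj: "\<pi> ` carrier R = carrier S"
    and zero_iff: "a \<in> carrier R \<Longrightarrow> \<pi> a = \<zero>\<^bsub>S\<^esub> \<longleftrightarrow> (\<exists>b\<in>carrier R. a = z \<otimes> b)"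
    and z_max: "z \<in> \<mm>" and z_nzd: "nonzerodivisor R z"
begin

lemma ring_hom: "ring_hom_ring R S \<pi>"
  by (rule ring_hom_ringI2[OF R.ring_axioms S.ring_axioms hom])

lemma image_simps [simp]:
  "a \<in> carrier R \<Longrightarrow> \<pi> a \<in> carrier S"
  "a \<in> carrier R \<Longrightarrow> b \<in> carrier R \<Longrightarrow> \<pi> (a \<oplus> b) = \<pi> a \<oplus>\<^bsub>S\<^esub> \<pi> b"
  "a \<in> carrier R \<Longrightarrow> b \<in> carrier R \<Longrightarrow> \<pi> (a \<otimes> b) = \<pi> a \<otimes>\<^bsub>S\<^esub> \<pi> b"
  "\<pi> \<one> = \<one>\<^bsub>S\<^esub>" "\<pi> \<zero> = \<zero>\<^bsub>S\<^esub>"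
  "a \<in> carrier R \<Longrightarrow> \<pi> (\<ominus> a) = \<ominus>\<^bsub>S\<^esub> \<pi> a"
proof -
  interpret h: ring_hom_ring R S \<pi> by (rule ring_hom)
  show "a \<in> carrier R \<Longrightarrow> \<pi> a \<in> carrier S"
    "a \<in> carrier R \<Longrightarrow> b \<in> carrier R \<Longrightarrow> \<pi> (a \<oplus> b) = \<pi> a \<oplus>\<^bsub>S\<^esub> \<pi> b"
    "a \<in> carrier R \<Longrightarrow> b \<in> carrier R \<Longrightarrow> \<pi> (a \<otimes> b) = \<pi> a \<otimes>\<^bsub>S\<^esub> \<pi> b"
    "\<pi> \<one> = \<one>\<^bsub>S\<^esub>" "\<pi> \<zero> = \<zero>\<^bsub>S\<^esub>"
    "a \<in> carrier R \<Longrightarrow> \<pi> (\<ominus> a) = \<ominus>\<^bsub>S\<^esub> \<pi> a" by auto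
qed

lemmas vimage_ideal = ring_hom_ring.ideal_vimage[OF ring_hom]

lemma surjE:
  assumes "s \<in> carrier S"
  obtains a where "a \<in> carrier R" "s = \<pi> a"
proof -
  from assms have "s \<in> \<pi> ` carrier R" by (simp only: surj)
  then show ?thesis using that by (rule imageE)
qed

text \<open>A section of \<open>\<pi>\<close>, made to send zero to zero so that applying it
  entrywise to a vector of \<open>free_mod S I\<close> creates no entries outside
  \<open>I\<close>.\<close>

definition sec :: "'a \<Rightarrow> 'a" where
  "sec s = (if s = \<zero>\<^bsub>S\<^esub> then \<zero> else (SOME a. a \<in> carrier R \<and> \<pi> a = s))"

lemma sec: "s \<in> carrier S \<Longrightarrow> sec s \<in> carrier R" "s \<in> carrier S \<Longrightarrow> \<pi> (sec s) = s"
  "sec \<zero>\<^bsub>S\<^esub> = \<zero>"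
proof -
  have "sec s \<in> carrier R \<and> \<pi> (sec s) = s" if "s \<in> carrier S"
  proof (cases "s = \<zero>\<^bsub>S\<^esub>")
    case False
    have "\<exists>a. a \<in> carrier R \<and> \<pi> a = s" by (rule surjE[OF that]) blast
    from someI_ex[OF this] show ?thesis using False by (simp add: sec_def)
  qed (simp add: sec_def)
  then show "s \<in> carrier S \<Longrightarrow> sec s \<in> carrier R" "s \<in> carrier S \<Longrightarrow> \<pi> (sec s) = s" by auto
qed (simp add: sec_def)

lemma z_closed: "z \<in> carrier R" using z_max max_simps(1) by blast

lemma image_z: "\<pi> z = \<zero>\<^bsub>S\<^esub>"
proof -
  have "\<exists>b\<in>carrier R. z = z \<otimes> b" using z_closed by (intro bexI[of _ \<one>]) auto
  then show ?thesis using zero_iff[OF z_closed] by simp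
qed

lemma z_cancel: "a \<in> carrier R \<Longrightarrow> z \<otimes> a = \<zero> \<Longrightarrow> a = \<zero>"
  using z_nzd by (simp add: nonzerodivisor_def)

lemma diff_in_ker:
  assumes "a \<in> carrier R" "b \<in> carrier R" "\<pi> a = \<pi> b"
  obtains c where "c \<in> carrier R" "a = b \<oplus> z \<otimes> c"
proof -
  have "\<pi> (a \<ominus> b) = \<zero>\<^bsub>S\<^esub>" using assms by (simp add: a_minus_def S.r_neg)
  then obtain c where c: "c \<in> carrier R" "a \<ominus> b = z \<otimes> c"
    using zero_iff assms(1,2) by auto
  have "a = b \<oplus> (a \<ominus> b)" using assms(1,2) by (simp add: a_minus_def a_lcomm r_neg)
  then show ?thesis using that c by simp
qed

lemma mem_if_image_mem:
  assumes J: "ideal J R" "z \<in> J" and a: "a \<in> carrier R" "\<pi> a \<in> \<pi> ` J"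
  shows "a \<in> J"
proof -
  interpret J: ideal J R by fact
  obtain b where b: "b \<in> J" "\<pi> a = \<pi> b" using a(2) by blast
  then obtain c where "c \<in> carrier R" "a = b \<oplus> z \<otimes> c"
    using diff_in_ker[OF a(1) J.Icarr] by blast
  then show ?thesis using b(1) J.I_r_closed[OF J(2)] by simp
qed

lemma image_ideal: assumes J: "ideal J R" shows "ideal (\<pi> ` J) S"
proof -
  interpret J: ideal J R by fact
  show ?thesis
  proof (rule S.idealI')
    show "\<zero>\<^bsub>S\<^esub> \<in> \<pi> ` J" by (rule image_eqI[of _ _ "\<zero>"]) auto
    fix a b assume "a \<in> \<pi> ` J" "b \<in> \<pi> ` J"
    then obtain a' b' where "a' \<in> J" "b' \<in> J" "a = \<pi> a'" "b = \<pi> b'" by blast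
    then show "a \<oplus>\<^bsub>S\<^esub> b \<in> \<pi> ` J" by (intro image_eqI[of _ _ "a' \<oplus> b'"]) (auto simp: J.Icarr)
  next
    fix a s assume s: "s \<in> carrier S" "a \<in> \<pi> ` J"
    obtain s' where "s' \<in> carrier R" "s = \<pi> s'" by (rule surjE[OF s(1)])
    moreover obtain a' where "a' \<in> J" "a = \<pi> a'" using s(2) by blast
    ultimately show "s \<otimes>\<^bsub>S\<^esub> a \<in> \<pi> ` J"
      by (intro image_eqI[of _ _ "s' \<otimes> a'"]) (auto simp: J.Icarr J.I_l_closed)
  qed (use J.Icarr in auto)
qed

text \<open>Ideals of \<open>S\<close> correspond to ideals of \<open>R\<close> containing
  \<open>z\<close>: one direction takes the preimage of an ideal, the other the image. This is what
  carries regularity back from \<open>S\<close> to \<open>R\<close>.\<close>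

lemma genideal_iff:
  assumes T: "T \<subseteq> carrier R" and a: "a \<in> carrier R"
  shows "a \<in> Idl\<^bsub>R\<^esub> (insert z T) \<longleftrightarrow> \<pi> a \<in> Idl\<^bsub>S\<^esub> (\<pi> ` T)"
proof
  have zT: "insert z T \<subseteq> carrier R" using T z_closed by blast
  have pT: "\<pi> ` T \<subseteq> carrier S" using T by auto
  note gi = R.genideal_ideal[OF zT] and gs = R.genideal_self[OF zT]
  have "ideal {r \<in> carrier R. \<pi> r \<in> Idl\<^bsub>S\<^esub> (\<pi> ` T)} R"
    by (rule vimage_ideal[OF S.genideal_ideal[OF pT]])
  moreover have "insert z T \<subseteq> {r \<in> carrier R. \<pi> r \<in> Idl\<^bsub>S\<^esub> (\<pi> ` T)}"
    using zT image_z S.genideal_self[OF pT]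
      additive_subgroup.zero_closed[OF ideal.axioms(1)[OF S.genideal_ideal[OF pT]]] by auto
  ultimately have "Idl\<^bsub>R\<^esub> (insert z T) \<subseteq> {r \<in> carrier R. \<pi> r \<in> Idl\<^bsub>S\<^esub> (\<pi> ` T)}"
    by (rule R.genideal_minimal)
  then show "a \<in> Idl\<^bsub>R\<^esub> (insert z T) \<Longrightarrow> \<pi> a \<in> Idl\<^bsub>S\<^esub> (\<pi> ` T)" by blast
  assume "\<pi> a \<in> Idl\<^bsub>S\<^esub> (\<pi> ` T)"
  moreover have "Idl\<^bsub>S\<^esub> (\<pi> ` T) \<subseteq> \<pi> ` (Idl\<^bsub>R\<^esub> (insert z T))"
    by (rule S.genideal_minimal[OF image_ideal[OF gi]]) (use gs in auto)
  ultimately show "a \<in> Idl\<^bsub>R\<^esub> (insert z T)"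
    using mem_if_image_mem[OF gi _ a] gs by auto
qed

lemma quotient_noeth_local: "noeth_local S (\<pi> ` \<mm>)"
proof -
  have "noetherian_ring S"
  proof (rule S.noetherian_ringI)
    fix J assume J: "ideal J S"
    let ?K = "{r \<in> carrier R. \<pi> r \<in> J}"
    obtain T where T: "T \<subseteq> carrier R" "finite T" "?K = Idl\<^bsub>R\<^esub> T"
      using R.finetely_gen[OF vimage_ideal[OF J]] by blast
    have pT: "\<pi> ` T \<subseteq> carrier S" using T by auto
    have "T \<subseteq> ?K" using R.genideal_self[OF T(1)] T(3) by simp
    then have "Idl\<^bsub>S\<^esub> (\<pi> ` T) \<subseteq> J" by (intro S.genideal_minimal[OF J]) auto
    moreover have "J \<subseteq> Idl\<^bsub>S\<^esub> (\<pi> ` T)"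
    proof
      fix s assume s: "s \<in> J"
      obtain r where r: "r \<in> carrier R" "s = \<pi> r" by (rule surjE[OF ideal.Icarr[OF J s]])
      have "insert z T \<subseteq> carrier R" using T(1) z_closed by blast
      then have "r \<in> Idl\<^bsub>R\<^esub> (insert z T)"
        using r s T(3) R.subset_Idl_subset[of "insert z T" T] by blast
      then show "s \<in> Idl\<^bsub>S\<^esub> (\<pi> ` T)" using genideal_iff[OF T(1) r(1)] r(2) by simp
    qed
    ultimately show "\<exists>A\<subseteq>carrier S. finite A \<and> J = Idl\<^bsub>S\<^esub> A" using T(2) pT by blast
  qed
  moreover have "noeth_local_axioms S (\<pi> ` \<mm>)"
  proof (rule noeth_local_axioms.intro)
    show "ideal (\<pi> ` \<mm>) S" by (rule image_ideal[OF ideal_max])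
    have "\<pi> \<one> \<notin> \<pi> ` \<mm>" using mem_if_image_mem[OF ideal_max z_max R.one_closed] one_notin_max by blast
    then show "\<pi> ` \<mm> \<noteq> carrier S" using image_simps(1)[OF R.one_closed] by blast
    fix s assume s: "s \<in> carrier S" "s \<notin> \<pi> ` \<mm>"
    obtain a where a: "a \<in> carrier R" "s = \<pi> a" by (rule surjE[OF s(1)])
    then have "a \<in> Units R" using units s by blast
    then obtain b where "b \<in> carrier R" "b \<otimes> a = \<one>" "a \<otimes> b = \<one>" by (auto simp: Units_def)
    then have "\<pi> b \<otimes>\<^bsub>S\<^esub> \<pi> a = \<one>\<^bsub>S\<^esub>" "\<pi> a \<otimes>\<^bsub>S\<^esub> \<pi> b = \<one>\<^bsub>S\<^esub>" "\<pi> b \<in> carrier S"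
      using a(1) image_simps(3)[of b a] image_simps(3)[of a b] by simp_all
    then show "s \<in> Units S" using a s unfolding Units_def by blast
  qed
  ultimately show ?thesis
    by (intro noeth_local.intro S.is_cring)
qed

section \<open>Reduction of free modules, linear maps and syzygies modulo \<open>z\<close>\<close>

lemma free_mod_image:
  assumes "finite I" "v \<in> carrier (free_mod R I)"
  shows "(\<lambda>k. \<pi> (v k)) \<in> carrier (free_mod S I)"
  using assms by (auto simp: free_mod_carrier)

lemma free_mod_sec:
  assumes "finite I" "w \<in> carrier (free_mod S I)"
  shows "(\<lambda>k. sec (w k)) \<in> carrier (free_mod R I)" "(\<lambda>k. \<pi> (sec (w k))) = w"
  using assms sec by (auto simp: free_mod_carrier)

lemma free_mod_surjE:
  assumes "finite I" "w \<in> carrier (free_mod S I)"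
  obtains v where "v \<in> carrier (free_mod R I)" "w = (\<lambda>k. \<pi> (v k))"
  by (rule that[OF free_mod_sec(1)[OF assms] free_mod_sec(2)[OF assms, symmetric]])

lemma free_mod_diff_in_ker:
  assumes I: "finite I" and v: "v \<in> carrier (free_mod R I)" "w \<in> carrier (free_mod R I)"
    and eq: "\<And>k. \<pi> (v k) = \<pi> (w k)"
  obtains u where "u \<in> carrier (free_mod R I)" "v = w \<oplus>\<^bsub>free_mod R I\<^esub> z \<odot>\<^bsub>free_mod R I\<^esub> u"
proof -
  have c: "v k \<in> carrier R" "w k \<in> carrier R" "k \<notin> I \<Longrightarrow> v k = \<zero>" "k \<notin> I \<Longrightarrow> w k = \<zero>" for k
    using v by (auto simp: free_mod_carrier[OF I])
  \<comment> \<open>The clause for \<open>k \<notin> I\<close> keeps the vector of chosen quotients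
    inside \<open>free_mod R I\<close>.\<close>
  have ex: "\<exists>u. u \<in> carrier R \<and> v k = w k \<oplus> z \<otimes> u \<and> (k \<notin> I \<longrightarrow> u = \<zero>)" for k
  proof (cases "k \<in> I")
    case True
    obtain u where "u \<in> carrier R" "v k = w k \<oplus> z \<otimes> u"
      by (rule diff_in_ker[OF c(1,2) eq])
    with True show ?thesis by (intro exI[of _ u]) simp
  next
    case False
    then show ?thesis using c(3,4)[of k] z_closed by (intro exI[of _ \<zero>]) simp
  qed
  define u where "u k = (SOME u. u \<in> carrier R \<and> v k = w k \<oplus> z \<otimes> u \<and> (k \<notin> I \<longrightarrow> u = \<zero>))" for k
  have "u k \<in> carrier R \<and> v k = w k \<oplus> z \<otimes> u k \<and> (k \<notin> I \<longrightarrow> u k = \<zero>)" for k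
    unfolding u_def by (rule someI_ex[OF ex])
  then show ?thesis using that[of u] by (auto simp: free_mod_carrier[OF I] free_mod_sel)
qed

text \<open>The map \<open>q\<close> is linear along \<open>\<pi>\<close>. Two lifts of a vector
  over \<open>S\<close> differ by a multiple of \<open>z\<close>, and \<open>q\<close> kills
  multiples of \<open>z\<close> because \<open>\<pi> z\<close> is zero; so evaluating
  \<open>q\<close> after \<open>\<alpha>\<close> on a lift does not depend on the lift.\<close>

lemma induced_hom:
  fixes M :: "('a, 'm) module" and N :: "('a, 'n) module"
  assumes I: "finite I" and M: "module R M" and N: "module S N"
    and \<alpha>: "\<alpha> \<in> mod_hom R (free_mod R I) M"
    and q: "\<And>x. x \<in> carrier M \<Longrightarrow> q x \<in> carrier N"
      "\<And>x y. x \<in> carrier M \<Longrightarrow> y \<in> carrier M \<Longrightarrow> q (x \<oplus>\<^bsub>M\<^esub> y) = q x \<oplus>\<^bsub>N\<^esub> q y"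
      "\<And>a x. a \<in> carrier R \<Longrightarrow> x \<in> carrier M \<Longrightarrow> q (a \<odot>\<^bsub>M\<^esub> x) = \<pi> a \<odot>\<^bsub>N\<^esub> q x"
  shows "\<exists>\<beta>\<in>mod_hom S (free_mod S I) N. \<forall>v\<in>carrier (free_mod R I). \<beta> (\<lambda>k. \<pi> (v k)) = q (\<alpha> v)"
proof -
  let ?F = "free_mod R I" and ?G = "free_mod S I"
  interpret F: module R ?F by (rule free_mod_module')
  interpret M: module R M by fact
  interpret N: module S N by fact
  define \<beta> where "\<beta> w = q (\<alpha> (\<lambda>k. sec (w k)))" for w
  have key: "\<beta> (\<lambda>k. \<pi> (v k)) = q (\<alpha> v)" if v: "v \<in> carrier ?F" for v
  proof -
    have w: "(\<lambda>k. \<pi> (v k)) \<in> carrier ?G" by (rule free_mod_image[OF I v])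
    have "\<pi> (sec (\<pi> (v k))) = \<pi> (v k)" for k
      using sec(2) v by (simp add: free_mod_carrier[OF I])
    then obtain u where u: "u \<in> carrier ?F" "(\<lambda>k. sec (\<pi> (v k))) = v \<oplus>\<^bsub>?F\<^esub> z \<odot>\<^bsub>?F\<^esub> u"
      by (rule free_mod_diff_in_ker[OF I free_mod_sec(1)[OF I w] v])
    have c: "\<alpha> v \<in> carrier M" "\<alpha> u \<in> carrier M" using mod_homD(1)[OF \<alpha>] v u(1) by auto
    have "\<beta> (\<lambda>k. \<pi> (v k)) = q (\<alpha> v \<oplus>\<^bsub>M\<^esub> z \<odot>\<^bsub>M\<^esub> \<alpha> u)"
      unfolding \<beta>_def u(2) using u(1) v z_closed by (simp add: mod_homD(2,3)[OF \<alpha>])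
    also have "\<dots> = q (\<alpha> v)" using c z_closed q(1)[OF c(1)] q(1)[OF c(2)] by (simp add: q image_z)
    finally show ?thesis .
  qed
  have "\<beta> \<in> mod_hom S ?G N"
  proof (rule mod_homI)
    fix w assume "w \<in> carrier ?G"
    then show "\<beta> w \<in> carrier N"
      unfolding \<beta>_def by (intro q(1) mod_homD(1)[OF \<alpha>] free_mod_sec(1)[OF I])
  next
    fix w w' assume w: "w \<in> carrier ?G" "w' \<in> carrier ?G"
    obtain v where v1: "v \<in> carrier ?F" "w = (\<lambda>k. \<pi> (v k))" by (rule free_mod_surjE[OF I w(1)])
    obtain v' where v2: "v' \<in> carrier ?F" "w' = (\<lambda>k. \<pi> (v' k))" by (rule free_mod_surjE[OF I w(2)])
    note v = v1(1) v2(1) v1(2) v2(2)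
    have "w \<oplus>\<^bsub>?G\<^esub> w' = (\<lambda>k. \<pi> ((v \<oplus>\<^bsub>?F\<^esub> v') k))"
      using v by (simp add: free_mod_sel free_mod_carrier[OF I])
    then show "\<beta> (w \<oplus>\<^bsub>?G\<^esub> w') = \<beta> w \<oplus>\<^bsub>N\<^esub> \<beta> w'"
      using v key[OF F.M.a_closed[OF v(1,2)]] key[OF v(1)] key[OF v(2)]
      by (simp add: mod_homD[OF \<alpha>] q)
  next
    fix s w assume s: "s \<in> carrier S" "w \<in> carrier ?G"
    obtain v where v: "v \<in> carrier ?F" "w = (\<lambda>k. \<pi> (v k))" by (rule free_mod_surjE[OF I s(2)])
    obtain r where r: "r \<in> carrier R" "s = \<pi> r" by (rule surjE[OF s(1)])
    have "s \<odot>\<^bsub>?G\<^esub> w = (\<lambda>k. \<pi> ((r \<odot>\<^bsub>?F\<^esub> v) k))"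
      using v r by (simp add: free_mod_sel free_mod_carrier[OF I])
    then show "\<beta> (s \<odot>\<^bsub>?G\<^esub> w) = s \<odot>\<^bsub>N\<^esub> \<beta> w"
      using v r key[OF F.smult_closed[OF r(1) v(1)]] key[OF v(1)]
      by (simp add: mod_homD[OF \<alpha>] q)
  qed
  then show ?thesis using key by blast
qed

definition red where "red K = (\<lambda>v k. \<pi> (v k)) ` K"

lemma red_submodule:
  assumes I: "finite I" and K: "submodule K R (free_mod R I)"
  shows "submodule (red K) S (free_mod S I)"
proof -
  let ?F = "free_mod R I" and ?G = "free_mod S I"
  have F: "module R ?F" by (rule free_mod_module')
  interpret G: module S ?G by (rule free_mod_module[OF S.is_cring])
  note k = submoduleD[OF F K]
  have kc: "v j \<in> carrier R" if "v \<in> K" for v j using that k(1) by (auto simp: free_mod_carrier[OF I])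
  show ?thesis
  proof (rule G.submoduleI')
    show "red K \<subseteq> carrier ?G" using k(1) free_mod_image[OF I] by (auto simp: red_def)
    show "\<zero>\<^bsub>?G\<^esub> \<in> red K"
      unfolding red_def by (rule image_eqI[OF _ k(2)]) (simp add: free_mod_sel)
    fix a b assume "a \<in> red K" "b \<in> red K"
    then obtain v w where v: "v \<in> K" "w \<in> K" "a = (\<lambda>j. \<pi> (v j))" "b = (\<lambda>j. \<pi> (w j))"
      by (auto simp: red_def)
    then show "a \<oplus>\<^bsub>?G\<^esub> b \<in> red K"
      unfolding red_def by (intro image_eqI[OF _ k(3)[OF v(1,2)]]) (simp add: free_mod_sel kc)
  next
    fix s b assume s: "s \<in> carrier S" "b \<in> red K"
    obtain r where r: "r \<in> carrier R" "s = \<pi> r" by (rule surjE[OF s(1)])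
    obtain v where "v \<in> K" "b = (\<lambda>j. \<pi> (v j))" using s(2) by (auto simp: red_def)
    note v = this r
    then show "s \<odot>\<^bsub>?G\<^esub> b \<in> red K"
      unfolding red_def by (intro image_eqI[OF _ k(4)[OF v(3) v(1)]]) (simp add: free_mod_sel kc)
  qed
qed

text \<open>The reduction of \<open>K\<close> is \<open>K/zK\<close> only if \<open>z\<close> is a non-zero-divisor modulo \<open>K\<close>; kernels have
  this property.\<close>

lemma min_res_red:
  fixes I :: "nat set"
  assumes "finite I" "submodule K R (free_mod R I)"
    and "\<And>u. u \<in> carrier (free_mod R I) \<Longrightarrow> z \<odot>\<^bsub>free_mod R I\<^esub> u \<in> K \<Longrightarrow> u \<in> K"
    and "min_res R \<mm> j ((free_mod R I)\<lparr>carrier := K\<rparr>)"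
  shows "min_res S (\<pi> ` \<mm>) j ((free_mod S I)\<lparr>carrier := red K\<rparr>)"
  using assms
proof (induction j arbitrary: I K)
  case 0
  then show ?case by (simp add: red_def free_mod_sel)
next
  case (Suc j)
  let ?F = "free_mod R I" and ?G = "free_mod S I"
  let ?M = "?F\<lparr>carrier := K\<rparr>" and ?N = "?G\<lparr>carrier := red K\<rparr>"
  note I = Suc.prems(1) and K = Suc.prems(2) and sat = Suc.prems(3)
  have F: "module R ?F" by (rule free_mod_module')
  have G: "module S ?G" by (rule free_mod_module[OF S.is_cring])
  interpret F: module R ?F by fact
  have M: "module R ?M" by (rule submodule_module[OF F K])
  have N: "module S ?N" by (rule submodule_module[OF G red_submodule[OF I K]])
  note k = submoduleD[OF F K]
  have kc: "v i \<in> carrier R" if "v \<in> K" for v i using that k(1) by (auto simp: free_mod_carrier[OF I])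
  obtain L \<alpha> where c: "min_cover R \<mm> L \<alpha> ?M" and res: "min_res R \<mm> j (ker_mod (free_mod R L) ?M \<alpha>)"
    using Suc.prems(4) by auto
  then have cc: "is_cover R L \<alpha> ?M" by (simp add: min_cover_def)
  note c' = is_coverD[OF cc]
  let ?L = "free_mod R L" and ?L' = "free_mod S L"
  interpret L: module R ?L by (rule free_mod_module')
  have "\<exists>\<beta>\<in>mod_hom S ?L' ?N. \<forall>v\<in>carrier ?L. \<beta> (\<lambda>k. \<pi> (v k)) = (\<lambda>v k. \<pi> (v k)) (\<alpha> v)"
    by (rule induced_hom[OF c'(1) M N c'(2)]) (auto simp: red_def free_mod_sel kc)
  then obtain \<beta> where b: "\<beta> \<in> mod_hom S ?L' ?N"
    and bv: "\<And>v. v \<in> carrier ?L \<Longrightarrow> \<beta> (\<lambda>k. \<pi> (v k)) = (\<lambda>k. \<pi> (\<alpha> v k))" by auto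
  have "carrier ?N \<subseteq> \<beta> ` carrier ?L'"
  proof
    fix y assume "y \<in> carrier ?N"
    then obtain u where "u \<in> K" "y = (\<lambda>k. \<pi> (u k))" by (auto simp: red_def)
    moreover from this obtain v where "v \<in> carrier ?L" "\<alpha> v = u" using c'(3) by auto
    ultimately show "y \<in> \<beta> ` carrier ?L'"
      by (intro image_eqI[OF _ free_mod_image[OF c'(1)]]) (simp_all add: bv)
  qed
  then have cov: "is_cover S L \<beta> ?N"
    using c'(1) b mod_homD(1)[OF b] by (auto simp: is_cover_def)
  \<comment> \<open>Reduction commutes with taking the kernel. If \<open>\<alpha> v\<close> reduces
    to zero, it equals \<open>z u\<close>; saturation puts \<open>u\<close> into \<open>K\<close>,
    so \<open>u = \<alpha> v'\<close>, and \<open>v - z v'\<close> is a relation with the same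
    reduction as \<open>v\<close>.\<close>
  have ker: "ker ?L' ?N \<beta> = red (ker ?L ?M \<alpha>)"
  proof
    show "red (ker ?L ?M \<alpha>) \<subseteq> ker ?L' ?N \<beta>"
      using bv free_mod_image[OF c'(1)] by (auto simp: red_def ker_def free_mod_sel)
    show "ker ?L' ?N \<beta> \<subseteq> red (ker ?L ?M \<alpha>)"
    proof
      fix w assume w: "w \<in> ker ?L' ?N \<beta>"
      then have "w \<in> carrier ?L'" by (simp add: ker_def)
      then obtain v where v: "v \<in> carrier ?L" "w = (\<lambda>k. \<pi> (v k))" by (rule free_mod_surjE[OF c'(1)])
      have aK: "\<alpha> v \<in> K" using mod_homD(1)[OF c'(2) v(1)] by simp
      have "\<pi> (\<alpha> v i) = \<pi> (\<zero>\<^bsub>?F\<^esub> i)" for i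
        using w bv[OF v(1)] v(2) by (simp add: ker_def free_mod_sel fun_eq_iff)
      then obtain u where u: "u \<in> carrier ?F" "\<alpha> v = \<zero>\<^bsub>?F\<^esub> \<oplus>\<^bsub>?F\<^esub> z \<odot>\<^bsub>?F\<^esub> u"
        by (rule free_mod_diff_in_ker[OF I subsetD[OF k(1) aK] F.M.zero_closed])
      then have au: "\<alpha> v = z \<odot>\<^bsub>?F\<^esub> u" using z_closed by simp
      then have "u \<in> K" using sat[OF u(1)] aK by simp
      then obtain v' where v': "v' \<in> carrier ?L" "\<alpha> v' = u" using c'(3) by auto
      define d where "d = v \<oplus>\<^bsub>?L\<^esub> (\<ominus> z) \<odot>\<^bsub>?L\<^esub> v'"
      have mz: "\<ominus> z \<in> carrier R" using z_closed by simp
      have dc: "d \<in> carrier ?L" using v v' mz by (simp add: d_def)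
      have "\<alpha> d = \<alpha> v \<oplus>\<^bsub>?F\<^esub> (\<ominus> z) \<odot>\<^bsub>?F\<^esub> u"
        unfolding d_def using mod_homD(2)[OF c'(2) v(1) L.smult_closed[OF mz v'(1)]]
          mod_homD(3)[OF c'(2) mz v'(1)] v'(2) by simp
      also have "\<dots> = \<zero>\<^bsub>?F\<^esub>"
        using u(1) z_closed by (simp add: au F.smult_l_minus F.M.r_neg)
      finally have "d \<in> ker ?L ?M \<alpha>" using dc by (simp add: ker_def)
      moreover have "\<pi> (d i) = w i" for i
      proof -
        show ?thesis using v v' z_closed
          by (simp add: image_z d_def free_mod_sel free_mod_carrier[OF c'(1)])
      qed
      ultimately show "w \<in> red (ker ?L ?M \<alpha>)" unfolding red_def by (intro image_eqI) auto
    qed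
  qed
  have "min_cover S (\<pi> ` \<mm>) L \<beta> ?N"
    using cov c unfolding min_cover_def ker by (auto simp: red_def)
  moreover have "min_res S (\<pi> ` \<mm>) j (?L'\<lparr>carrier := red (ker ?L ?M \<alpha>)\<rparr>)"
  proof (rule Suc.IH[OF c'(1) ker_submodule[OF free_mod_module' M c'(2)] _ res])
    \<comment> \<open>The kernel is saturated again, since \<open>z\<close> can be cancelled in the
      entries of \<open>\<alpha> u\<close>.\<close>
    fix u assume u: "u \<in> carrier ?L" "z \<odot>\<^bsub>?L\<^esub> u \<in> ker ?L ?M \<alpha>"
    have aK: "\<alpha> u \<in> K" using mod_homD(1)[OF c'(2) u(1)] by simp
    have "z \<otimes> \<alpha> u i = \<zero>" for i
      using u(2) mod_homD(3)[OF c'(2) z_closed u(1)] by (simp add: ker_def free_mod_sel fun_eq_iff)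
    then have "\<alpha> u i = \<zero>" for i using z_cancel[OF kc[OF aK]] by blast
    then show "u \<in> ker ?L ?M \<alpha>" using u(1) by (auto simp: ker_def free_mod_sel)
  qed
  ultimately show ?case unfolding min_res.simps(2) by (metis ker)
qed

end

section \<open>The maximal ideal\<close>

lemma ideal_module_sel [simp]:
  "carrier (ideal_module R J) = J" "\<zero>\<^bsub>ideal_module R J\<^esub> = \<zero>\<^bsub>R\<^esub>"
  "x \<oplus>\<^bsub>ideal_module R J\<^esub> y = x \<oplus>\<^bsub>R\<^esub> y" "a \<odot>\<^bsub>ideal_module R J\<^esub> x = a \<otimes>\<^bsub>R\<^esub> x"
  by (auto simp: ideal_module_def)

lemma module_zero_map: "module R A \<Longrightarrow> module R B \<Longrightarrow> (\<lambda>_. \<zero>\<^bsub>B\<^esub>) \<in> mod_hom R A B"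
proof (rule mod_homI)
  assume B: "module R B"
  interpret module R B by fact
  show "\<zero>\<^bsub>B\<^esub> \<in> carrier B" "\<zero>\<^bsub>B\<^esub> = \<zero>\<^bsub>B\<^esub> \<oplus>\<^bsub>B\<^esub> \<zero>\<^bsub>B\<^esub>" by simp_all
  show "\<zero>\<^bsub>B\<^esub> = a \<odot>\<^bsub>B\<^esub> \<zero>\<^bsub>B\<^esub>" if "a \<in> carrier R" for a using that by simp
qed

lemma stable_retractI:
  assumes A: "module R A" and B: "module R B" and i: "i \<in> mod_hom R A B" and p: "p \<in> mod_hom R B A"
    and id: "\<And>x. x \<in> carrier A \<Longrightarrow> p (i x) = x"
  shows "stable_retract R A B"
proof -
  interpret A: module R A by fact
  let ?F = "free_mod R ({} :: nat set)"
  have F: "module R ?F" by (rule free_mod_module[OF A.R.is_cring])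
  show ?thesis
    unfolding stable_retract_def
    by (rule exI[of _ "{}"], rule exI[of _ i], rule exI[of _ p], rule exI[of _ "\<lambda>_. \<zero>\<^bsub>?F\<^esub>"],
        rule exI[of _ "\<lambda>_. \<zero>\<^bsub>A\<^esub>"])
      (use i p id module_zero_map[OF A F] module_zero_map[OF F A] in simp)
qed

lemma (in cring) free_mod_split:
  assumes I: "finite I" and i: "i \<in> I" and v: "v \<in> carrier (free_mod R I)"
  obtains v' where "v' \<in> carrier (free_mod R (I - {i}))"
    "v = v' \<oplus>\<^bsub>free_mod R I\<^esub> v i \<odot>\<^bsub>free_mod R I\<^esub> unit_vec R i"
proof (rule that[of "\<lambda>k. if k = i then \<zero> else v k"])
  show "(\<lambda>k. if k = i then \<zero> else v k) \<in> carrier (free_mod R (I - {i}))"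
    using v I by (auto simp: free_mod_carrier)
  show "v = (\<lambda>k. if k = i then \<zero> else v k) \<oplus>\<^bsub>free_mod R I\<^esub> v i \<odot>\<^bsub>free_mod R I\<^esub> unit_vec R i"
    using v I by (auto simp: free_mod_carrier free_mod_sel unit_vec_def fun_eq_iff)
qed

lemma free_mod_Diff_subset: "carrier (free_mod R (I - {i})) \<subseteq> carrier (free_mod R I)"
  by (auto simp: free_mod_def)

lemma is_coverI:
  assumes "finite I" "\<alpha> \<in> mod_hom R (free_mod R I) A"
    and "\<And>y. y \<in> carrier A \<Longrightarrow> \<exists>v\<in>carrier (free_mod R I). \<alpha> v = y"
  shows "is_cover R I \<alpha> A"
  unfolding is_cover_def
proof (intro conjI assms(1,2) subset_antisym subsetI)
  fix y assume "y \<in> \<alpha> ` carrier (free_mod R I)"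
  then obtain v where "v \<in> carrier (free_mod R I)" "y = \<alpha> v" by (rule imageE) simp
  then show "y \<in> carrier A" using mod_homD(1)[OF assms(2)] by simp
next
  fix y assume "y \<in> carrier A"
  from assms(3)[OF this] obtain v where "v \<in> carrier (free_mod R I)" "\<alpha> v = y" by (rule bexE) simp
  then show "y \<in> \<alpha> ` carrier (free_mod R I)" by (intro image_eqI[of _ _ v]) simp_all
qed

lemma is_cover_surjE:
  assumes "is_cover R I \<alpha> A" "y \<in> carrier A"
  obtains v where "v \<in> carrier (free_mod R I)" "\<alpha> v = y"
proof -
  from assms have "y \<in> \<alpha> ` carrier (free_mod R I)" by (simp only: is_coverD(3))
  then show ?thesis using that by (elim imageE) simp
qed

text \<open>Finite projective dimension of \<open>\<mm>\<close>, expressed by its first syzygies: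
  these live in \<open>nat \<Rightarrow> 'a\<close>, the type that \<open>min_res\<close> requires,
  while the elements of \<open>\<mm>\<close> have type \<open>'a\<close>. Quantifying over all
  covers allows the generators to be changed later.\<close>

definition max_ideal_finite_res :: "('a, 'r) ring_scheme \<Rightarrow> 'a set \<Rightarrow> bool" where
  "max_ideal_finite_res R \<mm> \<longleftrightarrow> (\<forall>(I :: nat set) \<alpha>. is_cover R I \<alpha> (ideal_module R \<mm>) \<longrightarrow>
     (\<exists>j. min_res R \<mm> j (ker_mod (free_mod R I) (ideal_module R \<mm>) \<alpha>)))"

section \<open>The maximal ideal: finite resolutions and a regular generator\<close>

context noeth_local
begin

lemma max_module: "module R (ideal_module R \<mm>)"
  by (rule ideal_module_is_module[OF is_cring ideal_max])

lemma max_ideal_finite_resI: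
  fixes P :: "('a, 'p) module" and B :: "('a, 'q) module"
  assumes B: "module R B" and ret: "stable_retract R (ideal_module R \<mm>) B"
    and P: "projective_module R P" and \<beta>: "\<beta> \<in> mod_hom R P B" "\<beta> ` carrier P = carrier B"
    and res: "proj_res R j (ker_mod P B \<beta>)"
  shows "max_ideal_finite_res R \<mm>"
  unfolding max_ideal_finite_res_def
proof (intro allI impI)
  fix I :: "nat set" and \<alpha> assume c: "is_cover R I \<alpha> (ideal_module R \<mm>)"
  have PM: "module R P" using P by (simp add: projective_module_def)
  have "module R (ker_mod P B \<beta>)"
    by (rule submodule_module[OF PM ker_submodule[OF PM B \<beta>(1)]])
  from min_res_if_stable_retract[OF is_coverD(1)[OF c] ker_submodule[OF free_mod_module' max_module is_coverD(2)[OF c]]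
      this stable_retract_syzygy[OF max_module B ret c P \<beta>] res]
  show "\<exists>j. min_res R \<mm> j (ker_mod (free_mod R I) (ideal_module R \<mm>) \<alpha>)" by (rule exI)
qed

text \<open>Used over the quotient ring, where a resolution of \<open>B\<close> itself is at hand.
  If \<open>B\<close> is zero, it is covered by itself to obtain a first syzygy.\<close>

lemma max_ideal_finite_resI':
  fixes B :: "('a, 'q) module"
  assumes B: "module R B" and ret: "stable_retract R (ideal_module R \<mm>) B" and res: "proj_res R j B"
  shows "max_ideal_finite_res R \<mm>"
proof (cases j)
  case 0
  then have z: "carrier B = {\<zero>\<^bsub>B\<^esub>}" using res by simp
  show ?thesis
  proof (rule max_ideal_finite_resI[OF B ret zero_module_projective[OF B z]])
    show "(\<lambda>x. x) \<in> mod_hom R B B" by (auto simp: mod_hom_def)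
    show "proj_res R 0 (ker_mod B B (\<lambda>x. x))" using z by (simp add: ker_def)
  qed simp
next
  case (Suc k)
  then obtain P :: "('a, 'q) module" and \<beta> where "projective_module R P" "\<beta> \<in> mod_hom R P B"
    "\<beta> ` carrier P = carrier B" "proj_res R k (ker_mod P B \<beta>)"
    using res by auto
  then show ?thesis by (rule max_ideal_finite_resI[OF B ret])
qed

text \<open>Such an \<open>a\<close> kills the first syzygy, whose entries lie in
  \<open>\<mm>\<close> by minimality. If \<open>a\<close> were not zero, this syzygy would vanish;
  then \<open>\<mm>\<close> would be free and killed by \<open>a\<close>, hence zero.\<close>

lemma socle_zero:
  fixes I :: "nat set"
  assumes fin: "max_ideal_finite_res R \<mm>" and min: "min_cover R \<mm> I \<alpha> (ideal_module R \<mm>)"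
    and nz: "\<mm> \<noteq> {\<zero>}"
    and a: "a \<in> carrier R" "\<And>r. r \<in> \<mm> \<Longrightarrow> r \<otimes> a = \<zero>"
  shows "a = \<zero>"
proof (rule ccontr)
  assume a0: "a \<noteq> \<zero>"
  let ?M = "ideal_module R \<mm>" let ?F = "free_mod R I"
  have ar: "a \<otimes> r = \<zero>" if "r \<in> \<mm>" for r
    using a(2)[OF that] m_comm[OF a(1) max_simps(1)[OF that]] by simp
  have c: "is_cover R I \<alpha> ?M" using min by (simp add: min_cover_def)
  note c' = is_coverD[OF c]
  obtain j where res: "min_res R \<mm> j (ker_mod ?F ?M \<alpha>)"
    using fin c unfolding max_ideal_finite_res_def by auto
  have K: "module R (ker_mod ?F ?M \<alpha>)"
    by (rule submodule_module[OF free_mod_module' ker_submodule[OF free_mod_module' max_module c'(2)]])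
  have "carrier (ker_mod ?F ?M \<alpha>) = {\<zero>\<^bsub>ker_mod ?F ?M \<alpha>\<^esub>}"
  proof (rule socle_kills_min_res[OF K res _ a(1) a0 ar])
    fix x assume "x \<in> carrier (ker_mod ?F ?M \<alpha>)"
    then have "x k \<in> \<mm>" for k using min by (simp add: min_cover_def)
    then show "a \<odot>\<^bsub>ker_mod ?F ?M \<alpha>\<^esub> x = \<zero>\<^bsub>ker_mod ?F ?M \<alpha>\<^esub>" by (simp add: free_mod_sel ar)
  qed
  then have "carrier ?M = {\<zero>\<^bsub>?M\<^esub>}"
    by (intro socle_kills_free_cover[OF max_module c _ a(1) a0]) (simp_all add: ar)
  then show False using nz by simp
qed

text \<open>\<open>\<alpha>\<close> is composed with the elementary automorphism
  \<open>\<sigma>\<close> that adds \<open>w\<close> to the \<open>i\<close>-th unit vector; as the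
  \<open>i\<close>-th coordinate of \<open>w\<close> is zero, subtracting inverts it.\<close>

lemma cover_change_generator:
  assumes c: "is_cover R I \<alpha> (ideal_module R \<mm>)" and i: "i \<in> I" and w: "w \<in> carrier (free_mod R (I - {i}))"
  shows "\<exists>\<beta>. is_cover R I \<beta> (ideal_module R \<mm>) \<and> \<beta> (unit_vec R i) = \<alpha> (unit_vec R i) \<oplus> \<alpha> w"
proof -
  let ?F = "free_mod R I"
  note c' = is_coverD[OF c]
  interpret F: module R ?F by (rule free_mod_module')
  have wF: "w \<in> carrier ?F" by (rule subsetD[OF free_mod_Diff_subset w])
  have wi: "w i = \<zero>" using w c'(1) by (simp add: free_mod_carrier)
  have e: "unit_vec R i \<in> carrier ?F" by (rule unit_vec_closed[OF i])
  have vc: "v k \<in> carrier R" if "v \<in> carrier ?F" for v k using that by (simp add: free_mod_carrier[OF c'(1)])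
  define \<sigma> where "\<sigma> v = v \<oplus>\<^bsub>?F\<^esub> v i \<odot>\<^bsub>?F\<^esub> w" for v
  have s: "\<sigma> \<in> mod_hom R ?F ?F"
  proof (rule mod_homI)
    fix x y assume x: "x \<in> carrier ?F" and y: "y \<in> carrier ?F"
    show "\<sigma> (x \<oplus>\<^bsub>?F\<^esub> y) = \<sigma> x \<oplus>\<^bsub>?F\<^esub> \<sigma> y"
      using vc[OF wF] vc[OF x] vc[OF y] by (simp add: \<sigma>_def free_mod_sel l_distr a_ac)
  next
    fix a x assume a: "a \<in> carrier R" and x: "x \<in> carrier ?F"
    show "\<sigma> (a \<odot>\<^bsub>?F\<^esub> x) = a \<odot>\<^bsub>?F\<^esub> \<sigma> x"
      using a vc[OF wF] vc[OF x] by (simp add: \<sigma>_def free_mod_sel m_assoc r_distr)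
  qed (use wF vc in \<open>simp add: \<sigma>_def\<close>)
  have "is_cover R I (\<lambda>v. \<alpha> (\<sigma> v)) (ideal_module R \<mm>)"
  proof (rule is_coverI[OF c'(1) mod_hom_comp[OF s c'(2)]])
    fix y assume "y \<in> carrier (ideal_module R \<mm>)"
    with c obtain v where v: "v \<in> carrier ?F" "\<alpha> v = y" by (rule is_cover_surjE)
    define v' where "v' = v \<oplus>\<^bsub>?F\<^esub> (\<ominus> v i) \<odot>\<^bsub>?F\<^esub> w"
    have "v' \<in> carrier ?F" using v wF vc by (simp add: v'_def)
    moreover have "\<sigma> v' = v"
      using vc[OF v(1)] vc[OF wF] wi by (simp add: \<sigma>_def v'_def free_mod_sel l_minus a_assoc l_neg)
    ultimately show "\<exists>v\<in>carrier ?F. \<alpha> (\<sigma> v) = y" using v(2) by (intro bexI[of _ v']) simp_all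
  qed
  moreover have "\<alpha> (\<sigma> (unit_vec R i)) = \<alpha> (unit_vec R i) \<oplus> \<alpha> w"
  proof -
    have "\<sigma> (unit_vec R i) = unit_vec R i \<oplus>\<^bsub>?F\<^esub> w"
      using wF by (simp add: \<sigma>_def unit_vec_def[of R i, THEN fun_cong, of i])
    then show ?thesis using mod_homD(2)[OF c'(2) e wF] by simp
  qed
  ultimately show ?thesis by (intro exI[of _ "\<lambda>v. \<alpha> (\<sigma> v)"]) simp
qed

lemma nonzerodivisor_generator:
  fixes I :: "nat set"
  assumes fin: "max_ideal_finite_res R \<mm>"
    and min: "min_cover R \<mm> I \<alpha> (ideal_module R \<mm>)" and nz: "\<mm> \<noteq> {\<zero>}" and i: "i \<in> I"
  shows "\<exists>\<beta>. is_cover R I \<beta> (ideal_module R \<mm>) \<and> nonzerodivisor R (\<beta> (unit_vec R i))"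
proof -
  let ?F = "free_mod R I" and ?G = "free_mod R (I - {i})" and ?M = "ideal_module R \<mm>"
  have c: "is_cover R I \<alpha> ?M" using min by (simp add: min_cover_def)
  note c' = is_coverD[OF c]
  interpret F: module R ?F by (rule free_mod_module')
  have e: "unit_vec R i \<in> carrier ?F" by (rule unit_vec_closed[OF i])
  have h: "\<alpha> (unit_vec R i) \<in> carrier R" using mod_homD(1)[OF c'(2) e] max_simps(1) by simp
  have \<alpha>G: "\<alpha> \<in> mod_hom R ?G ?M" by (rule mod_hom_free_mod_mono[OF c'(2)]) auto
  \<comment> \<open>The ideal generated by the generators other than the
    \<open>i\<close>-th.\<close>
  let ?J = "\<alpha> ` carrier ?G"
  note j = submoduleD[OF max_module image_submodule[OF free_mod_module' max_module \<alpha>G]]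
  have J: "ideal ?J R"
  proof (rule idealI')
    show "?J \<subseteq> carrier R" using j(1) max_simps(1) by auto
  qed (use j(2-4) in simp_all)
  have "\<exists>j\<in>?J. nonzerodivisor R (\<alpha> (unit_vec R i) \<oplus> j)"
  proof (rule nonzerodivisor_coset[OF J h])
    show "a = \<zero>" if "a \<in> carrier R" "\<And>r. r \<in> \<mm> \<Longrightarrow> r \<otimes> a = \<zero>" for a
      by (rule socle_zero[OF fin min nz that])
    fix P assume P: "ideal P R" "\<alpha> (unit_vec R i) \<in> P" "?J \<subseteq> P"
    interpret P: ideal P R by fact
    show "\<mm> \<subseteq> P"
    proof
      fix y assume "y \<in> \<mm>"
      then have "y \<in> carrier ?M" by simp
      with c obtain v where v: "v \<in> carrier ?F" "\<alpha> v = y" by (rule is_cover_surjE)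
      obtain v' where v': "v' \<in> carrier ?G" "v = v' \<oplus>\<^bsub>?F\<^esub> v i \<odot>\<^bsub>?F\<^esub> unit_vec R i"
        by (rule free_mod_split[OF c'(1) i v(1)])
      have vi: "v i \<in> carrier R" using v(1) by (simp add: free_mod_carrier[OF c'(1)])
      have v'F: "v' \<in> carrier ?F" by (rule subsetD[OF free_mod_Diff_subset v'(1)])
      have "y = \<alpha> (v' \<oplus>\<^bsub>?F\<^esub> v i \<odot>\<^bsub>?F\<^esub> unit_vec R i)" using v'(2) v(2) by simp
      also have "\<dots> = \<alpha> v' \<oplus> v i \<otimes> \<alpha> (unit_vec R i)"
        using mod_homD(2)[OF c'(2) v'F F.smult_closed[OF vi e]] mod_homD(3)[OF c'(2) vi e] by simp
      finally show "y \<in> P" using P(2,3) v'(1) vi P.I_l_closed by auto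
    qed
  qed
  then obtain w where w: "w \<in> carrier ?G" "nonzerodivisor R (\<alpha> (unit_vec R i) \<oplus> \<alpha> w)" by blast
  obtain \<beta> where "is_cover R I \<beta> ?M" "\<beta> (unit_vec R i) = \<alpha> (unit_vec R i) \<oplus> \<alpha> w"
    using cover_change_generator[OF c i w(1)] by blast
  then show ?thesis using w(2) by (intro exI[of _ \<beta>]) simp
qed

end

section \<open>The maximal ideal of the quotient by \<open>z\<close>\<close>

context regular_quotient
begin

lemma kernel_saturated:
  assumes c: "is_cover R I \<alpha> (ideal_module R \<mm>)"
    and u: "u \<in> carrier (free_mod R I)"
      "z \<odot>\<^bsub>free_mod R I\<^esub> u \<in> ker (free_mod R I) (ideal_module R \<mm>) \<alpha>"
  shows "u \<in> ker (free_mod R I) (ideal_module R \<mm>) \<alpha>"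
proof -
  note c' = is_coverD[OF c]
  have "\<alpha> u \<in> carrier R" using mod_homD(1)[OF c'(2) u(1)] max_simps(1) by simp
  moreover have "z \<otimes> \<alpha> u = \<zero>"
    using u(2) mod_homD(3)[OF c'(2) z_closed u(1)] by (simp add: ker_def)
  ultimately have "\<alpha> u = \<zero>" by (rule z_cancel)
  then show ?thesis using u(1) by (simp add: ker_def)
qed

text \<open>The retract puts \<open>s\<close> at place \<open>i\<close> of a zero vector and comes
  back by the \<open>i\<close>-th coordinate. The first map lands in the reduced relations because
  \<open>z\<close> is the generator with index \<open>i\<close>; the second lands in the maximal
  ideal of \<open>S\<close> because the cover is minimal.\<close>

lemma max_stable_retract_red_kernel:
  assumes min: "min_cover R \<mm> I \<alpha> (ideal_module R \<mm>)" and i: "i \<in> I" and z: "\<alpha> (unit_vec R i) = z"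
  shows "stable_retract S (ideal_module S (\<pi> ` \<mm>))
    ((free_mod S I)\<lparr>carrier := red (ker (free_mod R I) (ideal_module R \<mm>) \<alpha>)\<rparr>)"
proof -
  let ?F = "free_mod R I" and ?G = "free_mod S I" and ?M = "ideal_module R \<mm>"
  let ?K = "ker ?F ?M \<alpha>"
  have c: "is_cover R I \<alpha> ?M" using min by (simp add: min_cover_def)
  note c' = is_coverD[OF c]
  interpret F: module R ?F by (rule free_mod_module')
  interpret Q: noeth_local S "\<pi> ` \<mm>" by (rule quotient_noeth_local)
  have e: "unit_vec R i \<in> carrier ?F" by (rule R.unit_vec_closed[OF i])
  have K: "submodule ?K R ?F" by (rule ker_submodule[OF free_mod_module' max_module c'(2)])
  have B: "module S (?G\<lparr>carrier := red ?K\<rparr>)"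
    by (rule submodule_module[OF Q.free_mod_module' red_submodule[OF c'(1) K]])
  \<comment> \<open>if \<open>s\<close> is the image of \<open>r = \<alpha> a\<close>, the relation \<open>r e\<^sub>i - z a\<close> lifts \<open>f s\<close>\<close>
  define f where "f s = (\<lambda>k. if k = i then s else \<zero>\<^bsub>S\<^esub>)" for s
  have fK: "f s \<in> red ?K" if s: "s \<in> \<pi> ` \<mm>" for s
  proof -
    obtain r where r: "r \<in> \<mm>" "s = \<pi> r" by (rule imageE[OF s]) blast
    have rc: "r \<in> carrier R" by (rule max_simps(1)[OF r(1)])
    have "r \<in> carrier ?M" using r(1) by simp
    with c obtain a where a: "a \<in> carrier ?F" "\<alpha> a = r" by (rule is_cover_surjE)
    have ac: "a k \<in> carrier R" for k using a(1) by (simp add: free_mod_carrier[OF c'(1)])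
    have mz: "\<ominus> z \<in> carrier R" using z_closed by simp
    define v where "v = r \<odot>\<^bsub>?F\<^esub> unit_vec R i \<oplus>\<^bsub>?F\<^esub> (\<ominus> z) \<odot>\<^bsub>?F\<^esub> a"
    have "\<alpha> v = r \<otimes> z \<oplus> (\<ominus> z) \<otimes> r"
      unfolding v_def
      using mod_homD(2)[OF c'(2) F.smult_closed[OF rc e] F.smult_closed[OF mz a(1)]]
        mod_homD(3)[OF c'(2) rc e] mod_homD(3)[OF c'(2) mz a(1)] z a(2) by simp
    also have "\<dots> = \<zero>" using rc z_closed by (simp add: l_minus R.m_comm[of r] R.r_neg)
    finally have "v \<in> ?K" using e a(1) rc mz by (simp add: ker_def v_def)
    moreover have "f s = (\<lambda>k. \<pi> (v k))"
      using ac rc z_closed by (auto simp: f_def v_def free_mod_sel unit_vec_def image_z r(2) fun_eq_iff)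
    ultimately show ?thesis unfolding red_def by (intro image_eqI) simp_all
  qed
  have red_max: "w i \<in> \<pi> ` \<mm>" if "w \<in> red ?K" for w
    using that min by (auto simp: red_def min_cover_def)
  show ?thesis
  proof (rule stable_retractI[OF Q.max_module B])
    show "f \<in> mod_hom S (ideal_module S (\<pi> ` \<mm>)) (?G\<lparr>carrier := red ?K\<rparr>)"
      by (rule mod_homI) (use fK in \<open>auto simp: f_def free_mod_sel fun_eq_iff\<close>)
    show "(\<lambda>w. w i) \<in> mod_hom S (?G\<lparr>carrier := red ?K\<rparr>) (ideal_module S (\<pi> ` \<mm>))"
      by (rule mod_homI) (use red_max in \<open>simp_all add: free_mod_sel\<close>)
  qed (simp add: f_def)
qed

lemma quotient_max_ideal_finite_res:
  fixes I :: "nat set"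
  assumes fin: "max_ideal_finite_res R \<mm>" and min: "min_cover R \<mm> I \<alpha> (ideal_module R \<mm>)"
    and i: "i \<in> I" and z: "\<alpha> (unit_vec R i) = z"
  shows "max_ideal_finite_res S (\<pi> ` \<mm>)"
proof -
  let ?F = "free_mod R I" and ?M = "ideal_module R \<mm>"
  have c: "is_cover R I \<alpha> ?M" using min by (simp add: min_cover_def)
  note c' = is_coverD[OF c]
  interpret Q: noeth_local S "\<pi> ` \<mm>" by (rule quotient_noeth_local)
  have K: "submodule (ker ?F ?M \<alpha>) R ?F" by (rule ker_submodule[OF free_mod_module' max_module c'(2)])
  obtain j where "min_res R \<mm> j (ker_mod ?F ?M \<alpha>)"
    using fin c unfolding max_ideal_finite_res_def by auto
  from min_res_red[OF c'(1) K kernel_saturated[OF c] this]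
  have "proj_res S j ((free_mod S I)\<lparr>carrier := red (ker ?F ?M \<alpha>)\<rparr>)"
    by (rule S.min_res_imp_proj_res)
  then show ?thesis
    by (rule Q.max_ideal_finite_resI'[OF submodule_module[OF Q.free_mod_module' red_submodule[OF c'(1) K]]
          max_stable_retract_red_kernel[OF min i z]])
qed

text \<open>The \<open>i\<close>-th generator \<open>z\<close> becomes zero in \<open>S\<close>, so
  the others suffice. This makes the final induction descend.\<close>

lemma quotient_cover:
  assumes c: "is_cover R I \<alpha> (ideal_module R \<mm>)" and i: "i \<in> I" and z: "\<alpha> (unit_vec R i) = z"
  shows "\<exists>\<beta>. is_cover S (I - {i}) \<beta> (ideal_module S (\<pi> ` \<mm>))"
proof -
  let ?F = "free_mod R I" and ?G = "free_mod R (I - {i})" and ?M = "ideal_module R \<mm>"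
  note c' = is_coverD[OF c]
  interpret F: module R ?F by (rule free_mod_module')
  interpret Q: noeth_local S "\<pi> ` \<mm>" by (rule quotient_noeth_local)
  have fI: "finite (I - {i})" using c'(1) by simp
  have e: "unit_vec R i \<in> carrier ?F" by (rule R.unit_vec_closed[OF i])
  have \<alpha>G: "\<alpha> \<in> mod_hom R ?G ?M" by (rule mod_hom_free_mod_mono[OF c'(2)]) auto
  obtain \<beta> where b: "\<beta> \<in> mod_hom S (free_mod S (I - {i})) (ideal_module S (\<pi> ` \<mm>))"
    and bv: "\<And>v. v \<in> carrier ?G \<Longrightarrow> \<beta> (\<lambda>k. \<pi> (v k)) = \<pi> (\<alpha> v)"
    using induced_hom[OF fI max_module Q.max_module \<alpha>G, of \<pi>] max_simps(1) by auto
  have "is_cover S (I - {i}) \<beta> (ideal_module S (\<pi> ` \<mm>))"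
  proof (rule is_coverI[OF fI b])
    fix y assume "y \<in> carrier (ideal_module S (\<pi> ` \<mm>))"
    then obtain r where r: "r \<in> carrier ?M" "y = \<pi> r" by auto
    from c r(1) obtain v where v: "v \<in> carrier ?F" "\<alpha> v = r" by (rule is_cover_surjE)
    obtain v' where v': "v' \<in> carrier ?G" "v = v' \<oplus>\<^bsub>?F\<^esub> v i \<odot>\<^bsub>?F\<^esub> unit_vec R i"
      by (rule R.free_mod_split[OF c'(1) i v(1)])
    have vi: "v i \<in> carrier R" using v(1) by (simp add: free_mod_carrier[OF c'(1)])
    have v'F: "v' \<in> carrier ?F" by (rule subsetD[OF free_mod_Diff_subset v'(1)])
    have a': "\<alpha> v' \<in> carrier R" using mod_homD(1)[OF c'(2) v'F] max_simps(1) by simp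
    have "r = \<alpha> (v' \<oplus>\<^bsub>?F\<^esub> v i \<odot>\<^bsub>?F\<^esub> unit_vec R i)" using v'(2) v(2) by simp
    also have "\<dots> = \<alpha> v' \<oplus> v i \<otimes> z"
      using mod_homD(2)[OF c'(2) v'F F.smult_closed[OF vi e]] mod_homD(3)[OF c'(2) vi e] z by simp
    finally have "y = \<pi> (\<alpha> v')" using r(2) a' vi z_closed by (simp add: image_z)
    then show "\<exists>v\<in>carrier (free_mod S (I - {i})). \<beta> v = y"
      using bv[OF v'(1)] free_mod_image[OF fI v'(1)] by (intro bexI[of _ "\<lambda>k. \<pi> (v' k)"]) simp_all
  qed
  then show ?thesis by (intro exI[of _ \<beta>])
qed

end

text \<open>Regularity written with elements of \<open>R\<close> instead of cosets, so that it can
  be carried along \<open>\<pi>\<close>. Properness of the ideal is supplied at the end, where the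
  ideal is \<open>\<mm>\<close>.\<close>

definition regular_elements :: "('a, 'r) ring_scheme \<Rightarrow> 'a list \<Rightarrow> bool" where
  "regular_elements R xs \<longleftrightarrow> set xs \<subseteq> carrier R \<and>
     (\<forall>j<length xs. \<forall>a\<in>carrier R. xs ! j \<otimes>\<^bsub>R\<^esub> a \<in> Idl\<^bsub>R\<^esub> (set (take j xs)) \<longrightarrow>
        a \<in> Idl\<^bsub>R\<^esub> (set (take j xs)))"

lemma (in cring) genideal_empty: "Idl {} = {\<zero>}"
proof -
  have "Idl {} \<subseteq> {\<zero>}" by (rule genideal_minimal[OF zeroideal]) simp
  then show ?thesis
    using additive_subgroup.zero_closed[OF ideal.axioms(1)[OF genideal_ideal[of "{}"]]] by auto
qed

text \<open>By \<open>genideal_iff\<close> the ideal of \<open>z\<close> and the first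
  \<open>k\<close> lifted elements is the preimage of the ideal of the first \<open>k\<close>
  elements of \<open>ys\<close>. So the condition at place \<open>k + 1\<close> comes from the one
  at place \<open>k\<close> over \<open>S\<close>, and at place \<open>0\<close> it says that
  \<open>z\<close> is a non-zero-divisor.\<close>

lemma (in regular_quotient) lift_regular_elements:
  assumes reg: "regular_elements S ys" and gen: "\<pi> ` \<mm> = Idl\<^bsub>S\<^esub> (set ys)"
  shows "regular_elements R (z # map sec ys) \<and> \<mm> = Idl\<^bsub>R\<^esub> (set (z # map sec ys))"
proof
  have ys: "set ys \<subseteq> carrier S" using reg by (simp add: regular_elements_def)
  have sc: "sec ` T \<subseteq> carrier R" "\<pi> ` sec ` T = T" if "T \<subseteq> carrier S" for T
  proof -
    show "sec ` T \<subseteq> carrier R" using that sec(1) by auto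
    have "\<pi> (sec t) = t" if "t \<in> T" for t using \<open>T \<subseteq> carrier S\<close> that sec(2) by auto
    then show "\<pi> ` sec ` T = T" by (simp add: image_image)
  qed
  have iff: "a \<in> Idl\<^bsub>R\<^esub> (insert z (sec ` T)) \<longleftrightarrow> \<pi> a \<in> Idl\<^bsub>S\<^esub> T"
    if "T \<subseteq> carrier S" "a \<in> carrier R" for a T
    using genideal_iff[OF sc(1)[OF that(1)] that(2)] sc(2)[OF that(1)] by simp
  have zys: "insert z (sec ` set ys) \<subseteq> carrier R" using sc(1)[OF ys] z_closed by simp
  have "a \<in> \<mm> \<longleftrightarrow> a \<in> Idl\<^bsub>R\<^esub> (insert z (sec ` set ys))" if a: "a \<in> carrier R" for a
    unfolding iff[OF ys a] gen[symmetric] using mem_if_image_mem[OF ideal_max z_max a] by auto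
  then show "\<mm> = Idl\<^bsub>R\<^esub> (set (z # map sec ys))"
    using max_simps(1) ideal.Icarr[OF R.genideal_ideal[OF zys]] by auto
  show "regular_elements R (z # map sec ys)"
    unfolding regular_elements_def
  proof (intro conjI allI impI ballI)
    show "set (z # map sec ys) \<subseteq> carrier R" using zys by simp
    fix j a assume j: "j < length (z # map sec ys)" and a: "a \<in> carrier R"
      and m: "(z # map sec ys) ! j \<otimes> a \<in> Idl\<^bsub>R\<^esub> (set (take j (z # map sec ys)))"
    show "a \<in> Idl\<^bsub>R\<^esub> (set (take j (z # map sec ys)))"
    proof (cases j)
      case 0
      then show ?thesis using m a z_cancel by (simp add: R.genideal_empty)
    next
      case (Suc k)
      have k: "k < length ys" using j Suc by simp
      have t: "set (take k ys) \<subseteq> carrier S" using ys set_take_subset[of k ys] by blast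
      have yk: "ys ! k \<in> carrier S" using ys k by (meson nth_mem subsetD)
      have set: "set (take j (z # map sec ys)) = insert z (sec ` set (take k ys))"
        by (simp add: Suc take_map)
      have "sec (ys ! k) \<otimes> a \<in> Idl\<^bsub>R\<^esub> (insert z (sec ` set (take k ys)))"
        using m k unfolding set by (simp add: Suc)
      then have "\<pi> (sec (ys ! k) \<otimes> a) \<in> Idl\<^bsub>S\<^esub> (set (take k ys))"
        using iff[OF t] sec(1)[OF yk] a by simp
      then have "ys ! k \<otimes>\<^bsub>S\<^esub> \<pi> a \<in> Idl\<^bsub>S\<^esub> (set (take k ys))"
        using sec(1,2)[OF yk] a by simp
      then have "\<pi> a \<in> Idl\<^bsub>S\<^esub> (set (take k ys))"
        using reg k a unfolding regular_elements_def by simp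
      then show ?thesis unfolding set by (simp add: iff[OF t a])
    qed
  qed
qed

text \<open>Induction on the number of generators, for all rings of the given type at once. A cover
  with fewest generators is taken, one of them is made a non-zero-divisor, and the quotient by it
  again has a maximal ideal with finite resolutions, covered by one generator less.\<close>

lemma regular_elements_generate_max:
  fixes R :: "('a, 'r) ring_scheme" and I :: "nat set"
  assumes "noeth_local R \<mm>" "max_ideal_finite_res R \<mm>" "is_cover R I \<alpha> (ideal_module R \<mm>)"
  shows "\<exists>xs. regular_elements R xs \<and> \<mm> = Idl\<^bsub>R\<^esub> (set xs)"
  using assms
proof (induction "card I" arbitrary: R \<mm> I \<alpha> rule: less_induct)
  case less
  interpret noeth_local R \<mm> by fact
  let ?M = "ideal_module R \<mm>"
  note fin = less.prems(2)
  show ?case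
  proof (cases "\<mm> = {\<zero>\<^bsub>R\<^esub>}")
    case True
    then show ?thesis
      by (intro exI[of _ "[]"]) (simp add: regular_elements_def genideal_empty)
  next
    case nz: False
    \<comment> \<open>Minimality refers to all covers, not to one fixed map. So every cover with
      index set \<open>L\<close> is minimal, in particular \<open>\<beta>\<close> below, whose
      generator with index \<open>i\<close> is \<open>z\<close>.\<close>
    define C where "C I \<longleftrightarrow> (\<exists>\<alpha>. is_cover R (I :: nat set) \<alpha> ?M)" for I
    have "C I" using less.prems(3) unfolding C_def by blast
    then obtain L where L: "C L" "\<And>J. C J \<Longrightarrow> card L \<le> card J"
      using ex_has_least_nat[of C I card] by auto
    have LI: "card L \<le> card I" by (rule L(2)[OF \<open>C I\<close>])
    have min: "min_cover R \<mm> L \<alpha> ?M" if "is_cover R L \<alpha> ?M" for \<alpha>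
    proof (rule min_cover_if_min_card[OF max_module that])
      show "card L \<le> card J" if "is_cover R J \<alpha> ?M" for J
        by (rule L(2)) (use that in \<open>auto simp: C_def\<close>)
    qed
    obtain \<gamma> where \<gamma>: "is_cover R L \<gamma> ?M" using L(1) unfolding C_def by blast
    have "L \<noteq> {}"
    proof
      assume "L = {}"
      have "y = \<zero>\<^bsub>R\<^esub>" if "y \<in> \<mm>" for y
      proof -
        have "y \<in> carrier ?M" using that by simp
        with \<gamma> obtain v where v: "v \<in> carrier (free_mod R L)" "\<gamma> v = y" by (rule is_cover_surjE)
        have "v = \<zero>\<^bsub>free_mod R L\<^esub>"
          using v(1) \<open>L = {}\<close> by (auto simp: free_mod_carrier free_mod_sel fun_eq_iff)
        then show ?thesis using mod_hom_zero[OF free_mod_module' max_module is_coverD(2)[OF \<gamma>]] v(2) by simp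
      qed
      then have "\<mm> \<subseteq> {\<zero>\<^bsub>R\<^esub>}" by (intro subsetI) simp
      moreover have "{\<zero>\<^bsub>R\<^esub>} \<subseteq> \<mm>" using max_simps(2) by simp
      ultimately have "\<mm> = {\<zero>\<^bsub>R\<^esub>}" by (rule subset_antisym)
      with nz show False ..
    qed
    then obtain i where i: "i \<in> L" by blast
    obtain \<beta> where \<beta>: "is_cover R L \<beta> ?M" "nonzerodivisor R (\<beta> (unit_vec R i))"
      using nonzerodivisor_generator[OF fin min[OF \<gamma>] nz i] by blast
    define z where "z = \<beta> (unit_vec R i)"
    have z: "z \<in> \<mm>" using mod_homD(1)[OF is_coverD(2)[OF \<beta>(1)] unit_vec_closed[OF i]] by (simp add: z_def)
    have zc: "z \<in> carrier R" by (rule max_simps(1)[OF z])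
    obtain S :: "('a, 'r) ring_scheme" and \<pi> where S: "cring S" "\<pi> \<in> ring_hom R S" "\<pi> ` carrier R = carrier S"
      "\<And>a. a \<in> carrier R \<Longrightarrow> \<pi> a = \<zero>\<^bsub>S\<^esub> \<longleftrightarrow> a \<in> PIdl\<^bsub>R\<^esub> z"
      using quotient_ring_same_type[OF cgenideal_ideal[OF zc]] by blast
    have pz: "a \<in> PIdl\<^bsub>R\<^esub> z \<longleftrightarrow> (\<exists>b\<in>carrier R. a = z \<otimes>\<^bsub>R\<^esub> b)" for a
      unfolding cgenideal_def using m_comm[OF zc] by auto
    interpret Q: regular_quotient R \<mm> S \<pi> z
      by (intro regular_quotient.intro regular_quotient_axioms.intro noeth_local_axioms less.prems(1) S(1,2,3) z)
        (use S(4) pz \<beta>(2) in \<open>simp_all add: z_def\<close>)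
    obtain \<delta> where \<delta>: "is_cover S (L - {i}) \<delta> (ideal_module S (\<pi> ` \<mm>))"
      using Q.quotient_cover[OF \<beta>(1) i z_def[symmetric]] by blast
    have "card (L - {i}) < card I"
      using card_Diff1_less[OF is_coverD(1)[OF \<gamma>] i] LI by linarith
    from less.hyps[OF this Q.quotient_noeth_local
        Q.quotient_max_ideal_finite_res[OF fin min[OF \<beta>(1)] i z_def[symmetric]] \<delta>]
    obtain ys where "regular_elements S ys" "\<pi> ` \<mm> = Idl\<^bsub>S\<^esub> (set ys)" by blast
    from Q.lift_regular_elements[OF this] show ?thesis by (rule exI)
  qed
qed

lemma (in cring) regular_sequence_if_regular_elements:
  assumes reg: "regular_elements R xs" and ne: "Idl (set xs) \<noteq> carrier R"
  shows "regular_sequence R xs"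
  unfolding regular_sequence_def Let_def
proof (intro conjI allI impI ballI ne)
  show xs: "set xs \<subseteq> carrier R" using reg by (simp add: regular_elements_def)
  fix j a
  let ?I = "Idl (set (take j xs))"
  assume j: "j < length xs" and a: "a \<in> carrier (R Quot ?I)"
    and z: "(?I +> xs ! j) \<otimes>\<^bsub>R Quot ?I\<^esub> a = \<zero>\<^bsub>R Quot ?I\<^esub>"
  have "set (take j xs) \<subseteq> carrier R" using xs set_take_subset[of j xs] by blast
  then have I: "ideal ?I R" by (rule genideal_ideal)
  interpret I: ideal ?I R by fact
  have xj: "xs ! j \<in> carrier R" using xs j by (meson nth_mem subsetD)
  obtain b where b: "b \<in> carrier R" "a = ?I +> b"
    using a by (auto simp: FactRing_def A_RCOSETS_def' a_r_coset_def)
  have "?I +> (xs ! j \<otimes> b) = ?I"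
    using z b I.rcoset_mult_add[OF xj b(1)] by (simp add: FactRing_def)
  then have "xs ! j \<otimes> b \<in> ?I" using I.rcos_const_imp_mem xj b(1) by simp
  then have "b \<in> ?I" using reg j b(1) unfolding regular_elements_def by blast
  then show "a = \<zero>\<^bsub>R Quot ?I\<^esub>" using a_rcos_zero[OF I] b(2) by (simp add: FactRing_def)
qed

text \<open>A non-unit generates a proper ideal. A maximal member among the proper ideals above it
  is a maximal ideal, hence \<open>\<mm>\<close>.\<close>

lemma local_ring_imp_noeth_local:
  fixes R :: "('a, 'r) ring_scheme"
  assumes N: "noetherian_ring R" and L: "local_ring R \<mm>"
  shows "noeth_local R \<mm>"
proof -
  interpret noetherian_ring R by fact
  have C: "cring R" and M: "maximalideal \<mm> R" and uniq: "\<And>J. maximalideal J R \<Longrightarrow> J = \<mm>"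
    using L by (auto simp: local_ring_def)
  interpret cring R by fact
  interpret M: maximalideal \<mm> R by fact
  show ?thesis
  proof (intro noeth_local.intro noeth_local_axioms.intro C N M.is_ideal)
    show "\<mm> \<noteq> carrier R" using M.I_notcarr by simp
    fix a assume a: "a \<in> carrier R" "a \<notin> \<mm>"
    note pa = cgenideal_ideal[OF a(1)]
    show "a \<in> Units R"
    proof (rule ccontr)
      assume nu: "a \<notin> Units R"
      have "\<one>\<^bsub>R\<^esub> \<notin> PIdl\<^bsub>R\<^esub> a"
      proof
        assume "\<one>\<^bsub>R\<^esub> \<in> PIdl\<^bsub>R\<^esub> a"
        then obtain b where b: "b \<in> carrier R" "b \<otimes>\<^bsub>R\<^esub> a = \<one>\<^bsub>R\<^esub>"
          unfolding cgenideal_def by (elim CollectE exE conjE) simp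
        then have "a \<otimes>\<^bsub>R\<^esub> b = \<one>\<^bsub>R\<^esub>" using m_comm[OF a(1)] by simp
        with a(1) b have "a \<in> Units R" unfolding Units_def by (intro CollectI conjI bexI[of _ b])
        with nu show False ..
      qed
      define \<F> where "\<F> = {J. ideal J R \<and> PIdl\<^bsub>R\<^esub> a \<subseteq> J \<and> \<one>\<^bsub>R\<^esub> \<notin> J}"
      have pF: "PIdl\<^bsub>R\<^esub> a \<in> \<F>" using pa \<open>\<one>\<^bsub>R\<^esub> \<notin> PIdl\<^bsub>R\<^esub> a\<close> by (simp add: \<F>_def)
      have idl: "ideal J R" if "J \<in> \<F>" for J using that by (simp add: \<F>_def)
      obtain K where K: "K \<in> \<F>" and max: "\<And>J. J \<in> \<F> \<Longrightarrow> K \<subseteq> J \<Longrightarrow> J = K"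
        using ideal_family_has_maximal[OF pF idl] by blast
      have "maximalideal K R"
      proof (rule maximalidealI)
        show "ideal K R" using K by (simp add: \<F>_def)
        show "carrier R \<noteq> K" using K by (auto simp: \<F>_def)
        fix J assume J: "ideal J R" "K \<subseteq> J" "J \<subseteq> carrier R"
        show "J = K \<or> J = carrier R"
        proof (cases "\<one>\<^bsub>R\<^esub> \<in> J")
          case True
          then show ?thesis using ideal.one_imp_carrier[OF J(1)] by simp
        next
          case False
          then have "J \<in> \<F>" using K J(1,2) by (auto simp: \<F>_def)
          then show ?thesis using max J(2) by blast
        qed
      qed
      then have "K = \<mm>" by (rule uniq)
      then have "PIdl\<^bsub>R\<^esub> a \<subseteq> \<mm>" using K by (simp add: \<F>_def)
      then show False using cgenideal_self[OF a(1)] a(2) by blast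
    qed
  qed
qed

text \<open>The exact sequence is cut into its successive kernels, each of which is the image of the
  next map.\<close>

lemma projective_resolution_imp_proj_res:
  fixes P :: "nat \<Rightarrow> ('a, 'p) module"
  assumes res: "projective_resolution R M n P d e"
  shows "proj_res R (Suc n) (ker_mod (P 0) M e)"
proof -
  have proj: "\<And>i. projective_module R (P i)" and zero: "\<And>i. i > n \<Longrightarrow> carrier (P i) = {\<zero>\<^bsub>P i\<^esub>}"
    and d: "\<And>i. d i \<in> mod_hom R (P (Suc i)) (P i)"
    and d0: "d 0 ` carrier (P (Suc 0)) = ker (P 0) M e"
    and ds: "\<And>i. d (Suc i) ` carrier (P (Suc (Suc i))) = ker (P (Suc i)) (P i) (d i)"
    using res unfolding projective_resolution_def ker_def by simp_all
  have mP: "module R (P i)" for i using proj[of i] by (simp add: projective_module_def)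
  have restrict: "f \<in> mod_hom R A (ker_mod B C g)"
    if "f \<in> mod_hom R A B" "f ` carrier A = ker B C g" for f g and A B C :: "('a, 'p) module"
    using that by (auto simp: mod_hom_def)
  \<comment> \<open>For \<open>i = n\<close> the kernel is zero, since \<open>P (Suc n)\<close> is.
    Each smaller index costs one more step, and so does the passage to the kernel of
    \<open>e\<close>, which gives \<open>Suc n\<close>.\<close>
  have tail: "proj_res R k (ker_mod (P (Suc i)) (P i) (d i))" if "i + k = n" for i k
    using that
  proof (induction k arbitrary: i)
    case 0
    then have z: "carrier (P (Suc i)) = {\<zero>\<^bsub>P (Suc i)\<^esub>}" using zero by simp
    have "d i \<zero>\<^bsub>P (Suc i)\<^esub> = \<zero>\<^bsub>P i\<^esub>" by (rule mod_hom_zero[OF mP mP d])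
    with z show ?case by (auto simp: ker_def)
  next
    case (Suc k)
    let ?N = "ker_mod (P (Suc i)) (P i) (d i)"
    have "proj_res R k (ker_mod (P (Suc (Suc i))) (P (Suc i)) (d (Suc i)))"
      using Suc.IH[of "Suc i"] Suc.prems by simp
    moreover have "ker (P (Suc (Suc i))) ?N (d (Suc i)) = ker (P (Suc (Suc i))) (P (Suc i)) (d (Suc i))"
      by (simp add: ker_def)
    moreover have "d (Suc i) \<in> mod_hom R (P (Suc (Suc i))) ?N" by (rule restrict[OF d ds])
    ultimately show ?case
      unfolding proj_res.simps using proj ds
      by (intro exI[of _ "P (Suc (Suc i))"] exI[of _ "d (Suc i)"]) simp
  qed
  have "d 0 \<in> mod_hom R (P (Suc 0)) (ker_mod (P 0) M e)"
    using d[of 0] d0 by (auto simp: mod_hom_def)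
  moreover have "ker (P (Suc 0)) (ker_mod (P 0) M e) (d 0) = ker (P (Suc 0)) (P 0) (d 0)"
    by (simp add: ker_def)
  ultimately show ?thesis
    unfolding proj_res.simps using tail[of 0 n] proj d0
    by (intro exI[of _ "P (Suc 0)"] exI[of _ "d 0"]) simp
qed

theorem theorem5p11:
  fixes R :: "('a, 'r) ring_scheme" and \<mm> :: "'a set"
  assumes "noetherian_ring R" and "local_ring R \<mm>"
    and "finite_projective_dimension TYPE('p) R (ideal_module R \<mm>)"
  shows "\<exists>xs. regular_sequence R xs \<and> \<mm> = Idl\<^bsub>R\<^esub> (set xs)"
proof -
  interpret noeth_local R \<mm> by (rule local_ring_imp_noeth_local[OF assms(1,2)])
  let ?M = "ideal_module R \<mm>"
  obtain n and P :: "nat \<Rightarrow> ('a, 'p) module" and d e where res: "projective_resolution R ?M n P d e"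
    using assms(3) unfolding finite_projective_dimension_def by blast
  \<comment> \<open>The first comparison is of \<open>\<mm>\<close> with itself: the given
    projective resolution against minimal covers.\<close>
  have ret: "stable_retract R ?M ?M"
    by (rule stable_retractI[OF max_module max_module, of "\<lambda>x. x" "\<lambda>x. x"]) (auto simp: mod_hom_def)
  have P: "projective_module R (P 0)" and e: "e \<in> mod_hom R (P 0) ?M" "e ` carrier (P 0) = carrier ?M"
    using res unfolding projective_resolution_def by simp_all
  have fin: "max_ideal_finite_res R \<mm>"
    by (rule max_ideal_finite_resI[OF max_module ret P e projective_resolution_imp_proj_res[OF res]])
  obtain S where S: "S \<subseteq> carrier R" "finite S" "\<mm> = Idl\<^bsub>R\<^esub> S"
    using finetely_gen[OF ideal_max] by blast
  \<comment> \<open>Generation as an ideal is turned into generation as a module: a submodule of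
    \<open>ideal_module R \<mm>\<close> is an ideal of \<open>R\<close>.\<close>
  have "\<exists>(I :: nat set) \<alpha>. finite I \<and> \<alpha> \<in> mod_hom R (free_mod R I) ?M \<and> \<alpha> ` carrier (free_mod R I) = carrier ?M"
  proof (rule fg_imp_surjection[OF max_module S(2)])
    show "S \<subseteq> carrier ?M" using genideal_self[OF S(1)] S(3) by simp
    fix L assume L: "submodule L R ?M" "S \<subseteq> L"
    note l = submoduleD[OF max_module L(1)]
    have "ideal L R"
    proof (rule idealI')
      show "L \<subseteq> carrier R" using l(1) max_simps(1) by auto
    qed (use l(2-4) in simp_all)
    then show "carrier ?M \<subseteq> L" using genideal_minimal[OF _ L(2)] S(3) by simp
  qed
  then obtain I :: "nat set" and \<alpha> where "is_cover R I \<alpha> ?M" unfolding is_cover_def by blast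
  from regular_elements_generate_max[OF noeth_local_axioms fin this]
  obtain xs where xs: "regular_elements R xs" "\<mm> = Idl\<^bsub>R\<^esub> (set xs)" by blast
  have "regular_sequence R xs"
    by (rule regular_sequence_if_regular_elements[OF xs(1)]) (use xs(2) proper_max in simp)
  with xs(2) show ?thesis by blast
qed

end
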